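(* Let $(L,R)$, $(\beta_{j,n})$, $(\nu_t)$, $(X_j)$ and $V_t$ be as in the context. Assume that the distribution function $F_0$ of $X_1$ satisfies \[ \lim_{x\to+\infty} x\,(1-F_0(x))=c_0^+,\qquad \lim_{x\to-\infty}|x|\,F_0(x)=c_0^-, \] with $c_0^+=c_0^->0$, and that \[ \lim_{R\to+\infty}\int_{(-R,R)}x\,dF_0(x)=\gamma_0 \] for some $\gamma_0\in(-\infty,+\infty)$. If $\mu(\delta)<\mu(1)<+\infty$ for some $\delta>1$, then $e^{-\mu(1)t}V_t$ converges in distribution, as $t\to+\infty$, to a random variable $V_\infty$ with characteristic function \[ \mathbb E[e^{i\xi V_\infty}]=\mathbb E\big[\exp\{Z_\infty(1)\,(i\gamma_0\xi-c_0^+\pi|\xi|)\}\big]\qquad(\xi\in\mathbb R), \] where the law of $Z_\infty(1)$ is the unique law of a positive random variable $Z$ with $\mathbb E[Z]=1$ solving the distributional fixed point equation $Z\overset{\mathcal L}{=}\Theta^{\mathcal S(1)}(L Z_1+RZ_2)$.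
   Context: $(L,R)$ is a random vector with $L,R\ge 0$ and $P\{L>0\}+P\{R>0\}>1$. For $s\ge0$ set $\mathcal S(s):=\mathbb E[L^s+R^s]-1\in[-1,+\infty]$ (with $0^0=0$) and for $s>0$ set $\mu(s):=\mathcal S(s)/s$. Let $(L_n,R_n)_{n\ge1}$ be i.i.d. copies of $(L,R)$ and $(I_n)_{n\ge1}$ independent random variables, independent of $(L_n,R_n)_n$, with $I_n$ uniform on $\{1,\dots,n\}$. Define weights $\beta_{1,1}:=1$, $(\beta_{1,2},\beta_{2,2}):=(L_1,R_1)$ and for $n\ge2$: $(\beta_{1,n+1},\dots,\beta_{n+1,n+1}):=(\beta_{1,n},\dots,\beta_{I_n-1,n},L_n\beta_{I_n,n},R_n\beta_{I_n,n},\beta_{I_n+1,n},\dots,\beta_{n,n})$. $(\nu_t)_{t\ge0}$ is a Yule process started at $\nu_0=1$ (pure birth process with rate $n$ in state $n$), so $P\{\nu_t=n\}=e^{-t}(1-e^{-t})^{n-1}$. $(X_j)_{j\ge1}$ are i.i.d. real random variables with distribution function $F_0$. The families $(X_j)$, $(\nu_t)$ and $((L_n,R_n,I_n))_n$ are independent. $V_t:=\sum_{j=1}^{\nu_t}\beta_{j,\nu_t}X_j$. In the fixed point equation, $Z,Z_1,Z_2$ are i.i.d., $\Theta$ is uniform on $(0,1)$, and $(Z,Z_1,Z_2)$, $\Theta$, $(L,R)$ are independent. *)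

theory Defs
  imports "HOL-Probability.Probability"
begin

text \<open>Q is the law of (L,R) on real x real. Note that in Isabelle 0 powr s = 0 for all s,
  which matches the convention 0^0 = 0.\<close>

definition Sfun :: "(real \<times> real) measure \<Rightarrow> real \<Rightarrow> ereal" where
  "Sfun Q s = enn2ereal (\<integral>\<^sup>+ p. ennreal (fst p powr s + snd p powr s) \<partial>Q) - 1"

definition mufun :: "(real \<times> real) measure \<Rightarrow> real \<Rightarrow> ereal" where
  "mufun Q s = Sfun Q s / ereal s"

text \<open>beta_list l r i m is the list (beta_{1,m+1}, ..., beta_{m+1,m+1}) for the sample
  paths l n = L_n, r n = R_n, i n = I_n (indices from 1).  The step from n=1 to n=2 splits
  the single weight (I_1 = 1 necessarily).\<close>

primrec beta_list :: "(nat \<Rightarrow> real) \<Rightarrow> (nat \<Rightarrow> real) \<Rightarrow> (nat \<Rightarrow> nat) \<Rightarrow> nat \<Rightarrow> real list" where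
  "beta_list l r i 0 = [1]"
| "beta_list l r i (Suc m) =
     (let n = Suc m; b = beta_list l r i m; k = (if n = 1 then 1 else i n)
      in take (k - 1) b @ [l n * b ! (k - 1), r n * b ! (k - 1)] @ drop k b)"

definition beta :: "(nat \<Rightarrow> real) \<Rightarrow> (nat \<Rightarrow> real) \<Rightarrow> (nat \<Rightarrow> nat) \<Rightarrow> nat \<Rightarrow> nat \<Rightarrow> real" where
  "beta l r i j n = beta_list l r i (n - 1) ! (j - 1)"

text \<open>With independent holding times h k ~ Exp(k) (time spent in state k), the Yule process
  started at 1 is nu_t = 1 + #{k >= 1. h 1 + ... + h k <= t}.\<close>

definition yule :: "(nat \<Rightarrow> real) \<Rightarrow> real \<Rightarrow> nat" where
  "yule h t = 1 + card {k. 1 \<le> k \<and> (\<Sum>j=1..k. h j) \<le> t}"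

definition Vfun :: "(nat \<Rightarrow> real) \<Rightarrow> (nat \<Rightarrow> real) \<Rightarrow> (nat \<Rightarrow> nat) \<Rightarrow> (nat \<Rightarrow> real)
                     \<Rightarrow> (nat \<Rightarrow> real) \<Rightarrow> real \<Rightarrow> real" where
  "Vfun l r i h x t = (\<Sum>j=1..yule h t. beta l r i j (yule h t) * x j)"

datatype vidx = XI nat | HI nat | LRI nat | II nat

definition vidx_set :: "vidx set" where
  "vidx_set = {XI j |j. 1 \<le> j} \<union> {HI k |k. 1 \<le> k} \<union> {LRI n |n. 1 \<le> n} \<union> {II n |n. 1 \<le> n}"

fun vfam :: "(nat \<Rightarrow> 'a \<Rightarrow> real) \<Rightarrow> (nat \<Rightarrow> 'a \<Rightarrow> real) \<Rightarrow> (nat \<Rightarrow> 'a \<Rightarrow> real \<times> real)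
             \<Rightarrow> (nat \<Rightarrow> 'a \<Rightarrow> nat) \<Rightarrow> vidx \<Rightarrow> 'a \<Rightarrow> real \<times> real" where
  "vfam X H LR I (XI j) = (\<lambda>\<omega>. (X j \<omega>, 0))"
| "vfam X H LR I (HI k) = (\<lambda>\<omega>. (H k \<omega>, 0))"
| "vfam X H LR I (LRI n) = LR n"
| "vfam X H LR I (II n) = (\<lambda>\<omega>. (real (I n \<omega>), 0))"

definition conv_distr_at_top :: "(real \<Rightarrow> real measure) \<Rightarrow> real measure \<Rightarrow> bool" where
  "conv_distr_at_top P N \<longleftrightarrow>
     (\<forall>s :: nat \<Rightarrow> real. filterlim s at_top sequentially \<longrightarrow> weak_conv_m (\<lambda>n. P (s n)) N)"

definition fp_rhs :: "(real \<times> real) measure \<Rightarrow> real \<Rightarrow> real measure \<Rightarrow> real measure" where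
  "fp_rhs Q a \<zeta> =
     distr ((uniform_measure lborel {0<..<1} \<Otimes>\<^sub>M Q) \<Otimes>\<^sub>M (\<zeta> \<Otimes>\<^sub>M \<zeta>)) borel
       (\<lambda>((\<theta>, (l, r)), (z1, z2)). \<theta> powr a * (l * z1 + r * z2))"

definition is_Zlaw :: "(real \<times> real) measure \<Rightarrow> real measure \<Rightarrow> bool" where
  "is_Zlaw Q \<zeta> \<longleftrightarrow> real_distribution \<zeta> \<and> (AE z in \<zeta>. 0 \<le> z) \<and>
     integrable \<zeta> (\<lambda>z. z) \<and> (\<integral>z. z \<partial>\<zeta>) = 1 \<and>
     \<zeta> = fp_rhs Q (real_of_ereal (Sfun Q 1)) \<zeta>"

end

theory Submission
  imports Defs
begin

text \<open>
  Write w(x) for the mean of exp(psi x Z), where Z solves the fixed point equation and Re psi is at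
  most 0, and q_n[g] for the mean of the product of g over the n weights. Splitting one weight
  uniformly at random turns q_n into q_(n+1), and the fixed point equation turns the flow
  y w(y^a x), a = S(1), into an ordinary differential equation with the same quadratic right-hand
  side. Hence the sum over n of P(nu_t = n) q_n[w] telescopes in y and equals w(exp(a t)). Two functions
  g with the same first-order expansion 1 + psi x + o(x) differ by at most eps x + C x^d, and the
  mean sums of the weights to the powers 1 and d grow like exp(S(1) t) and exp(S(d) t); since
  S(d) < d S(1), replacing w by the characteristic function of X_1 costs nothing in the limit. The
  same comparison gives uniqueness of Z, while existence is a contraction in the metric
  sup |w - w'| / |x|^d.
\<close>

text \<open>Its error o(x) has exactly the order that the weights amplify: the mean weight sum grows
  like exp(a t) and the normalisation exp(-a t) just balances it, which leaves an arbitrarily small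
  eps; every decaying term comes from the exponent d > 1. The parameter psi is complex so that one
  transform serves all purposes: psi = i sgn(u) gives the characteristic function of Z, psi = i
  gamma xi - c pi |xi| that of the limit of V, and rescaling x is a change of psi. The variable y
  stands for exponential time: the uniform factor of the fixed point equation becomes an average
  over (0, y), and with Y = exp(t) the Yule probabilities are y/Y (1 - y/Y)^m at y = 1. The exponent
  d is the minimum of delta and 2, because the second-order remainder of exp is bounded by a
  multiple of |w|^d on the half-plane only for d up to 2; a larger delta is brought down by
  interpolation with exponent 1. The limits are known only as functions, hence the form of Levy's
  theorem that produces the law.\<close>

section \<open>Levy continuity without a given limit law\<close>

text \<open>Averaging the characteristic function over a Gaussian argument gives a Gaussian in x by Fubini.\<close>

lemma gauss_tail_bound:
  fixes K :: real
  assumes "real_distribution M" "K > 0"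
  shows "(1 - exp (- 1 / 2)) * measure M {x. K \<le> \<bar>x\<bar>}
           \<le> Re (1 - (CLINT t|std_normal_distribution. char M (t / K)))"
proof -
  interpret M: real_distribution M by fact
  interpret N: real_distribution std_normal_distribution by (rule real_dist_normal_dist)
  interpret P: pair_prob_space std_normal_distribution M ..
  have "(CLINT t|std_normal_distribution. char M (t / K)) =
        (CLINT t|std_normal_distribution. CLINT x|M. iexp (t / K * x))"
    by (simp add: char_def)
  also have "\<dots> = (CLINT x|M. CLINT t|std_normal_distribution. iexp (t / K * x))"
  proof (rule P.Fubini_integral[symmetric])
    have "(\<lambda>p. iexp (fst p / K * snd p)) \<in> borel_measurable (std_normal_distribution \<Otimes>\<^sub>M M)"
      by measurable
    then show "complex_integrable (std_normal_distribution \<Otimes>\<^sub>M M) (\<lambda>(t, x). iexp (t / K * x))"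
      by (intro P.P.integrable_const_bound[where B = 1]) (auto simp: case_prod_beta')
  qed
  also have "\<dots> = (CLINT x|M. char std_normal_distribution (x / K))"
    by (simp add: char_def mult_ac)
  also have "\<dots> = (CLINT x|M. complex_of_real (exp (- ((x / K)\<^sup>2) / 2)))"
    by (simp add: char_std_normal_distribution)
  also have "\<dots> = complex_of_real (LINT x|M. exp (- ((x / K)\<^sup>2) / 2))"
    by simp
  finally have eq: "Re (1 - (CLINT t|std_normal_distribution. char M (t / K))) =
      1 - (LINT x|M. exp (- ((x / K)\<^sup>2) / 2))" by simp
  have int: "integrable M (\<lambda>x. exp (- ((x / K)\<^sup>2) / 2))"
    by (intro M.integrable_const_bound[where B = 1]) auto
  have "(1 - exp (- 1 / 2)) * measure M {x. K \<le> \<bar>x\<bar>} =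
      (LINT x|M. (1 - exp (- 1 / 2)) * indicator {x. K \<le> \<bar>x\<bar>} x)"
    by simp
  also have "\<dots> \<le> (LINT x|M. 1 - exp (- ((x / K)\<^sup>2) / 2))"
  proof (rule integral_mono)
    fix x
    have "exp (- ((x / K)\<^sup>2) / 2) \<le> exp (- 1 / 2)" if "K \<le> \<bar>x\<bar>"
    proof -
      have "1 \<le> \<bar>x / K\<bar>" using that \<open>K > 0\<close> by (simp add: abs_divide)
      then have "1 \<le> (x / K)\<^sup>2" by (metis one_le_power power2_abs)
      then show ?thesis by simp
    qed
    then show "(1 - exp (- 1 / 2)) * indicator {x. K \<le> \<bar>x\<bar>} x \<le> 1 - exp (- ((x / K)\<^sup>2) / 2)"
      by (auto split: split_indicator)
  qed (use int in \<open>auto intro!: M.integrable_const_bound[where B = 1]\<close>)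
  also have "\<dots> = 1 - (LINT x|M. exp (- ((x / K)\<^sup>2) / 2))"
    using int M.prob_space by (subst Bochner_Integration.integral_diff) auto
  finally show ?thesis unfolding eq .
qed

lemma (in real_distribution) ex_abs_tail_less:
  assumes "\<epsilon> > 0"
  shows "\<exists>k::nat. measure M {x. real k \<le> \<bar>x\<bar>} < \<epsilon>"
proof -
  have "(\<Inter>k. {x. real k \<le> \<bar>x\<bar>}) = {}"
    by (auto intro: notI) (meson not_less reals_Archimedean2)
  moreover have "(\<lambda>k. measure M {x. real k \<le> \<bar>x\<bar>}) \<longlonglongrightarrow> measure M (\<Inter>k. {x. real k \<le> \<bar>x\<bar>})"
    by (rule finite_Lim_measure_decseq) (auto simp: decseq_def)
  ultimately have "(\<lambda>k. measure M {x. real k \<le> \<bar>x\<bar>}) \<longlonglongrightarrow> 0" by simp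
  then have "eventually (\<lambda>k. measure M {x. real k \<le> \<bar>x\<bar>} < \<epsilon>) sequentially"
    using assms by (simp add: order_tendstoD)
  then show ?thesis by (auto simp: eventually_sequentially)
qed

text \<open>The Gaussian average of \<open>1 - f (t / K)\<close> is small for large
  \<open>K\<close>, because \<open>f\<close> is continuous at 0 with \<open>f 0 = 1\<close>. For
  that fixed \<open>K\<close> the averages for \<open>char (M n)\<close> converge to it, so
  \<open>gauss_tail_bound\<close> controls the tails of all but finitely many laws at once; each of
  the remaining ones has small tails by itself.\<close>

lemma char_limit_imp_tight:
  fixes M :: "nat \<Rightarrow> real measure" and f :: "real \<Rightarrow> complex"
  assumes M: "\<And>n. real_distribution (M n)"
    and conv: "\<And>t. (\<lambda>n. char (M n) t) \<longlonglongrightarrow> f t"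
    and cont: "isCont f 0"
  shows "tight M"
  unfolding tight_def
proof (intro conjI allI impI M)
  fix \<epsilon> :: real assume "\<epsilon> > 0"
  interpret M: real_distribution "M n" for n by (rule M)
  interpret N: real_distribution std_normal_distribution by (rule real_dist_normal_dist)
  let ?c = "1 - exp (- 1 / 2 :: real)"
  have c: "?c > 0" by simp
  have [measurable]: "f \<in> borel_measurable borel"
    by (rule borel_measurable_LIMSEQ_metric[OF _ conv]) auto
  have f_le: "norm (f t) \<le> 1" for t
    by (rule LIMSEQ_le_const2[OF tendsto_norm[OF conv]]) (auto intro: M.cmod_char_le_1)
  have f0: "f 0 = 1"
    using conv[of 0] by (simp add: M.char_zero LIMSEQ_const_iff)
  have "(\<lambda>k. CLINT t|std_normal_distribution. f (t / real (Suc k)))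
          \<longlonglongrightarrow> (CLINT t|std_normal_distribution. 1)"
  proof (rule integral_dominated_convergence[where w = "\<lambda>_. 1"])
    show "AE t in std_normal_distribution. (\<lambda>k. f (t / real (Suc k))) \<longlonglongrightarrow> 1"
    proof (rule AE_I2)
      fix t :: real
      have "(\<lambda>k. t / real (Suc k)) \<longlonglongrightarrow> 0"
        by (rule LIMSEQ_Suc[OF lim_const_over_n])
      then show "(\<lambda>k. f (t / real (Suc k))) \<longlonglongrightarrow> 1"
        using isCont_tendsto_compose[OF cont] f0 by simp
    qed
  qed (auto simp: f_le)
  then have "(\<lambda>k. Re (1 - (CLINT t|std_normal_distribution. f (t / real (Suc k))))) \<longlonglongrightarrow> Re (1 - 1)"
    using N.prob_space by (intro tendsto_intros) simp
  moreover have "0 < ?c * \<epsilon>" using c \<open>\<epsilon> > 0\<close> by simp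
  ultimately have "eventually (\<lambda>k. Re (1 - (CLINT t|std_normal_distribution. f (t / real (Suc k)))) < ?c * \<epsilon>) sequentially"
    by (intro order_tendstoD(2)[of _ "Re (1 - 1)"]) auto
  then obtain k where k: "Re (1 - (CLINT t|std_normal_distribution. f (t / real (Suc k)))) < ?c * \<epsilon>"
    by (auto simp: eventually_sequentially)
  let ?K = "real (Suc k)"
  have "(\<lambda>n. CLINT t|std_normal_distribution. char (M n) (t / ?K))
          \<longlonglongrightarrow> (CLINT t|std_normal_distribution. f (t / ?K))"
    by (rule integral_dominated_convergence[where w = "\<lambda>_. 1"]) (auto intro: conv M.cmod_char_le_1)
  then have "(\<lambda>n. Re (1 - (CLINT t|std_normal_distribution. char (M n) (t / ?K))))
      \<longlonglongrightarrow> Re (1 - (CLINT t|std_normal_distribution. f (t / ?K)))"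
    by (intro tendsto_intros)
  from order_tendstoD(2)[OF this k] obtain n0 where n0:
    "\<And>n. n \<ge> n0 \<Longrightarrow> Re (1 - (CLINT t|std_normal_distribution. char (M n) (t / ?K))) < ?c * \<epsilon>"
    by (auto simp: eventually_sequentially)
  have tail: "measure (M n) {x. ?K \<le> \<bar>x\<bar>} < \<epsilon>" if "n \<ge> n0" for n
  proof -
    have "?c * measure (M n) {x. ?K \<le> \<bar>x\<bar>} < ?c * \<epsilon>"
      using gauss_tail_bound[OF M, of ?K n] n0[OF that] by linarith
    then show ?thesis using c by (simp only: mult_less_cancel_left_pos)
  qed
  obtain kk where kk: "\<And>n. measure (M n) {x. real (kk n) \<le> \<bar>x\<bar>} < \<epsilon>"
    using M.ex_abs_tail_less[OF \<open>\<epsilon> > 0\<close>] by metis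
  \<comment> \<open>\<open>b\<close> dominates the common cutoff \<open>?K\<close> for
    \<open>n \<ge> n0\<close> and the individual cutoffs of the finitely many earlier laws.\<close>
  define b where "b = Max (insert ?K ((\<lambda>n. real (kk n)) ` {..<n0}))"
  have b1: "?K \<le> b" unfolding b_def by (intro Max_ge) auto
  have b2: "real (kk n) \<le> b" if "n < n0" for n
    unfolding b_def using that by (intro Max_ge) auto
  have "1 - \<epsilon> < measure (M n) {- b<..b}" for n
  proof -
    have "measure (M n) {x. b \<le> \<bar>x\<bar>} < \<epsilon>"
    proof (cases "n < n0")
      case True
      have "measure (M n) {x. b \<le> \<bar>x\<bar>} \<le> measure (M n) {x. real (kk n) \<le> \<bar>x\<bar>}"
        using b2[OF True] by (intro M.finite_measure_mono) auto
      then show ?thesis using kk[of n] by simp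
    next
      case False
      have "measure (M n) {x. b \<le> \<bar>x\<bar>} \<le> measure (M n) {x. ?K \<le> \<bar>x\<bar>}"
        using b1 by (intro M.finite_measure_mono) auto
      then show ?thesis using tail[of n] False by simp
    qed
    moreover have "1 - measure (M n) {x. b \<le> \<bar>x\<bar>} = measure (M n) (space (M n) - {x. b \<le> \<bar>x\<bar>})"
      by (rule M.prob_compl[symmetric]) simp
    moreover have "\<dots> \<le> measure (M n) {- b<..b}"
      by (intro M.finite_measure_mono) auto
    ultimately show ?thesis by linarith
  qed
  moreover have "- b < b" using b1 by linarith
  ultimately show "\<exists>a b. a < b \<and> (\<forall>n. 1 - \<epsilon> < measure (M n) {a<..b})" by blast
qed

text \<open>Tightness supplies a limit along a subsequence; its characteristic function must be
  \<open>f\<close>, and once a law with characteristic function \<open>f\<close> exists the whole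
  sequence converges to it. Here \<open>f\<close> is only a pointwise limit, which is the situation
  both for \<open>Z\<close> and for the limit of the scaled \<open>V\<close>.\<close>

theorem levy_continuity_exists:
  fixes M :: "nat \<Rightarrow> real measure" and f :: "real \<Rightarrow> complex"
  assumes M: "\<And>n. real_distribution (M n)"
    and conv: "\<And>t. (\<lambda>n. char (M n) t) \<longlonglongrightarrow> f t"
    and cont: "isCont f 0"
  obtains M' where "real_distribution M'" "char M' = f" "weak_conv_m M M'"
proof -
  have "tight M" by (rule char_limit_imp_tight[OF assms])
  then obtain r M' where r: "strict_mono r" and M': "real_distribution M'"
      and w: "weak_conv_m (M \<circ> id \<circ> r) M'"
    using tight_imp_convergent_subsubsequence[of M id] by (auto simp: strict_mono_def)
  have "char M' t = f t" for t
  proof (rule LIMSEQ_unique)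
    show "(\<lambda>n. char ((M \<circ> id \<circ> r) n) t) \<longlonglongrightarrow> char M' t"
      by (rule levy_continuity1[OF _ M' w]) (simp add: M)
    show "(\<lambda>n. char ((M \<circ> id \<circ> r) n) t) \<longlonglongrightarrow> f t"
      using LIMSEQ_subseq_LIMSEQ[OF conv r] by (simp add: comp_def)
  qed
  then have ch: "char M' = f" by auto
  have "weak_conv_m M M'"
    by (rule levy_continuity[OF M M']) (simp add: ch conv)
  with M' ch that show thesis by blast
qed

section \<open>Characteristic functions with balanced Cauchy tails\<close>

text \<open>\<open>1 - cdf M x\<close> is the mass of the open half-line, and an atom at
  \<open>x\<close> makes the closed tail larger. The closed tail at \<open>x\<close> lies between
  the open tails at \<open>x\<close> and at \<open>x - 1\<close>, and \<open>x / (x - 1)\<close>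
  tends to 1. Closed tails are the ones that appear after Fubini in
  \<open>trunc_char_eq\<close>.\<close>

lemma (in real_distribution) tail_atLeast_limit:
  assumes "((\<lambda>x. x * (1 - cdf M x)) \<longlongrightarrow> c) at_top"
  shows "((\<lambda>x. x * measure M {x..}) \<longlongrightarrow> c) at_top"
proof (rule tendsto_sandwich)
  have cdf: "1 - cdf M x = measure M {x<..}" for x
  proof -
    have "measure M {x<..} = measure M (space M - {..x})" by (rule arg_cong[where f = "measure M"]) auto
    also have "\<dots> = 1 - measure M {..x}" by (rule prob_compl) simp
    finally show ?thesis by (simp add: cdf_def)
  qed
  show "((\<lambda>x. x * (1 - cdf M x)) \<longlongrightarrow> c) at_top" by fact
  show "eventually (\<lambda>x. x * (1 - cdf M x) \<le> x * measure M {x..}) at_top"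
    using eventually_gt_at_top[of 0]
    by eventually_elim (auto simp: cdf intro!: finite_measure_mono)
  show "eventually (\<lambda>x. x * measure M {x..} \<le> x / (x - 1) * ((x - 1) * (1 - cdf M (x - 1)))) at_top"
    using eventually_gt_at_top[of 1]
    by eventually_elim (auto simp: cdf intro!: finite_measure_mono)
  have "((\<lambda>x. (x - 1) * (1 - cdf M (x - 1))) \<longlongrightarrow> c) at_top"
    by (rule filterlim_compose[OF assms])
       (simp add: filterlim_at_top_add_at_top[of "\<lambda>x. -1", simplified] filterlim_tendsto_add_at_top[OF tendsto_const filterlim_ident, of "-1::real", simplified])
  moreover have "((\<lambda>x::real. x / (x - 1)) \<longlongrightarrow> 1) at_top" by real_asymp
  ultimately have "((\<lambda>x. x / (x - 1) * ((x - 1) * (1 - cdf M (x - 1)))) \<longlongrightarrow> 1 * c) at_top"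
    by (intro tendsto_mult)
  then show "((\<lambda>x. x / (x - 1) * ((x - 1) * (1 - cdf M (x - 1)))) \<longlongrightarrow> c) at_top" by simp
qed

lemma (in real_distribution) tail_atLeast_bound:
  assumes "((\<lambda>x. x * measure M {x..}) \<longlongrightarrow> c) at_top"
  obtains K where "K > 0" "\<And>x. x > 0 \<Longrightarrow> x * measure M {x..} \<le> K"
proof -
  have "eventually (\<lambda>x. x * measure M {x..} < c + 1) at_top"
    by (rule order_tendstoD[OF assms]) simp
  then obtain x0 where x0: "\<And>x. x \<ge> x0 \<Longrightarrow> x * measure M {x..} < c + 1"
    by (auto simp: eventually_at_top_linorder)
  \<comment> \<open>Below \<open>x0\<close> the mass is at most 1, so \<open>x0\<close> bounds the
    product; the entry 1 keeps the constant positive.\<close>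
  show thesis
  proof (rule that[of "max 1 (max x0 (c + 1))"])
    fix x :: real assume "x > 0"
    show "x * measure M {x..} \<le> max 1 (max x0 (c + 1))"
    proof (cases "x \<ge> x0")
      case True then show ?thesis using x0[of x] by simp
    next
      case False
      have "x * measure M {x..} \<le> x * 1" using \<open>x > 0\<close> by (intro mult_left_mono) auto
      then show ?thesis using False by simp
    qed
  qed simp
qed

text \<open>Sequential dominated convergence transfers to \<open>at a within S\<close> in a first
  countable space; this covers one-sided limits at 0 as well as differentiation in a
  parameter.\<close>

lemma integral_dominated_convergence_within:
  fixes s :: "'b::first_countable_topology \<Rightarrow> 'a \<Rightarrow> 'c::{banach, second_countable_topology}"
  assumes "f \<in> borel_measurable M" "\<And>t. t \<in> S - {a} \<Longrightarrow> s t \<in> borel_measurable M" "integrable M w"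
    and lim: "AE x in M. ((\<lambda>t. s t x) \<longlongrightarrow> f x) (at a within S)"
    and bound: "\<And>t. t \<in> S - {a} \<Longrightarrow> AE x in M. norm (s t x) \<le> w x"
  shows "((\<lambda>t. integral\<^sup>L M (s t)) \<longlongrightarrow> integral\<^sup>L M f) (at a within S)"
  unfolding tendsto_at_iff_sequentially
proof (intro allI impI)
  fix X :: "nat \<Rightarrow> 'b" assume X: "\<forall>i. X i \<in> S - {a}" "X \<longlonglongrightarrow> a"
  have "(\<lambda>n. integral\<^sup>L M (s (X n))) \<longlonglongrightarrow> integral\<^sup>L M f"
  proof (rule integral_dominated_convergence[where w = w])
    show "AE x in M. (\<lambda>n. s (X n) x) \<longlonglongrightarrow> f x"
      using lim
    proof eventually_elim
      case (elim x)
      then show ?case using X unfolding tendsto_at_iff_sequentially comp_def by blast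
    qed
  qed (use assms X in auto)
  then show "((\<lambda>t. integral\<^sup>L M (s t)) \<circ> X) \<longlonglongrightarrow> integral\<^sup>L M f" by (simp add: comp_def)
qed

section \<open>Truncated characteristic functions through tail integrals\<close>

text \<open>Used with B = A / xi, so that all integrals converge absolutely; A tends to infinity last.\<close>

definition trunc_char :: "real measure \<Rightarrow> real \<Rightarrow> real \<Rightarrow> complex" where
  "trunc_char M B \<xi> = (CLINT x|M. indicator {0<..<B} x *\<^sub>R (iexp (\<xi> * x) - 1 - \<i> * (\<xi> * x)))"

text \<open>The limit of \<open>trunc_char M (A / \<xi>) \<xi> / \<xi>\<close> as
  \<open>\<xi>\<close> tends to 0 from the right: in \<open>trunc_char_eq\<close> each tail
  \<open>measure M {s / \<xi>..} / \<xi>\<close> is replaced by its limit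
  \<open>c / s\<close>.\<close>

definition trunc_lim :: "real \<Rightarrow> real \<Rightarrow> complex" where
  "trunc_lim c A = (CLBINT s. indicator {0..A} s *\<^sub>R (\<i> * (iexp s - 1) * (c / s - c / A)))"

text \<open>The derivative of \<open>iexp z - 1 - \<i> * z\<close> is
  \<open>\<i> * (iexp z - 1)\<close>. This representation lets Fubini take the place of an
  integration by parts against the law.\<close>

lemma integral_iexp_minus_one:
  assumes "0 \<le> z"
  shows "(CLBINT s. indicator {0..z} s *\<^sub>R (\<i> * (iexp s - 1))) = iexp z - 1 - \<i> * z"
proof -
  have "(CLBINT s. indicator {0..z} s *\<^sub>R (\<i> * (iexp s - 1))) =
    (iexp z - \<i> * complex_of_real z) - (iexp 0 - \<i> * complex_of_real 0)"
  proof (rule integral_FTC_Icc[OF assms])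
    fix x
    show "((\<lambda>z. iexp z - \<i> * complex_of_real z) has_vector_derivative \<i> * (iexp x - 1)) (at x within {0..z})"
      by (auto intro!: derivative_eq_intros simp: algebra_simps)
  qed (auto intro!: continuous_intros)
  then show ?thesis by simp
qed

lemma norm_iexp_minus_one_le: "norm (iexp s - 1) \<le> \<bar>s\<bar>"
  using iexp_approx1[of s 0] by simp

text \<open>The integrand at \<open>x\<close> is an integral over \<open>s\<close> in
  \<open>{0..\<xi> * x}\<close>. Exchanging the integrals leaves, for each \<open>s\<close>, the
  mass of \<open>s / \<xi> \<le> x < A / \<xi>\<close>, which is a difference of two closed
  tails.\<close>

lemma (in real_distribution) trunc_char_eq:
  assumes "\<xi> > 0" "A > 0"
  shows "trunc_char M (A / \<xi>) \<xi> = (CLBINT s. indicator {0..A} s *\<^sub>R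
    (\<i> * (iexp s - 1) * (measure M {s / \<xi>..} - measure M {A / \<xi>..})))"
proof -
  interpret P: pair_sigma_finite M lborel ..
  let ?f = "\<lambda>x s. indicator ({0<..<A / \<xi>} \<times> {0..A}) (x, s) *\<^sub>R (indicator {s. s \<le> \<xi> * x} s *\<^sub>R (\<i> * (iexp s - 1)))"
  have int: "complex_integrable (M \<Otimes>\<^sub>M lborel) (\<lambda>(x, s). ?f x s)"
  proof -
    have "complex_integrable (M \<Otimes>\<^sub>M lborel) (\<lambda>p. indicator ({0<..<A / \<xi>} \<times> {0..A}) p *\<^sub>R
        (indicator {s. s \<le> \<xi> * fst p} (snd p) *\<^sub>R (\<i> * (iexp (snd p) - 1))))"
    proof (rule integrableI_bounded_set_indicator[where B = A])
      show "{0<..<A / \<xi>} \<times> {0..A} \<in> sets (M \<Otimes>\<^sub>M lborel)" by simp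
      show "(\<lambda>p. indicator {s. s \<le> \<xi> * fst p} (snd p) *\<^sub>R (\<i> * (iexp (snd p) - 1))) \<in> borel_measurable (M \<Otimes>\<^sub>M lborel)"
        unfolding indicator_def by measurable
      show "emeasure (M \<Otimes>\<^sub>M lborel) ({0<..<A / \<xi>} \<times> {0..A}) < \<infinity>"
        by (subst lborel.emeasure_pair_measure_Times) (use \<open>A > 0\<close> in \<open>auto simp: emeasure_eq_measure ennreal_mult_eq_top_iff less_top[symmetric] simp del: not_less\<close>)
      show "AE p in M \<Otimes>\<^sub>M lborel. p \<in> {0<..<A / \<xi>} \<times> {0..A} \<longrightarrow>
          norm (indicator {s. s \<le> \<xi> * fst p} (snd p) *\<^sub>R (\<i> * (iexp (snd p) - 1))) \<le> A"
        using assms by (auto simp: norm_mult intro!: AE_I2 order_trans[OF norm_iexp_minus_one_le] split: split_indicator)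
    qed
    then show ?thesis by (simp add: case_prod_beta')
  qed
  have "trunc_char M (A / \<xi>) \<xi> = (CLINT x|M. CLBINT s. ?f x s)"
    unfolding trunc_char_def
  proof (rule Bochner_Integration.integral_cong[OF refl])
    fix x
    show "indicator {0<..<A / \<xi>} x *\<^sub>R (iexp (\<xi> * x) - 1 - \<i> * (\<xi> * x)) = (CLBINT s. ?f x s)"
    proof (cases "x \<in> {0<..<A / \<xi>}")
      case True
      then have x: "0 < x" "\<xi> * x < A" using assms by (auto simp: field_simps)
      have eq: "(\<lambda>s. ?f x s) = (\<lambda>s. indicator {0..\<xi> * x} s *\<^sub>R (\<i> * (iexp s - 1)))"
        using True x by (auto simp: fun_eq_iff split: split_indicator)
      have "(CLBINT s. ?f x s) = iexp (\<xi> * x) - 1 - \<i> * complex_of_real (\<xi> * x)"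
        unfolding eq by (rule integral_iexp_minus_one) (use x assms in simp)
      then show ?thesis using True by simp
    next
      case False
      then have eq: "(\<lambda>s. ?f x s) = (\<lambda>_. 0)" by (auto simp: fun_eq_iff)
      have "(CLBINT s. ?f x s) = 0" unfolding eq by simp
      moreover have "indicator {0<..<A / \<xi>} x = (0::real)" using False by simp
      ultimately show ?thesis by (simp only: scaleR_zero_left)
    qed
  qed
  also have "\<dots> = (CLBINT s. (CLINT x|M. ?f x s))"
    by (rule P.Fubini_integral[symmetric, OF int])
  also have "\<dots> = (CLBINT s. indicator {0..A} s *\<^sub>R
    (\<i> * (iexp s - 1) * (measure M {s / \<xi>..} - measure M {A / \<xi>..})))"
  proof (rule Bochner_Integration.integral_cong[OF refl])
    fix s :: real
    show "(CLINT x|M. ?f x s) = indicator {0..A} s *\<^sub>R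
       (\<i> * (iexp s - 1) * (measure M {s / \<xi>..} - measure M {A / \<xi>..}))"
    \<comment> \<open>At \<open>s = 0\<close> the condition \<open>s \<le> \<xi> * x\<close> does
      not imply \<open>0 < x\<close>, but there the factor \<open>iexp s - 1\<close>
      vanishes.\<close>
    proof (cases "0 < s \<and> s \<le> A")
      case True
      have "?f x s = indicator {s / \<xi>..<A / \<xi>} x *\<^sub>R (\<i> * (iexp s - 1))" for x
        using True assms less_le_trans[of 0 "s / \<xi>" x]
        by (auto simp: field_simps split: split_indicator)
      then have eq: "(\<lambda>x. ?f x s) = (\<lambda>x. indicator {s / \<xi>..<A / \<xi>} x *\<^sub>R (\<i> * (iexp s - 1)))"
        by blast
      have "(CLINT x|M. ?f x s) = measure M {s / \<xi>..<A / \<xi>} *\<^sub>R (\<i> * (iexp s - 1))"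
        unfolding eq by (simp add: emeasure_eq_measure)
      also have "measure M {s / \<xi>..<A / \<xi>} = measure M ({s / \<xi>..} - {A / \<xi>..})"
        by (rule arg_cong[where f = "measure M"]) auto
      also have "\<dots> = measure M {s / \<xi>..} - measure M {A / \<xi>..}"
        using True assms by (intro finite_measure_Diff) (auto simp: divide_right_mono)
      finally show ?thesis using True by (simp add: scaleR_conv_of_real)
    next
      case False
      then consider "s = 0" | "s < 0" | "A < s" by linarith
      then show ?thesis by cases (auto simp: indicator_def)
    qed
  qed
  finally show ?thesis .
qed

text \<open>Dominated convergence on \<open>{0..A}\<close>: the tail bound costs a factor
  \<open>1 / s\<close>, which \<open>norm (iexp s - 1) \<le> s\<close> compensates, so the constant
  \<open>2 * K\<close> dominates.\<close>

lemma (in real_distribution) trunc_char_tendsto: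
  assumes lim: "((\<lambda>x. x * measure M {x..}) \<longlongrightarrow> c) at_top" and "A > 0"
  shows "((\<lambda>\<xi>. trunc_char M (A / \<xi>) \<xi> / \<xi>) \<longlongrightarrow> trunc_lim c A) (at_right 0)"
proof -
  obtain K where K: "K > 0" "\<And>x. x > 0 \<Longrightarrow> x * measure M {x..} \<le> K"
    using tail_atLeast_bound[OF lim] by blast
  have Kd: "measure M {s / \<xi>..} / \<xi> \<le> K / s" if "s > 0" "\<xi> > 0" for s \<xi>
    using K(2)[of "s / \<xi>"] that by (simp add: field_simps)
  have ptlim: "((\<lambda>\<xi>. measure M {s / \<xi>..} / \<xi>) \<longlongrightarrow> c / s) (at_right 0)" if "s > 0" for s
  proof -
    have "filterlim (\<lambda>\<xi>. s / \<xi>) at_top (at_right 0)"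
      using that by real_asymp
    from filterlim_compose[OF lim this]
    have "((\<lambda>\<xi>. (s / \<xi> * measure M {s / \<xi>..}) / s) \<longlongrightarrow> c / s) (at_right 0)"
      using that by (intro tendsto_intros) auto
    then show ?thesis using that by (simp add: field_simps)
  qed
  let ?g = "\<lambda>\<xi> s. indicator {0..A} s *\<^sub>R
    (\<i> * (iexp s - 1) * complex_of_real (measure M {s / \<xi>..} / \<xi> - measure M {A / \<xi>..} / \<xi>))"
  have [measurable]: "(\<lambda>s. measure M {s / \<xi>..}) \<in> borel_measurable borel" if "\<xi> > 0" for \<xi>
  proof -
    have "antimono (\<lambda>s. measure M {s / \<xi>..})"
      using that by (intro antimonoI finite_measure_mono) (auto simp: divide_right_mono intro: order_trans)
    then have "mono (\<lambda>s. - measure M {s / \<xi>..})"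
      by (simp add: mono_def antimono_def)
    then have "(\<lambda>s. - measure M {s / \<xi>..}) \<in> borel_measurable borel"
      by (rule borel_measurable_mono)
    then have "(\<lambda>s. - (- measure M {s / \<xi>..})) \<in> borel_measurable borel"
      by (rule borel_measurable_uminus)
    then show ?thesis by simp
  qed
  have "((\<lambda>\<xi>. CLBINT s. ?g \<xi> s) \<longlongrightarrow> trunc_lim c A) (at_right 0)"
    unfolding trunc_lim_def
  proof (rule integral_dominated_convergence_within[where w = "\<lambda>s. indicator {0..A} s * (2 * K)"])
    show "AE s in lborel. norm (?g \<xi> s) \<le> indicator {0..A} s * (2 * K)" if "\<xi> \<in> {0<..} - {0}" for \<xi>
    proof -
      have elim: "0 < \<xi>" using that by simp
      have "norm (?g \<xi> s) \<le> indicator {0..A} s * (2 * K)" if "s \<noteq> 0" for s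
      proof (cases "s \<in> {0..A}")
        case True
        then have s: "0 < s" "s \<le> A" using that by auto
        have "\<bar>measure M {s / \<xi>..} / \<xi> - measure M {A / \<xi>..} / \<xi>\<bar> \<le> K / s + K / A"
        proof -
          have "0 \<le> measure M {s / \<xi>..} / \<xi>" "0 \<le> measure M {A / \<xi>..} / \<xi>" using elim by auto
          then show ?thesis using Kd[OF s(1) elim] Kd[OF \<open>A > 0\<close> elim] by linarith
        qed
        also have "\<dots> \<le> 2 * K / s"
          using s K(1) by (simp add: field_simps)
        finally have b: "\<bar>measure M {s / \<xi>..} / \<xi> - measure M {A / \<xi>..} / \<xi>\<bar> \<le> 2 * K / s" .
        have "norm (?g \<xi> s) = norm (iexp s - 1) * \<bar>measure M {s / \<xi>..} / \<xi> - measure M {A / \<xi>..} / \<xi>\<bar>"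
          using True by (simp add: norm_mult del: of_real_diff of_real_divide)
        also have "\<dots> \<le> s * (2 * K / s)"
          using norm_iexp_minus_one_le[of s] s by (intro mult_mono b) auto
        finally show ?thesis using True s by simp
      qed simp
      moreover have "AE s in lborel. s \<noteq> (0::real)" by (rule AE_lborel_singleton)
      ultimately show ?thesis by auto
    qed
    show "AE s in lborel. ((\<lambda>\<xi>. ?g \<xi> s) \<longlongrightarrow> indicator {0..A} s *\<^sub>R (\<i> * (iexp s - 1) * (c / s - c / A))) (at_right 0)"
    proof (rule AE_mp[OF AE_lborel_singleton[of 0] AE_I2], rule impI)
      fix s :: real assume "s \<noteq> 0"
      show "((\<lambda>\<xi>. ?g \<xi> s) \<longlongrightarrow> indicator {0..A} s *\<^sub>R (\<i> * (iexp s - 1) * (c / s - c / A))) (at_right 0)"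
      proof (cases "s \<in> {0..A}")
        case True
        then have "0 < s" using \<open>s \<noteq> 0\<close> by auto
        have "((\<lambda>\<xi>. ?g \<xi> s) \<longlongrightarrow> indicator {0..A} s *\<^sub>R (\<i> * (iexp s - 1) * complex_of_real (c / s - c / A))) (at_right 0)"
          by (intro tendsto_intros ptlim \<open>0 < s\<close> \<open>A > 0\<close>)
        then show ?thesis by simp
      qed simp
    qed
  qed (use \<open>A > 0\<close> in auto)
  moreover have "eventually (\<lambda>\<xi>. (CLBINT s. ?g \<xi> s) = trunc_char M (A / \<xi>) \<xi> / \<xi>) (at_right 0)"
    using eventually_at_right_less[of 0]
  proof eventually_elim
    case (elim \<xi>)
    have "(CLBINT s. ?g \<xi> s) = (CLBINT s. (indicator {0..A} s *\<^sub>R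
    (\<i> * (iexp s - 1) * (measure M {s / \<xi>..} - measure M {A / \<xi>..}))) / \<xi>)"
      by (intro Bochner_Integration.integral_cong) (auto simp: scaleR_conv_of_real diff_divide_distrib[symmetric])
    also have "\<dots> = trunc_char M (A / \<xi>) \<xi> / \<xi>"
      unfolding trunc_char_eq[OF elim \<open>A > 0\<close>] by simp
    finally show ?case .
  qed
  ultimately show ?thesis by (rule Lim_transform_eventually)
qed


text \<open>Only the real part is evaluated, because the left tail of the law contributes the
  complex conjugate. The real part of \<open>\<i> * (iexp s - 1)\<close> is \<open>- sin s\<close>;
  against \<open>c / s\<close> it yields the sine integral \<open>Si\<close>, against the constant
  \<open>c / A\<close> it yields \<open>1 - cos A\<close>.\<close>

lemma Re_trunc_lim:
  assumes "A > 0"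
  shows "Re (trunc_lim c A) = - c * (Si A - (1 - cos A) / A)"
proof -
  let ?g = "\<lambda>s. indicator {0..A} s *\<^sub>R (\<i> * (iexp s - 1) * (c / s - c / A))"
  have Re_g: "Re (?g s) = - c * (indicator {0..A} s * (sin s / s)) + c / A * (indicator {0..A} s * sin s)" for s
    by (auto simp: Re_exp Im_exp algebra_simps split: split_indicator)
  have Si: "(LBINT s. indicator {0..A} s * (sin s / s)) = Si A"
    using assms interval_integral_Icc[of 0 A "\<lambda>s. sin s / s"]
    by (simp add: Si_def set_lebesgue_integral_def zero_ereal_def)
  have "set_integrable lborel {0..A} sinc"
    by (rule borel_integrable_atLeastAtMost') (auto intro: continuous_on_sinc continuous_intros)
  then have int1: "integrable lborel (\<lambda>s. indicator {0..A} s * (sin s / s))"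
    unfolding set_integrable_def
  proof (rule Bochner_Integration.integrable_cong_AE_imp)
    show "AE s in lborel. indicat_real {0..A} s *\<^sub>R sinc s = indicator {0..A} s * (sin s / s)"
      using sinc_AE by eventually_elim simp
  qed simp
  have int2: "integrable lborel (\<lambda>s. indicator {0..A} s * sin s)"
    using borel_integrable_atLeastAtMost'[of 0 A sin] by (simp add: set_integrable_def continuous_intros)
  have cos: "(LBINT s. indicator {0..A} s * sin s) = 1 - cos A"
  proof -
    have "(LBINT s. indicator {0..A} s *\<^sub>R sin s) = - cos A - - cos 0"
      using assms by (intro integral_FTC_Icc)
        (auto intro!: derivative_eq_intros continuous_intros simp: has_real_derivative_iff_has_vector_derivative[symmetric])
    then show ?thesis by simp
  qed
  have "complex_integrable lborel ?g"
  proof (rule integrableI_bounded_set_indicator[where B = "2 * \<bar>c\<bar>"])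
    show "AE s in lborel. s \<in> {0..A} \<longrightarrow> norm (\<i> * (iexp s - 1) * complex_of_real (c / s - c / A)) \<le> 2 * \<bar>c\<bar>"
    proof (rule AE_mp[OF AE_lborel_singleton[of 0] AE_I2], intro impI)
      fix s :: real assume "s \<noteq> 0" "s \<in> {0..A}"
      then have s: "0 < s" "s \<le> A" by auto
      have "norm (\<i> * (iexp s - 1) * complex_of_real (c / s - c / A)) = norm (iexp s - 1) * \<bar>c / s - c / A\<bar>"
        by (simp add: norm_mult del: of_real_diff of_real_divide)
      also have "\<dots> \<le> s * (2 * \<bar>c\<bar> / s)"
      proof (rule mult_mono)
        have "\<bar>c / s - c / A\<bar> \<le> \<bar>c\<bar> / s + \<bar>c\<bar> / A"
          using s assms by (intro order_trans[OF abs_triangle_ineq4]) (simp add: abs_divide)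
        also have "\<dots> \<le> 2 * \<bar>c\<bar> / s" using s assms by (simp add: field_simps mult_right_mono)
        finally show "\<bar>c / s - c / A\<bar> \<le> 2 * \<bar>c\<bar> / s" .
      qed (use norm_iexp_minus_one_le[of s] s in auto)
      finally show "norm (\<i> * (iexp s - 1) * complex_of_real (c / s - c / A)) \<le> 2 * \<bar>c\<bar>" using s by simp
    qed
  qed (use assms in auto)
  then have "Re (trunc_lim c A) = (LBINT s. Re (?g s))"
    unfolding trunc_lim_def by (rule integral_Re[symmetric])
  also have "\<dots> = - c * (LBINT s. indicator {0..A} s * (sin s / s)) + c / A * (LBINT s. indicator {0..A} s * sin s)"
    unfolding Re_g
    by (subst Bochner_Integration.integral_add[OF integrable_mult_right[OF int1] integrable_mult_right[OF int2]])
       (simp only: Bochner_Integration.integral_mult_right_zero)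
  finally show ?thesis unfolding Si cos by (simp add: field_simps)
qed

text \<open>\<open>Si A\<close> tends to \<open>pi / 2\<close>; doubling accounts for the two tails
  and is the origin of the constant \<open>c * pi\<close> in the limit law.\<close>

lemma Re_trunc_lim_tendsto: "((\<lambda>A. 2 * Re (trunc_lim c A)) \<longlongrightarrow> - (c * pi)) at_top"
proof (rule Lim_transform_eventually)
  have "((\<lambda>A::real. (1 - cos A) / A) \<longlongrightarrow> 0) at_top"
  proof (rule tendsto_sandwich[where f = "\<lambda>_. 0" and h = "\<lambda>A. 2 / A"])
    show "eventually (\<lambda>A::real. 0 \<le> (1 - cos A) / A) at_top"
      using eventually_gt_at_top[of 0] by eventually_elim simp
    show "eventually (\<lambda>A::real. (1 - cos A) / A \<le> 2 / A) at_top"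
      using eventually_gt_at_top[of 0]
    proof eventually_elim
      case (elim A)
      have "1 - cos A \<le> 2" using cos_ge_minus_one[of A] by linarith
      then show ?case using elim by (simp add: divide_right_mono)
    qed
    show "((\<lambda>A::real. 2 / A) \<longlongrightarrow> 0) at_top" by real_asymp
  qed simp
  then have "((\<lambda>A. 2 * (- c * (Si A - (1 - cos A) / A))) \<longlongrightarrow> 2 * (- c * (pi / 2 - 0))) at_top"
    by (intro tendsto_intros Si_at_top)
  then show "((\<lambda>A. 2 * (- c * (Si A - (1 - cos A) / A))) \<longlongrightarrow> - (c * pi)) at_top" by simp
  show "eventually (\<lambda>A. 2 * (- c * (Si A - (1 - cos A) / A)) = 2 * Re (trunc_lim c A)) at_top"
    using eventually_gt_at_top[of 0] by eventually_elim (simp add: Re_trunc_lim)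
qed

text \<open>On \<open>{-B<..<B}\<close> the exponential is compensated by its linear part, whose
  contribution is the truncated mean. Reflecting the law turns the negative half into a positive one
  and conjugates it, so that one asymptotic result for \<open>trunc_char\<close> serves both
  tails.\<close>

lemma (in real_distribution) char_decompose:
  assumes "\<xi> > 0" "B > 0"
  shows "char M \<xi> - 1 = trunc_char M B \<xi> + cnj (trunc_char (distr M borel uminus) B \<xi>)
     + \<i> * \<xi> * (LINT x|M. indicator {-B<..<B} x * x) + (CLINT x|M. indicator {x. B \<le> \<bar>x\<bar>} x *\<^sub>R (iexp (\<xi> * x) - 1))"
proof -
  let ?h = "\<lambda>x. iexp (\<xi> * x) - 1 - \<i> * (\<xi> * x)"
  have h_meas [measurable]: "?h \<in> borel_measurable borel" by measurable
  have h_bound: "norm (?h x) \<le> 2 + \<xi> * B" if "\<bar>x\<bar> < B" for x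
  proof -
    have "norm (?h x) \<le> norm (iexp (\<xi> * x)) + norm (1::complex) + norm (\<i> * (\<xi> * x))"
      by (intro order_trans[OF norm_triangle_ineq4] add_mono order_refl)
    also have "\<dots> \<le> 2 + \<xi> * B"
      using that assms by (auto simp: norm_mult abs_mult)
    finally show ?thesis .
  qed
  have int_h: "complex_integrable M (\<lambda>x. indicator S x *\<^sub>R ?h x)"
    if "S \<subseteq> {-B<..<B}" "S \<in> sets borel" for S
    using that h_bound \<open>B > 0\<close> assms
    by (intro integrable_const_bound[where B = "2 + \<xi> * B"])
       (auto simp: subset_eq abs_less_iff split: split_indicator intro!: AE_I2)
  have int_x: "complex_integrable M (\<lambda>x. complex_of_real (indicator {-B<..<B} x * x))"
    using assms by (intro integrable_const_bound[where B = B]) (auto split: split_indicator)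
  have int_t: "complex_integrable M (\<lambda>x. indicator {x. B \<le> \<bar>x\<bar>} x *\<^sub>R (iexp (\<xi> * x) - 1))"
    by (intro integrable_const_bound[where B = 2]) (auto intro!: AE_I2 order_trans[OF norm_triangle_ineq4] split: split_indicator)
  have refl_eq: "cnj (trunc_char (distr M borel uminus) B \<xi>) = (CLINT x|M. indicator {-B<..<0} x *\<^sub>R ?h x)"
  proof -
    have "trunc_char (distr M borel uminus) B \<xi> =
      (CLINT x|M. indicator {0<..<B} (- x) *\<^sub>R (iexp (\<xi> * - x) - 1 - \<i> * (\<xi> * - x)))"
      unfolding trunc_char_def by (rule integral_distr) auto
    also have "cnj \<dots> = (CLINT x|M. cnj (indicator {0<..<B} (- x) *\<^sub>R (iexp (\<xi> * - x) - 1 - \<i> * (\<xi> * - x))))"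
      by (rule Bochner_Integration.integral_cnj[symmetric])
    also have "\<dots> = (CLINT x|M. indicator {-B<..<0} x *\<^sub>R ?h x)"
    proof (rule Bochner_Integration.integral_cong[OF refl])
      fix x
      have "cnj (iexp (\<xi> * - x)) = iexp (\<xi> * x)"
        by (simp add: complex_eq_iff Re_exp Im_exp)
      then have "cnj (iexp (\<xi> * - x) - 1 - \<i> * (\<xi> * - x)) = ?h x" by simp
      moreover have "indicator {0<..<B} (- x) = (indicator {-B<..<0} x :: real)"
        by (auto split: split_indicator)
      ultimately show "cnj (indicator {0<..<B} (- x) *\<^sub>R (iexp (\<xi> * - x) - 1 - \<i> * (\<xi> * - x))) = indicator {-B<..<0} x *\<^sub>R ?h x"
        by (simp only: complex_cnj_scaleR)
    qed
    finally show ?thesis .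
  qed
  have "char M \<xi> - 1 = (CLINT x|M. iexp (\<xi> * x) - 1)"
    using integrable_iexp[of "\<lambda>x. \<xi> * x"] prob_space
    by (subst Bochner_Integration.integral_diff) (auto simp: char_def)
  also have "\<dots> = (CLINT x|M. ((indicator {0<..<B} x *\<^sub>R ?h x + indicator {-B<..<0} x *\<^sub>R ?h x)
      + \<i> * \<xi> * complex_of_real (indicator {-B<..<B} x * x)) + indicator {x. B \<le> \<bar>x\<bar>} x *\<^sub>R (iexp (\<xi> * x) - 1))"
  proof (rule Bochner_Integration.integral_cong[OF refl])
    fix x
    show "iexp (\<xi> * x) - 1 = ((indicator {0<..<B} x *\<^sub>R ?h x + indicator {-B<..<0} x *\<^sub>R ?h x)
      + \<i> * \<xi> * complex_of_real (indicator {-B<..<B} x * x)) + indicator {x. B \<le> \<bar>x\<bar>} x *\<^sub>R (iexp (\<xi> * x) - 1)"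
      by (cases "x = 0"; cases "x > 0"; cases "\<bar>x\<bar> < B") (use assms in \<open>auto simp: indicator_def abs_if split: if_splits\<close>)
  qed
  also have "\<dots> = (CLINT x|M. indicator {0<..<B} x *\<^sub>R ?h x) + (CLINT x|M. indicator {-B<..<0} x *\<^sub>R ?h x)
      + \<i> * \<xi> * (CLINT x|M. complex_of_real (indicator {-B<..<B} x * x))
      + (CLINT x|M. indicator {x. B \<le> \<bar>x\<bar>} x *\<^sub>R (iexp (\<xi> * x) - 1))"
  proof -
    have i1: "complex_integrable M (\<lambda>x. indicator {0<..<B} x *\<^sub>R ?h x)"
      and i2: "complex_integrable M (\<lambda>x. indicator {-B<..<0} x *\<^sub>R ?h x)"
      using assms by (intro int_h; auto)+
    have i3: "complex_integrable M (\<lambda>x. \<i> * \<xi> * complex_of_real (indicator {-B<..<B} x * x))"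
      by (rule integrable_mult_right[OF int_x])
    show ?thesis
      by (simp only: Bochner_Integration.integral_add[OF Bochner_Integration.integrable_add[OF Bochner_Integration.integrable_add[OF i1 i2] i3] int_t]
          Bochner_Integration.integral_add[OF Bochner_Integration.integrable_add[OF i1 i2] i3]
          Bochner_Integration.integral_add[OF i1 i2] Bochner_Integration.integral_mult_right_zero)
  qed
  finally show ?thesis unfolding refl_eq unfolding trunc_char_def integral_complex_of_real .
qed

text \<open>With \<open>B = A / \<xi>\<close> and \<open>A\<close> fixed, the two truncated parts
  divided by \<open>\<xi>\<close> converge to conjugate numbers, because both tails have the same
  constant \<open>c\<close>, so their sum becomes real. The truncated mean converges to
  \<open>\<gamma>\<close>, and the large values contribute \<open>O(1 / A)\<close> uniformly in
  \<open>\<xi>\<close>. Letting \<open>A\<close> grow afterwards turns the real sum into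
  \<open>- c * pi\<close>.\<close>

theorem char_expansion:
  fixes M :: "real measure"
  assumes M: "real_distribution M"
    and tail_plus: "((\<lambda>x. x * (1 - cdf M x)) \<longlongrightarrow> c) at_top"
    and tail_minus: "((\<lambda>x. \<bar>x\<bar> * cdf M x) \<longlongrightarrow> c) at_bot"
    and mean: "((\<lambda>R. \<integral>x. indicator {-R<..<R} x * x \<partial>M) \<longlongrightarrow> \<gamma>) at_top"
  shows "((\<lambda>\<xi>. (char M \<xi> - 1) / \<xi>) \<longlongrightarrow> \<i> * \<gamma> - c * pi) (at_right 0)"
proof -
  interpret M: real_distribution M by fact
  define M' where "M' = distr M borel uminus"
  interpret M': real_distribution M'
    unfolding M'_def by (rule M.real_distribution_distr) simp
  have tp: "((\<lambda>x. x * measure M {x..}) \<longlongrightarrow> c) at_top"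
    by (rule M.tail_atLeast_limit[OF tail_plus])
  have M'_tail: "measure M' {x..} = measure M {..-x}" for x
    unfolding M'_def by (subst measure_distr) (auto intro!: arg_cong[where f = "measure M"])
  \<comment> \<open>The closed tail of the reflected law at \<open>x\<close> is
    \<open>cdf M (- x)\<close> itself, so the left side is handled without a sandwich.\<close>
  have tm: "((\<lambda>x. x * measure M' {x..}) \<longlongrightarrow> c) at_top"
  proof (rule Lim_transform_eventually)
    show "((\<lambda>x. \<bar>- x\<bar> * cdf M (- x)) \<longlongrightarrow> c) at_top"
      using tail_minus unfolding at_bot_mirror filterlim_filtermap .
    show "eventually (\<lambda>x. \<bar>- x\<bar> * cdf M (- x) = x * measure M' {x..}) at_top"
      using eventually_ge_at_top[of 0] by eventually_elim (simp add: cdf_def M'_tail)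
  qed
  obtain K1 where K1: "K1 > 0" "\<And>x. x > 0 \<Longrightarrow> x * measure M {x..} \<le> K1"
    using M.tail_atLeast_bound[OF tp] by blast
  obtain K2 where K2: "K2 > 0" "\<And>x. x > 0 \<Longrightarrow> x * measure M' {x..} \<le> K2"
    using M'.tail_atLeast_bound[OF tm] by blast
  have tail_int: "norm (CLINT x|M. indicator {x. B \<le> \<bar>x\<bar>} x *\<^sub>R (iexp (\<xi> * x) - 1)) \<le> 2 * ((K1 + K2) / B)"
    if "B > 0" for B \<xi>
  proof -
    have "norm (CLINT x|M. indicator {x. B \<le> \<bar>x\<bar>} x *\<^sub>R (iexp (\<xi> * x) - 1))
        \<le> (LINT x|M. norm (indicator {x. B \<le> \<bar>x\<bar>} x *\<^sub>R (iexp (\<xi> * x) - 1)))"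
      by (rule integral_norm_bound)
    also have "\<dots> \<le> (LINT x|M. 2 * indicator {x. B \<le> \<bar>x\<bar>} x)"
    proof (rule integral_mono)
      show "norm (indicator {x. B \<le> \<bar>x\<bar>} x *\<^sub>R (iexp (\<xi> * x) - 1)) \<le> 2 * indicator {x. B \<le> \<bar>x\<bar>} x" for x
        by (auto intro!: order_trans[OF norm_triangle_ineq4] split: split_indicator)
      show "integrable M (\<lambda>x. norm (indicator {x. B \<le> \<bar>x\<bar>} x *\<^sub>R (iexp (\<xi> * x) - 1)))"
        by (intro M.integrable_const_bound[where B = 2]) (auto intro!: AE_I2 order_trans[OF norm_triangle_ineq4] split: split_indicator)
      show "integrable M (\<lambda>x. 2 * indicator {x. B \<le> \<bar>x\<bar>} x :: real)"
        by (intro M.integrable_const_bound[where B = 2]) (auto split: split_indicator)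
    qed
    also have "\<dots> = 2 * measure M ({B..} \<union> {..-B})"
    proof -
      have "{x. B \<le> \<bar>x\<bar>} = {B..} \<union> {..-B}" using that by auto
      then show ?thesis by simp
    qed
    also have "\<dots> \<le> 2 * (measure M {B..} + measure M {..-B})"
      by (intro mult_left_mono measure_Un_le) auto
    also have "\<dots> \<le> 2 * (K1 / B + K2 / B)"
      using K1(2)[OF that] K2(2)[OF that] that unfolding M'_tail
      by (intro mult_left_mono add_mono) (auto simp: field_simps)
    finally show ?thesis by (simp add: add_divide_distrib)
  qed
  show ?thesis
  proof (rule tendstoI)
    fix e :: real assume "e > 0"
    \<comment> \<open>The error splits into four quarters of \<open>e\<close>: the limit in
      \<open>A\<close>, the values beyond \<open>A / \<xi>\<close>, the truncated parts and the
      truncated mean. \<open>A\<close> is fixed before \<open>\<xi>\<close>.\<close>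
    have "eventually (\<lambda>A. dist (2 * Re (trunc_lim c A)) (- (c * pi)) < e / 4) at_top"
      by (rule tendstoD[OF Re_trunc_lim_tendsto]) (use \<open>e > 0\<close> in simp)
    moreover have "((\<lambda>A::real. 2 * ((K1 + K2) / A)) \<longlongrightarrow> 0) at_top" by real_asymp
    then have "eventually (\<lambda>A::real. 2 * ((K1 + K2) / A) < e / 4) at_top"
      by (rule order_tendstoD) (use \<open>e > 0\<close> in simp)
    ultimately have "eventually (\<lambda>A. dist (2 * Re (trunc_lim c A)) (- (c * pi)) < e / 4 \<and> 2 * ((K1 + K2) / A) < e / 4 \<and> 0 < A) at_top"
      using eventually_gt_at_top[of 0] by eventually_elim auto
    then obtain A where A: "dist (2 * Re (trunc_lim c A)) (- (c * pi)) < e / 4" "2 * ((K1 + K2) / A) < e / 4" "0 < A"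
      using eventually_happens by fastforce
    define T where "T \<xi> = trunc_char M (A / \<xi>) \<xi> / \<xi> + cnj (trunc_char M' (A / \<xi>) \<xi> / \<xi>)" for \<xi> :: real
    define G where "G \<xi> = (LINT x|M. indicator {-(A / \<xi>)<..<A / \<xi>} x * x)" for \<xi>
    have "(T \<longlongrightarrow> trunc_lim c A + cnj (trunc_lim c A)) (at_right 0)"
      unfolding T_def
      by (intro tendsto_add tendsto_cnj M.trunc_char_tendsto M'.trunc_char_tendsto tp tm \<open>0 < A\<close>)
    then have T: "(T \<longlongrightarrow> complex_of_real (2 * Re (trunc_lim c A))) (at_right 0)"
      by (simp add: complex_add_cnj)
    have "filterlim (\<lambda>\<xi>. A / \<xi>) at_top (at_right 0)"
      using \<open>0 < A\<close> by real_asymp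
    from filterlim_compose[OF mean this]
    have G: "(G \<longlongrightarrow> \<gamma>) (at_right 0)" unfolding G_def .
    have "eventually (\<lambda>\<xi>. dist (T \<xi>) (complex_of_real (2 * Re (trunc_lim c A))) < e / 4) (at_right 0)"
      by (rule tendstoD[OF T]) (use \<open>e > 0\<close> in simp)
    moreover have "eventually (\<lambda>\<xi>. dist (G \<xi>) \<gamma> < e / 4) (at_right 0)"
      by (rule tendstoD[OF G]) (use \<open>e > 0\<close> in simp)
    ultimately show "eventually (\<lambda>\<xi>. dist ((char M \<xi> - 1) / \<xi>) (\<i> * \<gamma> - c * pi) < e) (at_right 0)"
      using eventually_at_right_less[of 0]
    proof eventually_elim
      case (elim \<xi>)
      let ?R = "(CLINT x|M. indicator {x. A / \<xi> \<le> \<bar>x\<bar>} x *\<^sub>R (iexp (\<xi> * x) - 1))"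
      have "0 < A / \<xi>" using elim A by simp
      from M.char_decompose[OF elim(3) this]
      have "(char M \<xi> - 1) / \<xi> = T \<xi> + \<i> * G \<xi> + ?R / \<xi>"
        using elim(3) by (simp add: T_def G_def M'_def field_simps)
      then have "(char M \<xi> - 1) / \<xi> - (\<i> * \<gamma> - c * pi) =
         (T \<xi> - complex_of_real (2 * Re (trunc_lim c A))) + (\<i> * (G \<xi> - \<gamma>) + (?R / \<xi>
          + complex_of_real (2 * Re (trunc_lim c A) - - (c * pi))))"
        by (simp add: algebra_simps)
      also have "norm \<dots> \<le> norm (T \<xi> - complex_of_real (2 * Re (trunc_lim c A))) + (norm (\<i> * (G \<xi> - \<gamma>)) + (norm (?R / \<xi>)
          + norm (complex_of_real (2 * Re (trunc_lim c A) - - (c * pi)))))"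
        by (intro order_trans[OF norm_triangle_ineq] add_mono order_refl)
      also have "norm (\<i> * (G \<xi> - \<gamma>)) = dist (G \<xi>) \<gamma>"
        by (simp add: norm_mult dist_real_def del: of_real_diff flip: of_real_diff)
      also have "norm (complex_of_real (2 * Re (trunc_lim c A) - - (c * pi))) = dist (2 * Re (trunc_lim c A)) (- (c * pi))"
        by (simp only: norm_of_real dist_real_def)
      also have "norm (?R / \<xi>) \<le> 2 * ((K1 + K2) / A)"
        using tail_int[OF \<open>0 < A / \<xi>\<close>, of \<xi>] elim(3) A(3) by (simp add: norm_divide field_simps)
      finally have "dist ((char M \<xi> - 1) / \<xi>) (\<i> * \<gamma> - c * pi) \<le> dist (T \<xi>) (complex_of_real (2 * Re (trunc_lim c A)))
          + (dist (G \<xi>) \<gamma> + (2 * ((K1 + K2) / A) + dist (2 * Re (trunc_lim c A)) (- (c * pi))))"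
        by (simp only: dist_norm)
      then show ?case using elim(1,2) A(1,2) by linarith
    qed
  qed
qed

section \<open>The smoothing transform\<close>

text \<open>On the convex half-plane of nonpositive real part the derivative of \<open>exp\<close>
  has modulus at most 1, so the mean value inequality applies with constant 1.\<close>

lemma norm_exp_minus_one_le:
  assumes "Re w \<le> 0"
  shows "norm (exp w - 1) \<le> norm w"
proof -
  have "norm (exp w - exp 0) \<le> 1 * norm (w - 0)"
  proof (rule field_differentiable_bound[where S = "{z. Re z \<le> 0}" and f' = exp])
    show "convex {z. Re z \<le> 0}" by (rule convex_halfspace_Re_le)
    fix z assume "z \<in> {z. Re z \<le> 0}"
    then show "norm (exp z) \<le> 1" by simp
    show "(exp has_field_derivative exp z) (at z within {z. Re z \<le> 0})"
      by (auto intro!: derivative_eq_intros)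
  qed (use assms in auto)
  then show ?thesis by simp
qed

lemma norm_exp_le_one:
  fixes \<psi> :: complex
  assumes "Re \<psi> \<le> 0" "0 \<le> x"
  shows "norm (exp (\<psi> * complex_of_real x)) \<le> 1"
  using assms by (simp add: mult_nonpos_nonneg)

lemma norm_mult_diff_le:
  fixes a b c d :: complex
  assumes "norm a \<le> 1" "norm d \<le> 1"
  shows "norm (a * b - c * d) \<le> norm (a - c) + norm (b - d)"
proof -
  have "a * b - c * d = a * (b - d) + (a - c) * d" by (simp add: algebra_simps)
  also have "norm \<dots> \<le> norm a * norm (b - d) + norm (a - c) * norm d"
    by (intro order_trans[OF norm_triangle_ineq]) (simp add: norm_mult)
  also have "\<dots> \<le> 1 * norm (b - d) + norm (a - c) * 1"
    using assms by (intro add_mono mult_mono) auto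
  finally show ?thesis by simp
qed

text \<open>The absolute values keep the kernel bounded on the whole line; only x, z \<ge> 0 matter.\<close>

definition laplace :: "real measure \<Rightarrow> complex \<Rightarrow> real \<Rightarrow> complex" where
  "laplace \<zeta> \<psi> x = (CLINT z|\<zeta>. exp (\<psi> * complex_of_real (\<bar>x\<bar> * \<bar>z\<bar>)))"

section \<open>Transforms of laws on the half-line\<close>

context real_distribution
begin

lemma norm_laplace_le_one:
  assumes "Re \<psi> \<le> 0"
  shows "norm (laplace M \<psi> x) \<le> 1"
proof -
  have "norm (laplace M \<psi> x) \<le> (LINT z|M. norm (exp (\<psi> * complex_of_real (\<bar>x\<bar> * \<bar>z\<bar>))))"
    unfolding laplace_def by (rule integral_norm_bound)
  also have "\<dots> \<le> (LINT z|M. 1)"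
    by (intro integral_mono norm_exp_le_one[OF assms] integrable_norm integrable_const_bound[where B = 1] AE_I2)
       (auto simp del: of_real_mult norm_exp_eq_Re intro: norm_exp_le_one[OF assms])
  finally show ?thesis using prob_space by simp
qed

lemma laplace_0 [simp]: "laplace M \<psi> 0 = 1"
  using prob_space by (simp add: laplace_def)

lemma isCont_laplace:
  assumes "Re \<psi> \<le> 0"
  shows "isCont (laplace M \<psi>) x"
  unfolding isCont_def laplace_def
proof (rule integral_dominated_convergence_within[where w = "\<lambda>_. 1"])
  show "AE z in M. ((\<lambda>t. exp (\<psi> * complex_of_real (\<bar>t\<bar> * \<bar>z\<bar>))) \<longlongrightarrow> exp (\<psi> * complex_of_real (\<bar>x\<bar> * \<bar>z\<bar>))) (at x)"
    by (intro AE_I2 tendsto_intros)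
  show "AE z in M. norm (exp (\<psi> * complex_of_real (\<bar>t\<bar> * \<bar>z\<bar>))) \<le> 1" for t
    by (intro AE_I2 norm_exp_le_one[OF assms]) simp
qed auto

lemma measurable_laplace:
  assumes "Re \<psi> \<le> 0"
  shows "laplace M \<psi> \<in> borel_measurable borel"
  by (intro borel_measurable_continuous_onI continuous_at_imp_continuous_on ballI isCont_laplace assms)

text \<open>The difference quotients are dominated by \<open>norm \<psi> * \<bar>z\<bar>\<close>, so
  a first moment gives the one-sided derivative at 0. In the convergence and uniqueness arguments
  the mean of \<open>Z\<close> enters through this slope.\<close>

lemma laplace_expansion:
  assumes "Re \<psi> \<le> 0" "integrable M (\<lambda>z. z)" "AE z in M. 0 \<le> z"
  shows "((\<lambda>x. (laplace M \<psi> x - 1) / x) \<longlongrightarrow> \<psi> * (LINT z|M. z)) (at_right 0)"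
proof -
  let ?f = "\<lambda>x z. (exp (\<psi> * complex_of_real (\<bar>x\<bar> * \<bar>z\<bar>)) - 1) / complex_of_real x"
  have "((\<lambda>x. CLINT z|M. ?f x z) \<longlongrightarrow> (CLINT z|M. \<psi> * complex_of_real z)) (at_right 0)"
  proof (rule integral_dominated_convergence_within[where w = "\<lambda>z. norm \<psi> * \<bar>z\<bar>"])
    show "AE z in M. ((\<lambda>x. ?f x z) \<longlongrightarrow> \<psi> * complex_of_real z) (at_right 0)"
      using assms(3)
    proof eventually_elim
      case (elim z)
      have "((\<lambda>x. exp (\<psi> * complex_of_real z * x)) has_field_derivative \<psi> * complex_of_real z) (at 0)"
        by (auto intro!: derivative_eq_intros)
      then have "((\<lambda>x::complex. (exp (\<psi> * complex_of_real z * x) - 1) / x) \<longlongrightarrow> \<psi> * complex_of_real z) (at 0)"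
        by (simp add: has_field_derivative_iff)
      moreover have "filterlim complex_of_real (at 0) (at_right 0)"
        by (auto simp: filterlim_at eventually_at_filter intro!: tendsto_eq_intros)
      ultimately have "((\<lambda>x. (exp (\<psi> * complex_of_real z * complex_of_real x) - 1) / complex_of_real x) \<longlongrightarrow> \<psi> * complex_of_real z) (at_right 0)"
        by (rule filterlim_compose)
      then show ?case
        by (rule Lim_transform_eventually)
           (use eventually_at_right_less[of "0::real"] in eventually_elim, use elim in \<open>simp add: mult_ac\<close>)
    qed
    show "AE z in M. norm (?f x z) \<le> norm \<psi> * \<bar>z\<bar>" if "x \<in> {0<..} - {0}" for x
    proof (rule AE_I2)
      fix z
      have "norm (exp (\<psi> * complex_of_real (\<bar>x\<bar> * \<bar>z\<bar>)) - 1) \<le> norm (\<psi> * complex_of_real (\<bar>x\<bar> * \<bar>z\<bar>))"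
        by (rule norm_exp_minus_one_le) (use assms(1) in \<open>simp add: mult_nonpos_nonneg\<close>)
      also have "\<dots> = norm \<psi> * \<bar>z\<bar> * x" using that by (simp add: norm_mult)
      finally show "norm (?f x z) \<le> norm \<psi> * \<bar>z\<bar>"
        using that by (simp add: norm_divide field_simps)
    qed
    show "integrable M (\<lambda>z. norm \<psi> * \<bar>z\<bar>)" using assms(2) by simp
  qed auto
  moreover have "(CLINT z|M. ?f x z) = (laplace M \<psi> x - 1) / x" for x
  proof -
    have "complex_integrable M (\<lambda>z. exp (\<psi> * complex_of_real (\<bar>x\<bar> * \<bar>z\<bar>)))"
      by (intro integrable_const_bound[where B = 1] AE_I2 norm_exp_le_one[OF assms(1)]) auto
    then show ?thesis unfolding laplace_def using prob_space
      by (simp only: Bochner_Integration.integral_divide_zero Bochner_Integration.integral_diff integrable_const) simp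
  qed
  ultimately show ?thesis by (simp only: integral_complex_of_real Bochner_Integration.integral_mult_right_zero)
qed

text \<open>Since \<open>laplace\<close> sees only \<open>\<bar>x\<bar>\<close>, the sign of
  \<open>u\<close> is moved into \<open>\<psi>\<close>, which stays purely imaginary and so meets
  \<open>Re \<psi> \<le> 0\<close>.\<close>

lemma laplace_char:
  assumes "AE z in M. 0 \<le> z"
  shows "char M u = laplace M (\<i> * sgn u) u"
  unfolding char_def laplace_def
proof (rule integral_cong_AE)
  show "AE z in M. iexp (u * z) = exp (\<i> * complex_of_real (sgn u) * complex_of_real (\<bar>u\<bar> * \<bar>z\<bar>))"
    using assms
  proof eventually_elim
    case (elim z)
    have "sgn u * (\<bar>u\<bar> * \<bar>z\<bar>) = u * z" using elim by (simp add: sgn_if)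
    then have "complex_of_real (sgn u) * complex_of_real (\<bar>u\<bar> * \<bar>z\<bar>) = complex_of_real (u * z)"
      by (simp only: of_real_mult[symmetric])
    then show ?case by (simp only: mult.assoc)
  qed
qed auto

end

text \<open>Here \<open>a\<close> stands for S(1), and \<open>moment_d\<close> is mu(d) < mu(1) with
  the denominators cleared, that is S(d) < a d. The bound \<open>d \<le> 2\<close> is the range in
  which the second-order estimate of \<open>exp\<close> holds.\<close>

locale smoothing =
  fixes Q :: "(real \<times> real) measure" and a d :: real
  assumes prob_Q: "prob_space Q"
    and sets_Q: "sets Q = sets borel"
    and nonneg_Q: "AE p in Q. 0 \<le> fst p \<and> 0 \<le> snd p"
    and int_1: "integrable Q (\<lambda>p. fst p + snd p)"
    and moment_1: "(\<integral>p. fst p + snd p \<partial>Q) = 1 + a"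
    and d_bounds: "1 < d" "d \<le> 2"
    and int_d: "integrable Q (\<lambda>p. fst p powr d + snd p powr d)"
    and moment_d: "(\<integral>p. fst p powr d + snd p powr d \<partial>Q) < 1 + a * d"
begin

sublocale Q: prob_space Q by (rule prob_Q)

lemma sets_Q_pair [measurable_cong]: "sets Q = sets (borel \<Otimes>\<^sub>M borel)"
  by (simp only: sets_Q borel_prod)

definition "Sd = (\<integral>p. fst p powr d + snd p powr d \<partial>Q) - 1"

lemma Sd: "- 1 \<le> Sd" "Sd < a * d"
  using moment_d by (auto simp: Sd_def intro!: integral_nonneg_AE)

text \<open>As S(d) is at least -1, the inequality S(d) < a d forces \<open>a * d > - 1\<close>, and
  then \<open>d > 1\<close> excludes \<open>a \<le> - 1\<close>. Since \<open>a\<close> may be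
  negative, these bounds are what makes the powers of the uniform variable integrable at 0.\<close>

lemma a_gt: "a > - 1" and ad_gt: "a * d > - 1"
proof -
  show *: "a * d > - 1" using Sd by linarith
  show "a > - 1"
  proof (rule ccontr)
    assume "\<not> a > - 1"
    then have "a * d \<le> - 1 * d" using d_bounds by (intro mult_right_mono) auto
    then show False using * d_bounds by linarith
  qed
qed

definition U :: "real measure" where "U = uniform_measure lborel {0<..<1}"

lemma sets_U [measurable_cong]: "sets U = sets borel" by (simp add: U_def)

lemma space_U [simp]: "space U = UNIV" by (simp add: U_def)

sublocale U: prob_space U
  unfolding U_def by (rule prob_space_uniform_measure) auto

lemma U_density: "U = density lborel (\<lambda>x. ennreal (indicator {0<..<1} x))"
  unfolding U_def uniform_measure_def
  by (rule density_cong) (auto simp: divide_ennreal_def split: split_indicator)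

lemma integral_U:
  fixes f :: "real \<Rightarrow> 'b::{banach, second_countable_topology}"
  assumes "f \<in> borel_measurable borel"
  shows "(\<integral>x. f x \<partial>U) = (\<integral>x. indicator {0<..<1} x *\<^sub>R f x \<partial>lborel)"
  unfolding U_density using assms by (subst integral_density) auto

lemma has_bochner_integral_powr_U:
  assumes "b > - 1"
  shows "has_bochner_integral U (\<lambda>\<theta>. \<theta> powr b) (1 / (b + 1))"
proof (rule has_bochner_integral_nn_integral)
  have "((\<lambda>x. x powr b) has_integral (1 powr (b + 1) / (b + 1))) {0..1}"
    by (rule has_integral_powr_from_0[OF assms]) simp
  then have "(\<integral>\<^sup>+x. ennreal (x powr b) * indicator {0..1} x \<partial>lborel) = ennreal (1 powr (b + 1) / (b + 1))"
    by (intro nn_integral_has_integral_lebesgue') (use assms in auto)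
  moreover have "(\<integral>\<^sup>+x. ennreal (x powr b) \<partial>U) = (\<integral>\<^sup>+x. ennreal (x powr b) * indicator {0..1} x \<partial>lborel)"
    unfolding U_density
  proof (subst nn_integral_density)
    show "(\<integral>\<^sup>+x. ennreal (indicator {0<..<1} x) * ennreal (x powr b) \<partial>lborel)
        = (\<integral>\<^sup>+x. ennreal (x powr b) * indicator {0..1} x \<partial>lborel)"
      by (rule nn_integral_cong_AE)
         (use AE_lborel_singleton[of "1::real"] in eventually_elim, auto split: split_indicator)
  qed auto
  ultimately show "(\<integral>\<^sup>+x. ennreal (x powr b) \<partial>U) = ennreal (1 / (b + 1))" by simp
qed (use assms in auto)

text \<open>The transform of \<open>L Z1 + R Z2\<close> at \<open>z\<close> when \<open>g\<close> is
  the transform of \<open>Z\<close>. The uniform factor is left out: it becomes an integral over a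
  time variable.\<close>

definition T :: "(real \<Rightarrow> complex) \<Rightarrow> real \<Rightarrow> complex" where
  "T g z = (CLINT p|Q. g (fst p * z) * g (snd p * z))"

lemma norm_T_le:
  assumes "g \<in> borel_measurable borel" "\<And>x. norm (g x) \<le> 1"
  shows "norm (T g z) \<le> 1"
proof -
  note [measurable] = assms(1)
  have b: "norm (g (fst p * z) * g (snd p * z)) \<le> 1" for p
    using mult_mono[OF assms(2) assms(2)] by (simp add: norm_mult)
  have "norm (T g z) \<le> (LINT p|Q. norm (g (fst p * z) * g (snd p * z)))"
    unfolding T_def by (rule integral_norm_bound)
  also have "\<dots> \<le> (LINT p|Q. 1)"
    by (intro integral_mono b integrable_norm Q.integrable_const_bound[where B = 1] AE_I2) auto
  finally show ?thesis using Q.prob_space by simp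
qed

lemma isCont_T:
  assumes "\<And>x. isCont g x" "\<And>x. norm (g x) \<le> 1"
  shows "isCont (T g) z"
proof -
  have [measurable]: "g \<in> borel_measurable borel"
    by (intro borel_measurable_continuous_onI continuous_at_imp_continuous_on ballI assms)
  have b: "norm (g (fst p * z) * g (snd p * z)) \<le> 1" for p z
    using mult_mono[OF assms(2) assms(2)] by (simp add: norm_mult)
  show ?thesis
    unfolding isCont_def T_def
  proof (rule integral_dominated_convergence_within[where w = "\<lambda>_. 1"])
    show "AE p in Q. ((\<lambda>t. g (fst p * t) * g (snd p * t)) \<longlongrightarrow> g (fst p * z) * g (snd p * z)) (at z)"
      by (intro AE_I2 tendsto_mult isCont_tendsto_compose[OF assms(1)] tendsto_intros)
  qed (use b in auto)
qed

lemma measurable_T: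
  assumes [measurable]: "g \<in> borel_measurable borel"
  shows "T g \<in> borel_measurable borel"
  unfolding T_def by measurable

end

lemma AE_pair_fst:
  assumes "prob_space N" "AE x in M. P x" "sigma_finite_measure M"
  shows "AE p in M \<Otimes>\<^sub>M N. P (fst p)"
proof -
  interpret N: prob_space N by fact
  have "distr (M \<Otimes>\<^sub>M N) M fst = M" by (rule N.distr_pair_fst)
  then have "AE x in distr (M \<Otimes>\<^sub>M N) M fst. P x" using assms(2) by (simp only:)
  then show ?thesis by (rule AE_distrD[OF measurable_fst])
qed

lemma AE_pair_snd:
  assumes "prob_space M" "AE x in N. P x" "sigma_finite_measure N"
  shows "AE p in M \<Otimes>\<^sub>M N. P (snd p)"
proof -
  interpret M: prob_space M by fact
  interpret N: sigma_finite_measure N by fact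
  obtain S where S: "S \<in> null_sets N" "{x \<in> space N. \<not> P x} \<subseteq> S"
    using assms(2) by (auto simp: eventually_ae_filter)
  show ?thesis
  proof (rule AE_I)
    show "{p \<in> space (M \<Otimes>\<^sub>M N). \<not> P (snd p)} \<subseteq> space M \<times> S"
      using S(2) by (auto simp: space_pair_measure)
    show "emeasure (M \<Otimes>\<^sub>M N) (space M \<times> S) = 0"
      using S(1) by (subst N.emeasure_pair_measure_Times) auto
  qed (use S(1) in auto)
qed

lemma integral_pair_mult:
  fixes f g :: "_ \<Rightarrow> complex"
  assumes "prob_space M" "prob_space N"
    and "f \<in> borel_measurable M" "g \<in> borel_measurable N" "\<And>x. norm (f x) \<le> 1" "\<And>x. norm (g x) \<le> 1"
  shows "(\<integral>p. f (fst p) * g (snd p) \<partial>(M \<Otimes>\<^sub>M N)) = (\<integral>x. f x \<partial>M) * (\<integral>y. g y \<partial>N)"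
proof -
  note [measurable] = assms(3,4)
  interpret M: prob_space M by fact
  interpret N: prob_space N by fact
  interpret P: pair_prob_space M N ..
  have b: "norm (f x * g y) \<le> 1" for x y
    using mult_mono[OF assms(5)[of x] assms(6)[of y]] by (simp add: norm_mult)
  have "(\<integral>p. f (fst p) * g (snd p) \<partial>(M \<Otimes>\<^sub>M N)) = (\<integral>x. \<integral>y. f (fst (x, y)) * g (snd (x, y)) \<partial>N \<partial>M)"
    by (rule P.integral_fst'[symmetric]) (intro P.P.integrable_const_bound[where B = 1] AE_I2 b, measurable)
  then show ?thesis by simp
qed

section \<open>The fixed point equation as a differential equation\<close>

context smoothing
begin

definition Zlaw :: "real measure \<Rightarrow> bool" where
  "Zlaw \<zeta> \<longleftrightarrow> real_distribution \<zeta> \<and> (AE z in \<zeta>. 0 \<le> z) \<and> integrable \<zeta> (\<lambda>z. z) \<and>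
     (\<integral>z. z \<partial>\<zeta>) = 1 \<and> \<zeta> = fp_rhs Q a \<zeta>"

abbreviation "fpmap \<equiv> \<lambda>q. fst (fst q) powr a * (fst (snd (fst q)) * fst (snd q) + snd (snd (fst q)) * snd (snd q))"

lemma fp_rhs_alt:
  "fp_rhs Q a \<zeta> = distr ((U \<Otimes>\<^sub>M Q) \<Otimes>\<^sub>M (\<zeta> \<Otimes>\<^sub>M \<zeta>)) borel fpmap"
  unfolding fp_rhs_def U_def[symmetric] by (rule arg_cong[where f = "distr _ _"]) (auto simp: fun_eq_iff)

lemma measurable_fpmap:
  assumes "real_distribution \<zeta>"
  shows "fpmap \<in> borel_measurable ((U \<Otimes>\<^sub>M Q) \<Otimes>\<^sub>M (\<zeta> \<Otimes>\<^sub>M \<zeta>))"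
proof -
  interpret \<zeta>: real_distribution \<zeta> by fact
  show ?thesis by measurable
qed

lemma prob_fp_base:
  assumes "real_distribution \<zeta>"
  shows "prob_space ((U \<Otimes>\<^sub>M Q) \<Otimes>\<^sub>M (\<zeta> \<Otimes>\<^sub>M \<zeta>))"
proof -
  interpret \<zeta>: real_distribution \<zeta> by fact
  interpret P1: pair_prob_space U Q ..
  interpret P2: pair_prob_space \<zeta> \<zeta> ..
  interpret P: pair_prob_space "U \<Otimes>\<^sub>M Q" "\<zeta> \<Otimes>\<^sub>M \<zeta>" ..
  show ?thesis by (rule P.P.prob_space_axioms)
qed

lemma real_distribution_fp_rhs:
  assumes "real_distribution \<zeta>"
  shows "real_distribution (fp_rhs Q a \<zeta>)"
  unfolding fp_rhs_alt by (rule prob_space.real_distribution_distr[OF prob_fp_base[OF assms] measurable_fpmap[OF assms]])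

lemma AE_fp_base:
  assumes "real_distribution \<zeta>" "AE z in \<zeta>. 0 \<le> z"
  shows "AE q in (U \<Otimes>\<^sub>M Q) \<Otimes>\<^sub>M (\<zeta> \<Otimes>\<^sub>M \<zeta>).
    0 \<le> fst (snd (fst q)) \<and> 0 \<le> snd (snd (fst q)) \<and> 0 \<le> fst (snd q) \<and> 0 \<le> snd (snd q)"
proof -
  interpret \<zeta>: real_distribution \<zeta> by fact
  interpret P1: pair_prob_space U Q ..
  interpret P2: pair_prob_space \<zeta> \<zeta> ..
  have "AE p in U \<Otimes>\<^sub>M Q. 0 \<le> fst (snd p) \<and> 0 \<le> snd (snd p)"
    by (rule AE_pair_snd[OF U.prob_space_axioms nonneg_Q Q.sigma_finite_measure_axioms])
  then have "AE q in (U \<Otimes>\<^sub>M Q) \<Otimes>\<^sub>M (\<zeta> \<Otimes>\<^sub>M \<zeta>). 0 \<le> fst (snd (fst q)) \<and> 0 \<le> snd (snd (fst q))"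
    by (rule AE_pair_fst[OF P2.P.prob_space_axioms _ P1.P.sigma_finite_measure_axioms])
  moreover have "AE p in \<zeta> \<Otimes>\<^sub>M \<zeta>. 0 \<le> fst p"
    by (rule AE_pair_fst[OF \<zeta>.prob_space_axioms assms(2) \<zeta>.sigma_finite_measure_axioms])
  then have "AE q in (U \<Otimes>\<^sub>M Q) \<Otimes>\<^sub>M (\<zeta> \<Otimes>\<^sub>M \<zeta>). 0 \<le> fst (snd q)"
    by (rule AE_pair_snd[OF P1.P.prob_space_axioms _ P2.P.sigma_finite_measure_axioms])
  moreover have "AE p in \<zeta> \<Otimes>\<^sub>M \<zeta>. 0 \<le> snd p"
    by (rule AE_pair_snd[OF \<zeta>.prob_space_axioms assms(2) \<zeta>.sigma_finite_measure_axioms])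
  then have "AE q in (U \<Otimes>\<^sub>M Q) \<Otimes>\<^sub>M (\<zeta> \<Otimes>\<^sub>M \<zeta>). 0 \<le> snd (snd q)"
    by (rule AE_pair_snd[OF P1.P.prob_space_axioms _ P2.P.sigma_finite_measure_axioms])
  ultimately show ?thesis by eventually_elim simp
qed

lemma AE_fp_rhs_nonneg:
  assumes "real_distribution \<zeta>" "AE z in \<zeta>. 0 \<le> z"
  shows "AE z in fp_rhs Q a \<zeta>. 0 \<le> z"
  unfolding fp_rhs_alt
proof (subst AE_distr_iff[OF measurable_fpmap[OF assms(1)]])
  show "AE q in (U \<Otimes>\<^sub>M Q) \<Otimes>\<^sub>M (\<zeta> \<Otimes>\<^sub>M \<zeta>). 0 \<le> fpmap q"
    using AE_fp_base[OF assms] by eventually_elim simp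
qed simp

text \<open>For nonnegative \<open>L\<close>, \<open>R\<close> and \<open>Z\<close> the absolute
  value of the sum is the sum of the absolute values, so the exponential factors and Fubini
  separates \<open>Z1\<close> from \<open>Z2\<close>. The outer integral stays over \<open>U\<close>
  and \<open>Q\<close> jointly, a form to which dominated convergence applies directly.\<close>

lemma laplace_fp_rhs_pair:
  assumes \<zeta>: "real_distribution \<zeta>" "AE z in \<zeta>. 0 \<le> z" and \<psi>: "Re \<psi> \<le> 0"
  shows "laplace (fp_rhs Q a \<zeta>) \<psi> x =
    (CLINT p|U \<Otimes>\<^sub>M Q. laplace \<zeta> \<psi> (fst (snd p) * (fst p powr a * x)) * laplace \<zeta> \<psi> (snd (snd p) * (fst p powr a * x)))"
proof -
  interpret \<zeta>: real_distribution \<zeta> by fact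
  interpret P1: pair_prob_space U Q ..
  interpret P2: pair_prob_space \<zeta> \<zeta> ..
  interpret P: pair_prob_space "U \<Otimes>\<^sub>M Q" "\<zeta> \<Otimes>\<^sub>M \<zeta>" ..
  let ?e = "\<lambda>y z. exp (\<psi> * complex_of_real (\<bar>y\<bar> * \<bar>z\<bar>))"
  let ?G = "\<lambda>p z. ?e (fst (snd p) * (fst p powr a * x)) (fst z) * ?e (snd (snd p) * (fst p powr a * x)) (snd z)"
  have e1: "norm (?e y z) \<le> 1" for y z by (rule norm_exp_le_one[OF \<psi>]) simp
  have G1: "norm (?G p z) \<le> 1" for p z
    using mult_mono[OF e1 e1] by (simp only: norm_mult) simp
  have "laplace (fp_rhs Q a \<zeta>) \<psi> x = (CLINT q|(U \<Otimes>\<^sub>M Q) \<Otimes>\<^sub>M (\<zeta> \<Otimes>\<^sub>M \<zeta>). ?e x (fpmap q))"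
    unfolding laplace_def fp_rhs_alt by (rule integral_distr[OF measurable_fpmap[OF \<zeta>(1)]]) auto
  also have "\<dots> = (CLINT q|(U \<Otimes>\<^sub>M Q) \<Otimes>\<^sub>M (\<zeta> \<Otimes>\<^sub>M \<zeta>). ?G (fst q) (snd q))"
  proof (rule integral_cong_AE)
    show "AE q in (U \<Otimes>\<^sub>M Q) \<Otimes>\<^sub>M (\<zeta> \<Otimes>\<^sub>M \<zeta>). ?e x (fpmap q) = ?G (fst q) (snd q)"
      using AE_fp_base[OF \<zeta>]
    proof eventually_elim
      case (elim q)
      have "\<bar>x\<bar> * \<bar>fpmap q\<bar> = \<bar>fst (snd (fst q)) * (fst (fst q) powr a * x)\<bar> * \<bar>fst (snd q)\<bar>
          + \<bar>snd (snd (fst q)) * (fst (fst q) powr a * x)\<bar> * \<bar>snd (snd q)\<bar>"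
        using elim by (simp add: abs_mult algebra_simps)
      then show ?case
        by (simp only: of_real_add distrib_left exp_add)
    qed
  qed measurable
  also have "\<dots> = (CLINT p|U \<Otimes>\<^sub>M Q. CLINT z|\<zeta> \<Otimes>\<^sub>M \<zeta>. ?G (fst (p, z)) (snd (p, z)))"
    by (rule P.integral_fst'[symmetric]) (intro P.P.integrable_const_bound[where B = 1] AE_I2 G1, measurable)
  also have "\<dots> = (CLINT p|U \<Otimes>\<^sub>M Q. laplace \<zeta> \<psi> (fst (snd p) * (fst p powr a * x)) * laplace \<zeta> \<psi> (snd (snd p) * (fst p powr a * x)))"
  proof (rule Bochner_Integration.integral_cong[OF refl])
    fix p
    have "(CLINT z|\<zeta> \<Otimes>\<^sub>M \<zeta>. ?G (fst (p, z)) (snd (p, z))) =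
      (CLINT z|\<zeta> \<Otimes>\<^sub>M \<zeta>. ?e (fst (snd p) * (fst p powr a * x)) (fst z) * ?e (snd (snd p) * (fst p powr a * x)) (snd z))"
      by (simp only: fst_conv snd_conv)
    also have "\<dots> = laplace \<zeta> \<psi> (fst (snd p) * (fst p powr a * x)) * laplace \<zeta> \<psi> (snd (snd p) * (fst p powr a * x))"
      unfolding laplace_def by (rule integral_pair_mult[OF \<zeta>.prob_space_axioms \<zeta>.prob_space_axioms _ _ e1 e1]) measurable
    finally show "(CLINT z|\<zeta> \<Otimes>\<^sub>M \<zeta>. ?G (fst (p, z)) (snd (p, z))) =
      laplace \<zeta> \<psi> (fst (snd p) * (fst p powr a * x)) * laplace \<zeta> \<psi> (snd (snd p) * (fst p powr a * x))" .
  qed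
  finally show ?thesis .
qed

lemma laplace_fp_rhs:
  assumes \<zeta>: "real_distribution \<zeta>" "AE z in \<zeta>. 0 \<le> z" and \<psi>: "Re \<psi> \<le> 0"
  shows "laplace (fp_rhs Q a \<zeta>) \<psi> x = (CLINT \<theta>|U. T (laplace \<zeta> \<psi>) (\<theta> powr a * x))"
proof -
  interpret \<zeta>: real_distribution \<zeta> by fact
  interpret P1: pair_prob_space U Q ..
  note [measurable] = \<zeta>.measurable_laplace[OF \<psi>]
  let ?G = "\<lambda>p. laplace \<zeta> \<psi> (fst (snd p) * (fst p powr a * x)) * laplace \<zeta> \<psi> (snd (snd p) * (fst p powr a * x))"
  have G1: "norm (?G p) \<le> 1" for p
    using mult_mono[OF \<zeta>.norm_laplace_le_one[OF \<psi>] \<zeta>.norm_laplace_le_one[OF \<psi>]] by (simp only: norm_mult) simp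
  have "(CLINT p|U \<Otimes>\<^sub>M Q. ?G p) = (CLINT \<theta>|U. CLINT p|Q. ?G (\<theta>, p))"
    by (rule P1.integral_fst'[symmetric]) (intro P1.P.integrable_const_bound[where B = 1] AE_I2 G1, measurable)
  then show ?thesis unfolding laplace_fp_rhs_pair[OF assms] T_def by simp
qed

text \<open>Substituting \<open>\<sigma> = y * \<theta>\<close> turns the mean over the uniform
  variable into an integral over \<open>{0<..<y}\<close>. The dependence on \<open>y\<close> now
  sits in the upper limit, ready for the fundamental theorem of calculus.\<close>

lemma Zlaw_scaled_integral:
  assumes "Zlaw \<zeta>" and \<psi>: "Re \<psi> \<le> 0" and "0 < y"
  shows "y *\<^sub>R laplace \<zeta> \<psi> (y powr a * x) = (CLBINT \<sigma>. indicator {0<..<y} \<sigma> *\<^sub>R T (laplace \<zeta> \<psi>) (\<sigma> powr a * x))"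
proof -
  interpret \<zeta>: real_distribution \<zeta> using assms by (simp add: Zlaw_def)
  note [measurable] = \<zeta>.measurable_laplace[OF \<psi>] measurable_T[OF \<zeta>.measurable_laplace[OF \<psi>]]
  let ?T = "T (laplace \<zeta> \<psi>)"
  have "laplace \<zeta> \<psi> (y powr a * x) = laplace (fp_rhs Q a \<zeta>) \<psi> (y powr a * x)"
    using assms(1) by (simp add: Zlaw_def)
  also have "\<dots> = (CLINT \<theta>|U. ?T (\<theta> powr a * (y powr a * x)))"
    by (rule laplace_fp_rhs) (use assms in \<open>auto simp: Zlaw_def\<close>)
  also have "\<dots> = (CLBINT \<theta>. indicator {0<..<1} \<theta> *\<^sub>R ?T (\<theta> powr a * (y powr a * x)))"
    by (rule integral_U) measurable
  finally have "y *\<^sub>R laplace \<zeta> \<psi> (y powr a * x) = y *\<^sub>R (CLBINT \<theta>. indicator {0<..<1} \<theta> *\<^sub>R ?T (\<theta> powr a * (y powr a * x)))"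
    by (rule arg_cong)
  also have "\<dots> = \<bar>y\<bar> *\<^sub>R (CLBINT \<theta>. indicator {0<..<y} (0 + y * \<theta>) *\<^sub>R ?T ((0 + y * \<theta>) powr a * x))"
  proof -
    have "indicator {0<..<1} \<theta> *\<^sub>R ?T (\<theta> powr a * (y powr a * x)) =
        indicator {0<..<y} (0 + y * \<theta>) *\<^sub>R ?T ((0 + y * \<theta>) powr a * x)" for \<theta>
      using \<open>0 < y\<close> by (auto simp: powr_mult mult_ac zero_less_mult_iff split: split_indicator)
    then show ?thesis using \<open>0 < y\<close> by simp
  qed
  also have "\<dots> = (CLBINT \<sigma>. indicator {0<..<y} \<sigma> *\<^sub>R ?T (\<sigma> powr a * x))"
  proof -
    have "y \<noteq> 0" using \<open>0 < y\<close> by simp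
    from lborel_integral_real_affine[OF this, of "\<lambda>\<sigma>. indicator {0<..<y} \<sigma> *\<^sub>R ?T (\<sigma> powr a * x)" 0]
    show ?thesis by (rule sym)
  qed
  finally show ?thesis .
qed

text \<open>Write \<open>v\<close> for the flow
  \<open>y \<mapsto> laplace \<zeta> \<psi> (y powr a * x)\<close>. The scaled identity says that
  \<open>y * v\<close> has derivative \<open>T v\<close>, hence \<open>y * v' = T v - v\<close>: the
  factor of one weight is replaced by that of its two descendants.\<close>

lemma laplace_flow_derivative:
  assumes Z: "Zlaw \<zeta>" and \<psi>: "Re \<psi> \<le> 0" and y: "0 < y"
  shows "((\<lambda>y. laplace \<zeta> \<psi> (y powr a * x)) has_vector_derivative
    (1 / y) *\<^sub>R (T (laplace \<zeta> \<psi>) (y powr a * x) - laplace \<zeta> \<psi> (y powr a * x))) (at y)"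
proof -
  interpret \<zeta>: real_distribution \<zeta> using assms by (simp add: Zlaw_def)
  note [measurable] = \<zeta>.measurable_laplace[OF \<psi>] measurable_T[OF \<zeta>.measurable_laplace[OF \<psi>]]
  let ?w = "laplace \<zeta> \<psi>"
  define h where "h \<sigma> = T ?w (\<sigma> powr a * x)" for \<sigma>
  have [measurable]: "h \<in> borel_measurable borel" unfolding h_def by measurable
  have h1: "norm (h s) \<le> 1" for s
    unfolding h_def by (rule norm_T_le) (auto simp: \<zeta>.norm_laplace_le_one[OF \<psi>])
  have hcont: "isCont h s" if "0 < s" for s
    unfolding h_def
    by (rule continuous_at_compose[unfolded comp_def, OF _ isCont_T])
       (use that in \<open>auto intro!: continuous_intros \<zeta>.isCont_laplace \<zeta>.norm_laplace_le_one \<psi>\<close>)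
  have int: "complex_integrable lborel (\<lambda>s. indicator S s *\<^sub>R h s)" if "S \<in> sets borel" "S \<subseteq> {0..u}" for S u
  proof (rule integrableI_bounded_set_indicator[where B = 1])
    have "emeasure lborel S \<le> emeasure lborel {0..u}" using that by (intro emeasure_mono) auto
    also have "\<dots> < \<infinity>" by (simp add: emeasure_lborel_Icc_eq)
    finally show "emeasure lborel S < \<infinity>" .
    show "S \<in> sets lborel" using that(1) by simp
    show "h \<in> borel_measurable lborel" by simp
    show "AE s in lborel. s \<in> S \<longrightarrow> norm (h s) \<le> 1" by (simp only: h1) simp
  qed
  define G where "G u = u *\<^sub>R ?w (u powr a * x)" for u
  \<comment> \<open>The integral is split at \<open>y / 2\<close> because the continuity of
    \<open>h\<close> is available only on the positive half-line: at 0 the factor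
    \<open>\<sigma> powr a\<close> may blow up. Only the part over \<open>{y / 2..u}\<close> varies
    with \<open>u\<close>.\<close>
  have G_split: "G u = G (y / 2) + (CLBINT s:{y / 2..u}. h s)" if "y / 2 \<le> u" for u
  proof -
    have u: "0 < u" using that y by simp
    have "G u = (CLBINT s. indicator {0<..<u} s *\<^sub>R h s)"
      unfolding G_def h_def by (rule Zlaw_scaled_integral[OF Z \<psi> u])
    also have "\<dots> = (CLBINT s. indicator {0<..<y / 2} s *\<^sub>R h s + indicator {y / 2..u} s *\<^sub>R h s)"
    proof (rule integral_cong_AE)
      show "AE s in lborel. indicator {0<..<u} s *\<^sub>R h s = indicator {0<..<y / 2} s *\<^sub>R h s + indicator {y / 2..u} s *\<^sub>R h s"
        using AE_lborel_singleton[of u]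
        by eventually_elim (use that y in \<open>auto split: split_indicator\<close>)
    qed auto
    also have "\<dots> = (CLBINT s. indicator {0<..<y / 2} s *\<^sub>R h s) + (CLBINT s. indicator {y / 2..u} s *\<^sub>R h s)"
      by (rule Bochner_Integration.integral_add) (intro int[of _ u]; use y that in auto)+
    also have "(CLBINT s. indicator {0<..<y / 2} s *\<^sub>R h s) = G (y / 2)"
      unfolding G_def h_def by (rule Zlaw_scaled_integral[OF Z \<psi>, symmetric]) (use y in simp)
    finally show ?thesis by (simp add: set_lebesgue_integral_def)
  qed
  have "((\<lambda>u. LBINT s=y / 2..u. h s) has_vector_derivative h y) (at y within {y / 2..2 * y})"
    by (rule interval_integral_FTC2) (use y in \<open>auto intro!: continuous_at_imp_continuous_on hcont\<close>)
  then have "((\<lambda>u. LBINT s=y / 2..u. h s) has_vector_derivative h y) (at y)"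
    using y by (simp add: at_within_Icc_at)
  then have "((\<lambda>u. G (y / 2) + (LBINT s=y / 2..u. h s)) has_vector_derivative h y) (at y)"
    by (auto intro!: derivative_eq_intros)
  then have "(G has_vector_derivative h y) (at y)"
  proof (rule has_vector_derivative_transform_within_open[where S = "{y / 2<..}"])
    show "G (y / 2) + (LBINT s=y / 2..u. h s) = G u" if "u \<in> {y / 2<..}" for u
      using G_split[of u] that by (simp only: interval_integral_Icc greaterThan_iff less_imp_le)
  qed (use y in auto)
  then have "((\<lambda>u. (1 / u) *\<^sub>R G u) has_vector_derivative (1 / y) *\<^sub>R h y + (- 1 / y\<^sup>2) *\<^sub>R G y) (at y)"
    by (intro has_vector_derivative_scaleR) (use y in \<open>auto intro!: derivative_eq_intros simp: power2_eq_square divide_simps\<close>)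
  then have "((\<lambda>u. ?w (u powr a * x)) has_vector_derivative (1 / y) *\<^sub>R h y + (- 1 / y\<^sup>2) *\<^sub>R G y) (at y)"
    by (rule has_vector_derivative_transform_within_open[where S = "{0<..}"]) (use y in \<open>auto simp: G_def\<close>)
  moreover have "(1 / y) *\<^sub>R h y + (- 1 / y\<^sup>2) *\<^sub>R G y = (1 / y) *\<^sub>R (T ?w (y powr a * x) - ?w (y powr a * x))"
    using y by (simp add: G_def h_def scaleR_diff_right power2_eq_square)
  ultimately show ?thesis by simp
qed

end

section \<open>Existence of the fixed point\<close>

text \<open>For \<open>norm w \<le> 1\<close> the quadratic bound is used, and
  \<open>d \<le> 2\<close> makes the square smaller than \<open>norm w powr d\<close>. For larger
  \<open>w\<close> the linear bound \<open>2 * norm w\<close> is used, and \<open>d > 1\<close> lets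
  the power dominate. The quadratic bound is the mean value inequality once more, applied to a
  function with derivative \<open>exp z - 1\<close>.\<close>

lemma norm_exp_second_order:
  assumes "Re w \<le> 0" "1 < d" "d \<le> 2"
  shows "norm (exp w - 1 - w) \<le> 2 * norm w powr d"
proof -
  have quad: "norm (exp w - 1 - w) \<le> norm w * norm w"
  proof -
    let ?S = "{z. Re z \<le> 0} \<inter> cball 0 (norm w)"
    have "norm ((exp w - 1 - w) - (exp 0 - 1 - 0)) \<le> norm w * norm (w - 0)"
    proof (rule field_differentiable_bound[where S = ?S and f' = "\<lambda>z. exp z - 1"])
      show "convex ?S" by (intro convex_Int convex_halfspace_Re_le convex_cball)
      fix z assume z: "z \<in> ?S"
      then show "norm (exp z - 1) \<le> norm w"
        using norm_exp_minus_one_le[of z] by simp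
      show "((\<lambda>z. exp z - 1 - z) has_field_derivative exp z - 1) (at z within ?S)"
        by (auto intro!: derivative_eq_intros)
    qed (use assms in auto)
    then show ?thesis by simp
  qed
  have lin: "norm (exp w - 1 - w) \<le> 2 * norm w"
    using norm_triangle_ineq4[of "exp w - 1" w] norm_exp_minus_one_le[OF assms(1)] by linarith
  show ?thesis
  proof (cases "norm w \<le> 1")
    case True
    have "norm w * norm w \<le> norm w powr d"
    proof (cases "norm w = 0")
      case False
      have "norm w powr 2 \<le> norm w powr d"
        by (rule powr_mono') (use True False assms in auto)
      then show ?thesis using False by (simp add: power2_eq_square)
    qed simp
    then show ?thesis using quad powr_ge_zero[of "norm w" d] by linarith
  next
    case False
    then have "norm w powr 1 \<le> norm w powr d" by (intro powr_mono) (use assms in auto)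
    then show ?thesis using lin False by simp
  qed
qed

text \<open>\<open>l + r\<close> is at most twice the larger term, and 4 bounds
  \<open>2 powr d\<close>.\<close>

lemma powr_add_le:
  fixes l r d :: real
  assumes "0 \<le> l" "0 \<le> r" "1 < d" "d \<le> 2"
  shows "(l + r) powr d \<le> 4 * (l powr d + r powr d)"
proof -
  have m: "(2 * max l r) powr d = 2 powr d * max l r powr d"
    by (rule powr_mult)
  have "(l + r) powr d \<le> (2 * max l r) powr d"
    using assms by (intro powr_mono2) auto
  also have "\<dots> \<le> 4 * (l powr d + r powr d)"
    unfolding m
  proof (rule mult_mono)
    have "2 powr d \<le> 2 powr (2::real)" using assms by (intro powr_mono) auto
    then show "2 powr d \<le> 4" by simp
    show "max l r powr d \<le> l powr d + r powr d" by (auto simp: max_def)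
  qed auto
  finally show ?thesis .
qed

lemma (in real_distribution) laplace_weak_limit:
  assumes "\<And>n. real_distribution (N n)" "weak_conv_m N M" "Re \<psi> \<le> 0"
  shows "(\<lambda>n. laplace (N n) \<psi> x) \<longlonglongrightarrow> laplace M \<psi> x"
  unfolding laplace_def
  by (rule weak_conv_imp_integral_bdd_continuous_conv[OF assms(1) real_distribution_axioms assms(2), where B = 1])
     (auto intro!: continuous_intros norm_exp_le_one[OF assms(3)] simp del: of_real_mult norm_exp_eq_Re)

context smoothing
begin

text \<open>Contraction factor of the smoothing map for the distance weighted by
  \<open>\<bar>x\<bar> powr d\<close>: \<open>1 + Sd\<close> is the mean of
  \<open>L powr d + R powr d\<close>, and \<open>1 / (a * d + 1)\<close> is the mean of
  \<open>\<theta> powr (a * d)\<close>. The condition S(d) < a d is exactly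
  \<open>\<rho> < 1\<close>.\<close>

definition "\<rho> = (1 + Sd) / (a * d + 1)"

lemma rho: "0 \<le> \<rho>" "\<rho> < 1"
  using Sd ad_gt by (auto simp: \<rho>_def)

lemma integral_powr_U: "b > - 1 \<Longrightarrow> (\<integral>\<theta>. \<theta> powr b \<partial>U) = 1 / (b + 1)"
  and integrable_powr_U: "b > - 1 \<Longrightarrow> integrable U (\<lambda>\<theta>. \<theta> powr b)"
  using has_bochner_integral_powr_U by (auto simp: has_bochner_integral_iff)

text \<open>For functions bounded by 1 a difference of products splits into a sum of differences;
  then \<open>\<bar>L * z\<bar> powr d\<close> factors, and the mean of
  \<open>L powr d + R powr d\<close> is \<open>1 + Sd\<close>.\<close>

lemma T_lipschitz:
  assumes [measurable]: "g \<in> borel_measurable borel" "g' \<in> borel_measurable borel"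
    and le1: "\<And>x. norm (g x) \<le> 1" "\<And>x. norm (g' x) \<le> 1"
    and diff: "\<And>x. norm (g x - g' x) \<le> K * \<bar>x\<bar> powr d"
  shows "norm (T g z - T g' z) \<le> K * (1 + Sd) * \<bar>z\<bar> powr d"
proof -
  have b: "norm (g x * g y) \<le> 1" "norm (g' x * g' y) \<le> 1" for x y
    using mult_mono[OF le1(1) le1(1)] mult_mono[OF le1(2) le1(2)] by (simp_all add: norm_mult)
  have i: "complex_integrable Q (\<lambda>p. g (fst p * z) * g (snd p * z))"
       "complex_integrable Q (\<lambda>p. g' (fst p * z) * g' (snd p * z))"
    by (intro Q.integrable_const_bound[where B = 1] AE_I2 b; measurable)+
  have "norm (T g z - T g' z) = norm (CLINT p|Q. g (fst p * z) * g (snd p * z) - g' (fst p * z) * g' (snd p * z))"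
    unfolding T_def by (subst Bochner_Integration.integral_diff[OF i]) simp
  also have "\<dots> \<le> (LINT p|Q. norm (g (fst p * z) * g (snd p * z) - g' (fst p * z) * g' (snd p * z)))"
    by (rule integral_norm_bound)
  also have "\<dots> \<le> (LINT p|Q. K * \<bar>z\<bar> powr d * (fst p powr d + snd p powr d))"
  proof (rule integral_mono_AE)
    show "integrable Q (\<lambda>p. norm (g (fst p * z) * g (snd p * z) - g' (fst p * z) * g' (snd p * z)))"
      by (intro integrable_norm Bochner_Integration.integrable_diff i)
    show "integrable Q (\<lambda>p. K * \<bar>z\<bar> powr d * (fst p powr d + snd p powr d))"
      by (intro integrable_mult_right int_d)
    show "AE p in Q. norm (g (fst p * z) * g (snd p * z) - g' (fst p * z) * g' (snd p * z))
        \<le> K * \<bar>z\<bar> powr d * (fst p powr d + snd p powr d)"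
      using nonneg_Q
    proof eventually_elim
      case (elim p)
      have "norm (g (fst p * z) * g (snd p * z) - g' (fst p * z) * g' (snd p * z))
        \<le> norm (g (fst p * z) - g' (fst p * z)) + norm (g (snd p * z) - g' (snd p * z))"
        by (rule norm_mult_diff_le[OF le1])
      also have "\<dots> \<le> K * \<bar>fst p * z\<bar> powr d + K * \<bar>snd p * z\<bar> powr d"
        by (intro add_mono diff)
      also have "\<dots> = K * \<bar>z\<bar> powr d * (fst p powr d + snd p powr d)"
        using elim by (simp add: abs_mult powr_mult algebra_simps)
      finally show ?case .
    qed
  qed
  also have "\<dots> = K * (1 + Sd) * \<bar>z\<bar> powr d"
    using int_d by (simp add: Sd_def)
  finally show ?thesis .
qed

lemma laplace_fp_lipschitz:
  assumes \<zeta>: "real_distribution \<zeta>" "AE z in \<zeta>. 0 \<le> z" and \<zeta>': "real_distribution \<zeta>'" "AE z in \<zeta>'. 0 \<le> z"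
    and \<psi>: "Re \<psi> \<le> 0" and diff: "\<And>x. norm (laplace \<zeta> \<psi> x - laplace \<zeta>' \<psi> x) \<le> K * \<bar>x\<bar> powr d"
  shows "norm (laplace (fp_rhs Q a \<zeta>) \<psi> x - laplace (fp_rhs Q a \<zeta>') \<psi> x) \<le> K * \<rho> * \<bar>x\<bar> powr d"
proof -
  interpret \<zeta>: real_distribution \<zeta> by fact
  interpret \<zeta>': real_distribution \<zeta>' by fact
  note [measurable] = \<zeta>.measurable_laplace[OF \<psi>] \<zeta>'.measurable_laplace[OF \<psi>]
    measurable_T[OF \<zeta>.measurable_laplace[OF \<psi>]] measurable_T[OF \<zeta>'.measurable_laplace[OF \<psi>]]
  have T1: "norm (T (laplace \<zeta> \<psi>) z) \<le> 1" "norm (T (laplace \<zeta>' \<psi>) z) \<le> 1" for z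
    by (rule norm_T_le; auto simp: \<zeta>.norm_laplace_le_one[OF \<psi>] \<zeta>'.norm_laplace_le_one[OF \<psi>])+
  let ?D = "\<lambda>\<theta>. T (laplace \<zeta> \<psi>) (\<theta> powr a * x) - T (laplace \<zeta>' \<psi>) (\<theta> powr a * x)"
  have i: "complex_integrable U (\<lambda>\<theta>. T (laplace \<zeta> \<psi>) (\<theta> powr a * x))"
     "complex_integrable U (\<lambda>\<theta>. T (laplace \<zeta>' \<psi>) (\<theta> powr a * x))"
    by (intro U.integrable_const_bound[where B = 1] AE_I2 T1; measurable)+
  have "norm (laplace (fp_rhs Q a \<zeta>) \<psi> x - laplace (fp_rhs Q a \<zeta>') \<psi> x) = norm (CLINT \<theta>|U. ?D \<theta>)"
    unfolding laplace_fp_rhs[OF \<zeta> \<psi>] laplace_fp_rhs[OF \<zeta>' \<psi>]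
    by (subst Bochner_Integration.integral_diff[OF i]) simp
  also have "\<dots> \<le> (LINT \<theta>|U. norm (?D \<theta>))" by (rule integral_norm_bound)
  also have "\<dots> \<le> (LINT \<theta>|U. K * (1 + Sd) * \<bar>x\<bar> powr d * \<theta> powr (a * d))"
  proof (rule integral_mono_AE)
    show "integrable U (\<lambda>\<theta>. norm (?D \<theta>))"
      by (intro integrable_norm Bochner_Integration.integrable_diff i)
    show "integrable U (\<lambda>\<theta>. K * (1 + Sd) * \<bar>x\<bar> powr d * \<theta> powr (a * d))"
      by (intro integrable_mult_right integrable_powr_U ad_gt)
    show "AE \<theta> in U. norm (?D \<theta>) \<le> K * (1 + Sd) * \<bar>x\<bar> powr d * \<theta> powr (a * d)"
    proof (rule AE_I2)
      fix \<theta>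
      have "norm (?D \<theta>) \<le> K * (1 + Sd) * \<bar>\<theta> powr a * x\<bar> powr d"
        by (rule T_lipschitz) (auto simp: \<zeta>.norm_laplace_le_one[OF \<psi>] \<zeta>'.norm_laplace_le_one[OF \<psi>] diff)
      then show "norm (?D \<theta>) \<le> K * (1 + Sd) * \<bar>x\<bar> powr d * \<theta> powr (a * d)"
        by (simp add: abs_mult powr_mult powr_powr mult_ac)
    qed
  qed
  also have "\<dots> = K * \<rho> * \<bar>x\<bar> powr d"
    using ad_gt by (simp add: integral_powr_U \<rho>_def)
  finally show ?thesis .
qed

text \<open>The iteration starts at the point mass at 1: it has the mean 1 that the map preserves,
  so the first step changes the transform only at order \<open>\<bar>x\<bar> powr d\<close> and its
  weighted distance is finite.\<close>

primrec iter :: "nat \<Rightarrow> real measure" where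
  "iter 0 = return borel 1"
| "iter (Suc n) = fp_rhs Q a (iter n)"

lemma iter_real_distribution: "real_distribution (iter n)"
proof (induction n)
  case 0
  have "prob_space (return borel (1::real))" by (rule prob_space_return) simp
  then show ?case by (simp add: real_distribution_def real_distribution_axioms_def)
qed (simp add: real_distribution_fp_rhs)

lemma iter_nonneg: "AE z in iter n. 0 \<le> z"
proof (induction n)
  case 0
  have "AE z in return borel (1::real). 0 \<le> z" by (subst AE_return) auto
  then show ?case by (simp only: iter.simps)
next
  case (Suc n)
  then show ?case
    unfolding iter.simps by (rule AE_fp_rhs_nonneg[OF iter_real_distribution])
qed

text \<open>The mean is multiplied by the mean \<open>1 / (a + 1)\<close> of
  \<open>\<theta> powr a\<close> and by \<open>1 + a\<close>. The upper bound is the part that Fatou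
  passes on to the limit; the exact value 1 is recovered from the slope of the transform.\<close>

lemma nn_mean_fp_rhs:
  assumes \<zeta>: "real_distribution \<zeta>" "AE z in \<zeta>. 0 \<le> z" "(\<integral>\<^sup>+z. ennreal z \<partial>\<zeta>) \<le> 1"
  shows "(\<integral>\<^sup>+z. ennreal z \<partial>fp_rhs Q a \<zeta>) \<le> 1"
proof -
  interpret \<zeta>: real_distribution \<zeta> by fact
  interpret P1: pair_prob_space U Q ..
  interpret P2: pair_prob_space \<zeta> \<zeta> ..
  interpret P: pair_prob_space "U \<Otimes>\<^sub>M Q" "\<zeta> \<Otimes>\<^sub>M \<zeta>" ..
  let ?h = "\<lambda>p z. ennreal (fst p powr a) * (ennreal (fst (snd p)) * ennreal (fst z) + ennreal (snd (snd p)) * ennreal (snd z))"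
  have inner: "(\<integral>\<^sup>+z. ?h p z \<partial>(\<zeta> \<Otimes>\<^sub>M \<zeta>)) \<le> ennreal (fst p powr a) * (ennreal (fst (snd p)) + ennreal (snd (snd p)))" for p
  proof -
    have "(\<integral>\<^sup>+z. ennreal (fst z) \<partial>(\<zeta> \<Otimes>\<^sub>M \<zeta>)) = (\<integral>\<^sup>+z. \<integral>\<^sup>+z'. ennreal (fst (z, z')) \<partial>\<zeta> \<partial>\<zeta>)"
      by (rule \<zeta>.nn_integral_fst[symmetric]) measurable
    also have "\<dots> \<le> 1" using \<zeta>(3) \<zeta>.emeasure_space_1 by simp
    finally have m1: "(\<integral>\<^sup>+z. ennreal (fst z) \<partial>(\<zeta> \<Otimes>\<^sub>M \<zeta>)) \<le> 1" .
    have "(\<integral>\<^sup>+z. ennreal (snd z) \<partial>(\<zeta> \<Otimes>\<^sub>M \<zeta>)) = (\<integral>\<^sup>+z. \<integral>\<^sup>+z'. ennreal (snd (z, z')) \<partial>\<zeta> \<partial>\<zeta>)"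
      by (rule \<zeta>.nn_integral_fst[symmetric]) measurable
    also have "\<dots> \<le> 1" using \<zeta>(3) \<zeta>.emeasure_space_1 by simp
    finally have m2: "(\<integral>\<^sup>+z. ennreal (snd z) \<partial>(\<zeta> \<Otimes>\<^sub>M \<zeta>)) \<le> 1" .
    have "(\<integral>\<^sup>+z. ?h p z \<partial>(\<zeta> \<Otimes>\<^sub>M \<zeta>)) = ennreal (fst p powr a) *
       (ennreal (fst (snd p)) * (\<integral>\<^sup>+z. ennreal (fst z) \<partial>(\<zeta> \<Otimes>\<^sub>M \<zeta>)) + ennreal (snd (snd p)) * (\<integral>\<^sup>+z. ennreal (snd z) \<partial>(\<zeta> \<Otimes>\<^sub>M \<zeta>)))"
      by (simp add: nn_integral_cmult nn_integral_add)
    also have "\<dots> \<le> ennreal (fst p powr a) * (ennreal (fst (snd p)) * 1 + ennreal (snd (snd p)) * 1)"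
      by (intro mult_left_mono add_mono m1 m2) auto
    finally show ?thesis by simp
  qed
  have "(\<integral>\<^sup>+z. ennreal z \<partial>fp_rhs Q a \<zeta>) = (\<integral>\<^sup>+q. ennreal (fpmap q) \<partial>((U \<Otimes>\<^sub>M Q) \<Otimes>\<^sub>M (\<zeta> \<Otimes>\<^sub>M \<zeta>)))"
    unfolding fp_rhs_alt by (rule nn_integral_distr[OF measurable_fpmap[OF \<zeta>(1)]]) simp
  also have "\<dots> = (\<integral>\<^sup>+q. ?h (fst q) (snd q) \<partial>((U \<Otimes>\<^sub>M Q) \<Otimes>\<^sub>M (\<zeta> \<Otimes>\<^sub>M \<zeta>)))"
  proof (rule nn_integral_cong_AE)
    show "AE q in (U \<Otimes>\<^sub>M Q) \<Otimes>\<^sub>M (\<zeta> \<Otimes>\<^sub>M \<zeta>). ennreal (fpmap q) = ?h (fst q) (snd q)"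
      using AE_fp_base[OF \<zeta>(1,2)]
      by eventually_elim (simp add: ennreal_mult' ennreal_plus)
  qed
  also have "\<dots> = (\<integral>\<^sup>+p. \<integral>\<^sup>+z. ?h (fst (p, z)) (snd (p, z)) \<partial>(\<zeta> \<Otimes>\<^sub>M \<zeta>) \<partial>(U \<Otimes>\<^sub>M Q))"
    by (rule P2.P.nn_integral_fst[symmetric]) measurable
  also have "\<dots> \<le> (\<integral>\<^sup>+p. ennreal (fst p powr a) * (ennreal (fst (snd p)) + ennreal (snd (snd p))) \<partial>(U \<Otimes>\<^sub>M Q))"
    by (intro nn_integral_mono) (use inner in simp)
  also have "\<dots> = (\<integral>\<^sup>+\<theta>. \<integral>\<^sup>+p. ennreal (fst (\<theta>, p) powr a) * (ennreal (fst (snd (\<theta>, p))) + ennreal (snd (snd (\<theta>, p)))) \<partial>Q \<partial>U)"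
    by (rule Q.nn_integral_fst[symmetric]) measurable
  also have "\<dots> = (\<integral>\<^sup>+\<theta>. ennreal (\<theta> powr a) \<partial>U) * (\<integral>\<^sup>+p. ennreal (fst p) + ennreal (snd p) \<partial>Q)"
    by (simp add: nn_integral_cmult nn_integral_multc)
  also have "(\<integral>\<^sup>+p. ennreal (fst p) + ennreal (snd p) \<partial>Q) = (\<integral>\<^sup>+p. ennreal (fst p + snd p) \<partial>Q)"
    by (rule nn_integral_cong_AE) (use nonneg_Q in eventually_elim, simp add: ennreal_plus)
  also have "\<dots> = ennreal (1 + a)"
  proof (subst nn_integral_eq_integral[OF int_1])
    show "AE p in Q. 0 \<le> fst p + snd p" using nonneg_Q by eventually_elim simp
  qed (simp add: moment_1)
  also have "(\<integral>\<^sup>+\<theta>. ennreal (\<theta> powr a) \<partial>U) = ennreal (1 / (a + 1))"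
    by (subst nn_integral_eq_integral[OF integrable_powr_U[OF a_gt]]) (auto simp: integral_powr_U[OF a_gt])
  also have "ennreal (1 / (a + 1)) * ennreal (1 + a) = 1"
    using a_gt by (simp add: ennreal_mult'[symmetric])
  finally show ?thesis .
qed

lemma iter_mean: "(\<integral>\<^sup>+z. ennreal z \<partial>iter n) \<le> 1"
proof (induction n)
  case 0
  show ?case by (simp add: nn_integral_return)
next
  case (Suc n)
  then show ?case by (simp add: nn_mean_fp_rhs iter_real_distribution iter_nonneg)
qed

lemma laplace_iter_0: "laplace (iter 0) \<psi> x = exp (\<psi> * complex_of_real \<bar>x\<bar>)"
  by (simp add: laplace_def integral_return)


text \<open>For nonnegative \<open>L\<close> and \<open>R\<close> the product is a single
  exponential of \<open>\<psi> * \<bar>z\<bar> * (L + R)\<close>, and \<open>L + R\<close> has mean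
  \<open>1 + a\<close>. The constant 8 is 2 from \<open>norm_exp_second_order\<close> times 4 from
  \<open>powr_add_le\<close>.\<close>

lemma exp_add_expansion:
  assumes "Re \<psi> \<le> 0" "norm \<psi> \<le> 1"
  shows "norm (T (\<lambda>x. exp (\<psi> * complex_of_real \<bar>x\<bar>)) z - (1 + \<psi> * complex_of_real (\<bar>z\<bar> * (1 + a))))
    \<le> 8 * (1 + Sd) * \<bar>z\<bar> powr d"
proof -
  let ?w = "\<lambda>p. \<psi> * complex_of_real (\<bar>z\<bar> * (fst p + snd p))"
  let ?e = "\<lambda>p. exp (\<psi> * complex_of_real \<bar>fst p * z\<bar>) * exp (\<psi> * complex_of_real \<bar>snd p * z\<bar>)"
  have e1: "norm (?e p) \<le> 1" for p
  proof -
    have "norm (exp (\<psi> * complex_of_real \<bar>x\<bar>)) \<le> 1" for x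
      by (rule norm_exp_le_one[OF assms(1)]) simp
    then have "norm (exp (\<psi> * complex_of_real \<bar>fst p * z\<bar>)) * norm (exp (\<psi> * complex_of_real \<bar>snd p * z\<bar>)) \<le> 1 * 1"
      by (intro mult_mono) auto
    then show ?thesis by (simp only: norm_mult)
  qed
  have ie: "complex_integrable Q ?e"
    by (rule Q.integrable_const_bound[where B = 1], rule AE_I2, rule e1) simp
  have iw: "complex_integrable Q ?w"
    by (intro integrable_mult_right integrable_of_real int_1)
  have i1w: "complex_integrable Q (\<lambda>p. 1 + ?w p)"
    by (intro Bochner_Integration.integrable_add iw) simp
  have "(CLINT p|Q. 1 + ?w p) = (CLINT p|Q. 1) + (CLINT p|Q. ?w p)"
    by (rule Bochner_Integration.integral_add[OF _ iw]) simp
  also have "(CLINT p|Q. ?w p) = \<psi> * complex_of_real (\<bar>z\<bar> * (1 + a))"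
    by (simp only: Bochner_Integration.integral_mult_right_zero integral_complex_of_real moment_1)
  finally have mean: "(CLINT p|Q. 1 + ?w p) = 1 + \<psi> * complex_of_real (\<bar>z\<bar> * (1 + a))"
    using Q.prob_space by simp
  have "norm (T (\<lambda>x. exp (\<psi> * complex_of_real \<bar>x\<bar>)) z - (1 + \<psi> * complex_of_real (\<bar>z\<bar> * (1 + a)))) = norm (CLINT p|Q. ?e p - (1 + ?w p))"
    unfolding T_def mean[symmetric] by (subst Bochner_Integration.integral_diff[OF ie i1w]) (rule refl)
  also have "\<dots> \<le> (LINT p|Q. norm (?e p - (1 + ?w p)))" by (rule integral_norm_bound)
  also have "\<dots> \<le> (LINT p|Q. 8 * \<bar>z\<bar> powr d * (fst p powr d + snd p powr d))"
  proof (rule integral_mono_AE)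
    show "integrable Q (\<lambda>p. norm (?e p - (1 + ?w p)))"
      by (intro integrable_norm Bochner_Integration.integrable_diff ie i1w)
    show "integrable Q (\<lambda>p. 8 * \<bar>z\<bar> powr d * (fst p powr d + snd p powr d))"
      by (intro integrable_mult_right int_d)
    show "AE p in Q. norm (?e p - (1 + ?w p)) \<le> 8 * \<bar>z\<bar> powr d * (fst p powr d + snd p powr d)"
      using nonneg_Q
    proof eventually_elim
      case (elim p)
      have eq: "?e p = exp (?w p)"
        using elim by (simp add: abs_mult exp_add[symmetric] algebra_simps)
      have "?e p - (1 + ?w p) = exp (?w p) - 1 - ?w p" unfolding eq by simp
      also have "norm \<dots> \<le> 2 * norm (?w p) powr d"
        by (rule norm_exp_second_order) (use assms elim d_bounds in \<open>auto simp: mult_nonpos_nonneg\<close>)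
      finally have 1: "norm (?e p - (1 + ?w p)) \<le> 2 * norm (?w p) powr d" .
      have "norm (?w p) = norm \<psi> * (\<bar>z\<bar> * (fst p + snd p))"
        using elim by (simp only: norm_mult norm_of_real) (simp add: abs_mult)
      then have "norm (?w p) powr d = (norm \<psi> * (\<bar>z\<bar> * (fst p + snd p))) powr d" by (rule arg_cong)
      also have "\<dots> \<le> (\<bar>z\<bar> * (fst p + snd p)) powr d"
        using assms elim d_bounds by (intro powr_mono2 mult_left_le_one_le) auto
      also have "\<dots> = \<bar>z\<bar> powr d * (fst p + snd p) powr d" by (rule powr_mult)
      also have "\<dots> \<le> \<bar>z\<bar> powr d * (4 * (fst p powr d + snd p powr d))"
        using elim d_bounds by (intro mult_left_mono powr_add_le) auto
      finally show ?case using 1 by linarith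
    qed
  qed
  also have "\<dots> = 8 * (1 + Sd) * \<bar>z\<bar> powr d"
    by (simp add: Sd_def)
  finally show ?thesis .
qed

text \<open>Both transforms are compared with the common linear part
  \<open>1 + \<psi> * \<bar>x\<bar>\<close>. The term \<open>8 * \<rho>\<close> is the remainder of
  \<open>exp_add_expansion\<close> averaged over the uniform variable, the term 2 the remainder of
  the point mass itself.\<close>

lemma iter_first_step:
  assumes "Re \<psi> \<le> 0" "norm \<psi> \<le> 1"
  shows "norm (laplace (iter (Suc 0)) \<psi> x - laplace (iter 0) \<psi> x) \<le> (8 * \<rho> + 2) * \<bar>x\<bar> powr d"
proof -
  interpret \<zeta>: real_distribution "iter 0" by (rule iter_real_distribution)
  let ?g = "\<lambda>x. exp (\<psi> * complex_of_real \<bar>x\<bar>)"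
  have g: "laplace (iter 0) \<psi> = ?g" by (rule ext) (rule laplace_iter_0)
  have [measurable]: "T ?g \<in> borel_measurable borel"
    using measurable_T[OF \<zeta>.measurable_laplace[OF assms(1)]] unfolding g .
  have T1: "norm (T ?g z) \<le> 1" for z
    by (rule norm_T_le) (auto intro!: norm_exp_le_one[OF assms(1)] simp del: norm_exp_eq_Re)
  let ?l = "\<lambda>\<theta>. 1 + (\<psi> * complex_of_real (\<bar>x\<bar> * (1 + a))) * complex_of_real (\<theta> powr a)"
  have iT: "complex_integrable U (\<lambda>\<theta>. T ?g (\<theta> powr a * x))"
    by (intro U.integrable_const_bound[where B = 1] AE_I2 T1) measurable
  have il0: "complex_integrable U (\<lambda>\<theta>. (\<psi> * complex_of_real (\<bar>x\<bar> * (1 + a))) * complex_of_real (\<theta> powr a))"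
    by (intro integrable_mult_right integrable_of_real integrable_powr_U a_gt)
  have il: "complex_integrable U ?l"
    by (intro Bochner_Integration.integrable_add il0) simp
  have "(CLINT \<theta>|U. ?l \<theta>) = (CLINT \<theta>|U. 1) + (CLINT \<theta>|U. (\<psi> * complex_of_real (\<bar>x\<bar> * (1 + a))) * complex_of_real (\<theta> powr a))"
    by (rule Bochner_Integration.integral_add[OF _ il0]) simp
  also have "\<dots> = 1 + (\<psi> * complex_of_real (\<bar>x\<bar> * (1 + a))) * complex_of_real (1 / (a + 1))"
    using U.prob_space by (simp only: Bochner_Integration.integral_mult_right_zero integral_complex_of_real integral_powr_U[OF a_gt]) simp
  also have "\<dots> = 1 + \<psi> * complex_of_real (\<bar>x\<bar> * (1 + a) * (1 / (a + 1)))"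
    by (simp only: of_real_mult mult.assoc)
  \<comment> \<open>The mean \<open>1 / (a + 1)\<close> of \<open>\<theta> powr a\<close> cancels
    the mean \<open>1 + a\<close> of \<open>L + R\<close>, so the linear part is reproduced.\<close>
  also have "\<bar>x\<bar> * (1 + a) * (1 / (a + 1)) = \<bar>x\<bar>" using a_gt by (simp add: field_simps)
  finally have mean: "(CLINT \<theta>|U. ?l \<theta>) = 1 + \<psi> * complex_of_real \<bar>x\<bar>" .
  have "laplace (iter (Suc 0)) \<psi> x = (CLINT \<theta>|U. T ?g (\<theta> powr a * x))"
    unfolding iter.simps(2) laplace_fp_rhs[OF iter_real_distribution iter_nonneg assms(1)] g ..
  then have "norm (laplace (iter (Suc 0)) \<psi> x - (1 + \<psi> * complex_of_real \<bar>x\<bar>)) = norm (CLINT \<theta>|U. T ?g (\<theta> powr a * x) - ?l \<theta>)"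
    unfolding mean[symmetric] by (subst Bochner_Integration.integral_diff[OF iT il]) simp
  also have "\<dots> \<le> (LINT \<theta>|U. norm (T ?g (\<theta> powr a * x) - ?l \<theta>))" by (rule integral_norm_bound)
  also have "\<dots> \<le> (LINT \<theta>|U. 8 * (1 + Sd) * \<bar>x\<bar> powr d * \<theta> powr (a * d))"
  proof (rule integral_mono_AE)
    show "integrable U (\<lambda>\<theta>. norm (T ?g (\<theta> powr a * x) - ?l \<theta>))"
      by (intro integrable_norm Bochner_Integration.integrable_diff iT il)
    show "integrable U (\<lambda>\<theta>. 8 * (1 + Sd) * \<bar>x\<bar> powr d * \<theta> powr (a * d))"
      by (intro integrable_mult_right integrable_powr_U ad_gt)
    show "AE \<theta> in U. norm (T ?g (\<theta> powr a * x) - ?l \<theta>) \<le> 8 * (1 + Sd) * \<bar>x\<bar> powr d * \<theta> powr (a * d)"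
    proof (rule AE_I2)
      fix \<theta>
      have "\<psi> * complex_of_real (\<bar>\<theta> powr a * x\<bar> * (1 + a)) = (\<psi> * complex_of_real (\<bar>x\<bar> * (1 + a))) * complex_of_real (\<theta> powr a)"
        by (simp add: abs_mult)
      then have "norm (T ?g (\<theta> powr a * x) - ?l \<theta>) \<le> 8 * (1 + Sd) * \<bar>\<theta> powr a * x\<bar> powr d"
        using exp_add_expansion[OF assms, of "\<theta> powr a * x"] by (simp only:)
      then show "norm (T ?g (\<theta> powr a * x) - ?l \<theta>) \<le> 8 * (1 + Sd) * \<bar>x\<bar> powr d * \<theta> powr (a * d)"
        by (simp add: abs_mult powr_mult powr_powr mult_ac)
    qed
  qed
  also have "\<dots> = 8 * \<rho> * \<bar>x\<bar> powr d"
    using ad_gt by (simp add: integral_powr_U \<rho>_def)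
  finally have 1: "norm (laplace (iter (Suc 0)) \<psi> x - (1 + \<psi> * complex_of_real \<bar>x\<bar>)) \<le> 8 * \<rho> * \<bar>x\<bar> powr d" .
  have "norm (exp (\<psi> * complex_of_real \<bar>x\<bar>) - 1 - \<psi> * complex_of_real \<bar>x\<bar>) \<le> 2 * norm (\<psi> * complex_of_real \<bar>x\<bar>) powr d"
    by (rule norm_exp_second_order) (use assms d_bounds in \<open>auto simp: mult_nonpos_nonneg\<close>)
  moreover have "norm (\<psi> * complex_of_real \<bar>x\<bar>) powr d \<le> \<bar>x\<bar> powr d"
    using assms d_bounds by (intro powr_mono2) (auto simp: norm_mult mult_left_le_one_le)
  ultimately have 2: "norm (exp (\<psi> * complex_of_real \<bar>x\<bar>) - 1 - \<psi> * complex_of_real \<bar>x\<bar>) \<le> 2 * \<bar>x\<bar> powr d" by linarith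
  have "laplace (iter (Suc 0)) \<psi> x - laplace (iter 0) \<psi> x =
     (laplace (iter (Suc 0)) \<psi> x - (1 + \<psi> * complex_of_real \<bar>x\<bar>)) - (exp (\<psi> * complex_of_real \<bar>x\<bar>) - 1 - \<psi> * complex_of_real \<bar>x\<bar>)"
    unfolding laplace_iter_0 by simp
  also have "norm \<dots> \<le> 8 * \<rho> * \<bar>x\<bar> powr d + 2 * \<bar>x\<bar> powr d"
    by (intro order_trans[OF norm_triangle_ineq4] add_mono 1 2)
  finally show ?thesis by (simp add: algebra_simps)
qed

lemma iter_step:
  assumes "Re \<psi> \<le> 0" "norm \<psi> \<le> 1"
  shows "norm (laplace (iter (Suc n)) \<psi> x - laplace (iter n) \<psi> x) \<le> (8 * \<rho> + 2) * \<rho> ^ n * \<bar>x\<bar> powr d"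
proof (induction n arbitrary: x)
  case 0
  then show ?case using iter_first_step[OF assms] by simp
next
  case (Suc n)
  have "norm (laplace (fp_rhs Q a (iter (Suc n))) \<psi> x - laplace (fp_rhs Q a (iter n)) \<psi> x)
      \<le> (8 * \<rho> + 2) * \<rho> ^ n * \<rho> * \<bar>x\<bar> powr d"
    by (rule laplace_fp_lipschitz[OF iter_real_distribution iter_nonneg iter_real_distribution iter_nonneg assms(1) Suc])
  then show ?case by (simp add: mult_ac)
qed

text \<open>Summing the geometric bound gives more than convergence: the limit agrees with the
  transform of the point mass at 1 up to order \<open>\<bar>x\<bar> powr d\<close>, from which
  continuity at 0 and the mean of the limit law are obtained.\<close>

lemma iter_limit:
  assumes "Re \<psi> \<le> 0" "norm \<psi> \<le> 1"
  obtains l where "(\<lambda>n. laplace (iter n) \<psi> x) \<longlonglongrightarrow> l"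
    "norm (l - exp (\<psi> * complex_of_real \<bar>x\<bar>)) \<le> (8 * \<rho> + 2) / (1 - \<rho>) * \<bar>x\<bar> powr d"
proof -
  let ?c = "(8 * \<rho> + 2) * \<bar>x\<bar> powr d"
  have le: "norm (laplace (iter (Suc n)) \<psi> x - laplace (iter n) \<psi> x) \<le> ?c * \<rho> ^ n" for n
    using iter_step[OF assms, of n x] by (simp add: mult_ac)
  have sg: "(\<lambda>n. ?c * \<rho> ^ n) sums (?c * (1 / (1 - \<rho>)))"
    by (intro sums_mult geometric_sums) (use rho in simp)
  have sm: "summable (\<lambda>n. norm (laplace (iter (Suc n)) \<psi> x - laplace (iter n) \<psi> x))"
    by (rule summable_comparison_test'[OF sums_summable[OF sg], of 0]) (use le in simp)
  let ?s = "\<Sum>n. laplace (iter (Suc n)) \<psi> x - laplace (iter n) \<psi> x"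
  have "(\<lambda>n. \<Sum>i<n. laplace (iter (Suc i)) \<psi> x - laplace (iter i) \<psi> x) \<longlonglongrightarrow> ?s"
    using summable_LIMSEQ[OF summable_norm_cancel[OF sm]] .
  then have "(\<lambda>n. laplace (iter n) \<psi> x - laplace (iter 0) \<psi> x) \<longlonglongrightarrow> ?s"
    unfolding sum_lessThan_telescope[of "\<lambda>i. laplace (iter i) \<psi> x"] .
  then have "(\<lambda>n. (laplace (iter n) \<psi> x - laplace (iter 0) \<psi> x) + laplace (iter 0) \<psi> x) \<longlonglongrightarrow> ?s + laplace (iter 0) \<psi> x"
    by (intro tendsto_add tendsto_const)
  then have lim: "(\<lambda>n. laplace (iter n) \<psi> x) \<longlonglongrightarrow> ?s + laplace (iter 0) \<psi> x" by simp
  have "norm ?s \<le> (\<Sum>n. norm (laplace (iter (Suc n)) \<psi> x - laplace (iter n) \<psi> x))"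
    by (rule summable_norm[OF sm])
  also have "\<dots> \<le> (\<Sum>n. ?c * \<rho> ^ n)"
    by (rule suminf_le[OF le sm sums_summable[OF sg]])
  also have "\<dots> = ?c * (1 / (1 - \<rho>))" using sg by (rule sums_unique[symmetric])
  finally have "norm (?s + laplace (iter 0) \<psi> x - exp (\<psi> * complex_of_real \<bar>x\<bar>)) \<le> (8 * \<rho> + 2) / (1 - \<rho>) * \<bar>x\<bar> powr d"
    unfolding laplace_iter_0 by (simp add: mult_ac)
  with lim show thesis by (rule that)
qed

text \<open>The limit of the characteristic functions is within a multiple of
  \<open>\<bar>u\<bar> powr d\<close> of \<open>iexp u\<close>. This makes it continuous at 0, so it
  belongs to a law, and since \<open>d > 1\<close> it fixes the slope at 0, so the mean is 1. The
  fixed point equation passes to the limit on the side of the transforms.\<close>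

theorem Zlaw_exists: "\<exists>\<zeta>. Zlaw \<zeta>"
proof -
  let ?C = "(8 * \<rho> + 2) / (1 - \<rho>)"
  have sg: "Re (\<i> * complex_of_real (sgn u)) \<le> 0" "norm (\<i> * complex_of_real (sgn u)) \<le> 1" for u
    by (auto simp: norm_mult sgn_if)
  have "\<exists>l. (\<lambda>n. laplace (iter n) (\<i> * complex_of_real (sgn u)) u) \<longlonglongrightarrow> l \<and>
      norm (l - exp (\<i> * complex_of_real (sgn u) * complex_of_real \<bar>u\<bar>)) \<le> ?C * \<bar>u\<bar> powr d" for u
    using iter_limit[OF sg[of u], of u] by metis
  then obtain F where F: "\<And>u. (\<lambda>n. laplace (iter n) (\<i> * complex_of_real (sgn u)) u) \<longlonglongrightarrow> F u"
      "\<And>u. norm (F u - exp (\<i> * complex_of_real (sgn u) * complex_of_real \<bar>u\<bar>)) \<le> ?C * \<bar>u\<bar> powr d"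
    by metis
  have char_iter: "char (iter n) u = laplace (iter n) (\<i> * complex_of_real (sgn u)) u" for n u
    by (rule real_distribution.laplace_char[OF iter_real_distribution iter_nonneg])
  have F2: "norm (F u - iexp u) \<le> ?C * \<bar>u\<bar> powr d" for u
  proof -
    have "complex_of_real (sgn u) * complex_of_real \<bar>u\<bar> = complex_of_real u"
      by (simp add: sgn_mult_abs flip: of_real_mult)
    then show ?thesis using F(2)[of u] by (simp only: mult.assoc)
  qed
  have F0: "F 0 = 1" using F2[of 0] by simp
  have "((\<lambda>u. F u - iexp u) \<longlongrightarrow> 0) (at 0)"
  proof (rule Lim_null_comparison)
    show "eventually (\<lambda>u. norm (F u - iexp u) \<le> ?C * \<bar>u\<bar> powr d) (at 0)" by (simp only: F2) simp
    have "((\<lambda>u. ?C * \<bar>u\<bar> powr d) \<longlongrightarrow> ?C * 0) (at 0)"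
      by (intro tendsto_mult tendsto_const tendsto_zero_powrI[where b = d] tendsto_rabs_zero tendsto_ident_at)
         (use d_bounds in auto)
    then show "((\<lambda>u. ?C * \<bar>u\<bar> powr d) \<longlongrightarrow> 0) (at 0)" by simp
  qed
  moreover have "((\<lambda>u. iexp u) \<longlongrightarrow> iexp 0) (at 0)"
    using isCont_iexp[of 0] by (simp only: isCont_def)
  ultimately have "((\<lambda>u. (F u - iexp u) + iexp u) \<longlongrightarrow> 0 + iexp 0) (at 0)" by (rule tendsto_add)
  then have "isCont F 0" by (simp add: isCont_def F0)
  then obtain \<zeta> where \<zeta>: "real_distribution \<zeta>" "char \<zeta> = F" "weak_conv_m iter \<zeta>"
    using levy_continuity_exists[of iter F] iter_real_distribution F(1) by (simp only: char_iter) blast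
  interpret \<zeta>: real_distribution \<zeta> by fact
  have lim: "(\<lambda>n. laplace (iter n) \<psi> x) \<longlonglongrightarrow> laplace \<zeta> \<psi> x" if "Re \<psi> \<le> 0" for \<psi> x
    by (rule \<zeta>.laplace_weak_limit[OF iter_real_distribution \<zeta>(3) that])
  \<comment> \<open>A Skorohod coupling makes the convergence pointwise, so that nonnegativity is
    inherited and Fatou bounds the mean of the limit by 1.\<close>
  obtain \<Omega> :: "real measure" and Yn Y where Y: "prob_space \<Omega>" "\<And>n. Yn n \<in> measurable \<Omega> borel"
      "\<And>n. distr \<Omega> borel (Yn n) = iter n" "Y \<in> measurable \<Omega> lborel" "distr \<Omega> borel Y = \<zeta>"
      "\<And>x. x \<in> space \<Omega> \<Longrightarrow> (\<lambda>n. Yn n x) \<longlonglongrightarrow> Y x"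
    using Skorohod[OF iter_real_distribution \<zeta>(1) \<zeta>(3)] by blast
  have Y_meas [measurable]: "Y \<in> borel_measurable \<Omega>" "\<And>n. Yn n \<in> borel_measurable \<Omega>" using Y(2,4) by simp_all
  have "AE x in \<Omega>. \<forall>n. 0 \<le> Yn n x"
    unfolding AE_all_countable
  proof
    fix n show "AE x in \<Omega>. 0 \<le> Yn n x"
      using iter_nonneg[of n] unfolding Y(3)[of n, symmetric] by (subst (asm) AE_distr_iff) auto
  qed
  then have Y0: "AE x in \<Omega>. 0 \<le> Y x"
    using AE_space
  proof eventually_elim
    case (elim x)
    show ?case by (rule LIMSEQ_le_const[OF Y(6)[OF elim(2)]]) (use elim(1) in auto)
  qed
  have nonneg: "AE z in \<zeta>. 0 \<le> z"
    unfolding Y(5)[symmetric] by (subst AE_distr_iff) (use Y0 in auto)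
  have "(\<integral>\<^sup>+x. ennreal (Y x) \<partial>\<Omega>) = (\<integral>\<^sup>+x. liminf (\<lambda>n. ennreal (Yn n x)) \<partial>\<Omega>)"
  proof (rule nn_integral_cong)
    fix x assume "x \<in> space \<Omega>"
    then have "(\<lambda>n. ennreal (Yn n x)) \<longlonglongrightarrow> ennreal (Y x)" by (intro tendsto_ennrealI Y(6))
    then show "ennreal (Y x) = liminf (\<lambda>n. ennreal (Yn n x))"
      by (simp add: lim_imp_Liminf)
  qed
  also have "\<dots> \<le> liminf (\<lambda>n. \<integral>\<^sup>+x. ennreal (Yn n x) \<partial>\<Omega>)"
    by (rule nn_integral_liminf) measurable
  also have "\<dots> \<le> liminf (\<lambda>n::nat. 1)"
  proof (rule Liminf_mono, rule always_eventually, rule allI)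
    fix n
    have "(\<integral>\<^sup>+x. ennreal (Yn n x) \<partial>\<Omega>) = (\<integral>\<^sup>+z. ennreal z \<partial>distr \<Omega> borel (Yn n))"
      by (rule nn_integral_distr[symmetric]) auto
    then show "(\<integral>\<^sup>+x. ennreal (Yn n x) \<partial>\<Omega>) \<le> 1" using iter_mean[of n] by (simp add: Y(3))
  qed
  also have "\<dots> = 1" by (simp add: Liminf_const)
  finally have "(\<integral>\<^sup>+x. ennreal (Y x) \<partial>\<Omega>) \<le> 1" .
  moreover have "(\<integral>\<^sup>+x. ennreal (Y x) \<partial>\<Omega>) = (\<integral>\<^sup>+z. ennreal z \<partial>\<zeta>)"
    unfolding Y(5)[symmetric] by (rule nn_integral_distr[symmetric]) auto
  ultimately have nn: "(\<integral>\<^sup>+z. ennreal z \<partial>\<zeta>) \<le> 1" by simp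
  have int: "integrable \<zeta> (\<lambda>z. z)"
  proof (rule integrableI_nonneg)
    show "(\<integral>\<^sup>+z. ennreal z \<partial>\<zeta>) < \<infinity>" using nn by (rule le_less_trans) simp
  qed (use nonneg in auto)
  \<comment> \<open>The slope of the transform at 0 is computed twice: as \<open>\<i>\<close> times
    the mean, and as \<open>\<i>\<close> from the bound of order \<open>d\<close>. Fatou alone would
    allow the mean to drop in the limit.\<close>
  have "((\<lambda>x. (laplace \<zeta> \<i> x - 1) / x) \<longlongrightarrow> \<i> * (LINT z|\<zeta>. z)) (at_right 0)"
    by (rule \<zeta>.laplace_expansion) (use int nonneg in auto)
  moreover have "((\<lambda>x. (laplace \<zeta> \<i> x - 1) / x) \<longlongrightarrow> \<i>) (at_right 0)"
  proof -
    have bd: "norm (laplace \<zeta> \<i> x - iexp x) \<le> ?C * x powr d" if "x > 0" for x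
    proof -
      have "laplace \<zeta> \<i> x = char \<zeta> x"
        using \<zeta>.laplace_char[OF nonneg, of x] that by simp
      then show ?thesis using F2[of x] that by (simp add: \<zeta>(2))
    qed
    have "((\<lambda>x. (laplace \<zeta> \<i> x - iexp x) / x) \<longlongrightarrow> 0) (at_right 0)"
    proof (rule Lim_null_comparison)
      show "eventually (\<lambda>x. norm ((laplace \<zeta> \<i> x - iexp x) / x) \<le> ?C * x powr (d - 1)) (at_right 0)"
        using eventually_at_right_less[of 0]
      proof eventually_elim
        case (elim x)
        have "x powr d = x * x powr (d - 1)" using elim by (simp add: powr_mult_base)
        then show ?case using bd[OF elim] elim by (simp add: norm_divide divide_le_eq mult_ac)
      qed
      have "((\<lambda>x. ?C * x powr (d - 1)) \<longlongrightarrow> ?C * 0) (at_right 0)"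
        by (intro tendsto_mult tendsto_const tendsto_zero_powrI[where b = "d - 1"] tendsto_ident_at)
           (use d_bounds in \<open>auto simp: eventually_at_filter\<close>)
      then show "((\<lambda>x. ?C * x powr (d - 1)) \<longlongrightarrow> 0) (at_right 0)" by simp
    qed
    moreover have "((\<lambda>x. (iexp x - 1) / x) \<longlongrightarrow> \<i>) (at_right 0)"
    proof -
      have "((\<lambda>z. exp (\<i> * z)) has_field_derivative \<i>) (at 0)"
        by (auto intro!: derivative_eq_intros)
      then have "((\<lambda>z::complex. (exp (\<i> * z) - 1) / z) \<longlongrightarrow> \<i>) (at 0)"
        by (simp add: has_field_derivative_iff)
      moreover have "filterlim complex_of_real (at 0) (at_right 0)"
        by (auto simp: filterlim_at eventually_at_filter intro!: tendsto_eq_intros)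
      ultimately show ?thesis by (rule filterlim_compose)
    qed
    ultimately have "((\<lambda>x. (laplace \<zeta> \<i> x - iexp x) / x + (iexp x - 1) / x) \<longlongrightarrow> 0 + \<i>) (at_right 0)"
      by (rule tendsto_add)
    then show ?thesis by (simp add: add_divide_distrib[symmetric])
  qed
  ultimately have "\<i> * complex_of_real (LINT z|\<zeta>. z) = \<i>"
    by (rule tendsto_unique[rotated]) simp
  then have mean: "(LINT z|\<zeta>. z) = 1" by simp
  have fix_laplace: "laplace (fp_rhs Q a \<zeta>) \<psi> x = laplace \<zeta> \<psi> x" if \<psi>: "Re \<psi> \<le> 0" for \<psi> x
  proof -
    note [measurable] = \<zeta>.measurable_laplace[OF \<psi>] real_distribution.measurable_laplace[OF iter_real_distribution \<psi>]
    have le: "norm (laplace (iter n) \<psi> x * laplace (iter n) \<psi> y) \<le> 1" for n x y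
      using mult_mono[OF real_distribution.norm_laplace_le_one[OF iter_real_distribution \<psi>] real_distribution.norm_laplace_le_one[OF iter_real_distribution \<psi>]]
      by (simp add: norm_mult)
    interpret P1: pair_prob_space U Q ..
    have "(\<lambda>n. laplace (fp_rhs Q a (iter n)) \<psi> x) \<longlonglongrightarrow> laplace (fp_rhs Q a \<zeta>) \<psi> x"
      unfolding laplace_fp_rhs_pair[OF \<zeta>(1) nonneg \<psi>] laplace_fp_rhs_pair[OF iter_real_distribution iter_nonneg \<psi>]
      by (rule integral_dominated_convergence[where w = "\<lambda>_. 1"])
         (auto intro!: AE_I2 tendsto_mult lim \<psi> le)
    moreover have "(\<lambda>n. laplace (iter (Suc n)) \<psi> x) \<longlonglongrightarrow> laplace \<zeta> \<psi> x"
      by (rule LIMSEQ_Suc[OF lim[OF \<psi>]])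
    ultimately show ?thesis
      using LIMSEQ_unique by (simp only: iter.simps) blast
  qed
  have "char (fp_rhs Q a \<zeta>) u = char \<zeta> u" for u
    unfolding \<zeta>.laplace_char[OF nonneg] real_distribution.laplace_char[OF real_distribution_fp_rhs[OF \<zeta>(1)] AE_fp_rhs_nonneg[OF \<zeta>(1) nonneg]]
    by (rule fix_laplace[OF sg(1)])
  then have "fp_rhs Q a \<zeta> = \<zeta>"
    by (intro Levy_uniqueness[OF real_distribution_fp_rhs[OF \<zeta>(1)] \<zeta>(1)] ext)
  then have "Zlaw \<zeta>" using \<zeta>(1) nonneg int mean by (simp add: Zlaw_def)
  then show ?thesis ..
qed

end

section \<open>The forward equation and convergence\<close>

lemma vector_derivative_bound:
  fixes f :: "real \<Rightarrow> 'b::real_normed_vector"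
  assumes "convex S" "\<And>x. x \<in> S \<Longrightarrow> (f has_vector_derivative f' x) (at x within S)"
    and "\<And>x. x \<in> S \<Longrightarrow> norm (f' x) \<le> B" "0 \<le> B" "x \<in> S" "y \<in> S"
  shows "norm (f x - f y) \<le> B * \<bar>x - y\<bar>"
proof -
  have "norm (f x - f y) \<le> B * norm (x - y)"
  proof (rule differentiable_bound[OF assms(1) _ _ assms(5,6)])
    fix x assume x: "x \<in> S"
    show "(f has_derivative (\<lambda>h. h *\<^sub>R f' x)) (at x within S)"
      using assms(2)[OF x] by (simp add: has_vector_derivative_def)
    show "onorm (\<lambda>h. h *\<^sub>R f' x) \<le> B"
      using assms(3)[OF x] assms(4) by (intro onorm_bound) (auto simp: mult.commute[of B] intro: mult_left_mono)
  qed
  then show ?thesis by simp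
qed

lemma has_vector_derivative_iff_quotient:
  fixes f :: "real \<Rightarrow> 'b::real_normed_vector"
  shows "(f has_vector_derivative D) (at x) \<longleftrightarrow> ((\<lambda>y. (1 / (y - x)) *\<^sub>R (f y - f x)) \<longlongrightarrow> D) (at x)"
proof -
  have "norm ((1 / (y - x)) *\<^sub>R (f y - f x) - D) = norm ((f y - f x) - (y - x) *\<^sub>R D) / norm (y - x)" if "y \<noteq> x" for y
  proof -
    have "(1 / (y - x)) *\<^sub>R (f y - f x) - D = (1 / (y - x)) *\<^sub>R ((f y - f x) - (y - x) *\<^sub>R D)"
      using that by (simp add: scaleR_diff_right)
    then show ?thesis by simp
  qed
  then have "((\<lambda>y. norm ((f y - f x) - (y - x) *\<^sub>R D) / norm (y - x)) \<longlongrightarrow> 0) (at x) \<longleftrightarrow>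
     ((\<lambda>y. norm ((1 / (y - x)) *\<^sub>R (f y - f x) - D)) \<longlongrightarrow> 0) (at x)"
    by (intro filterlim_cong refl) (auto simp: eventually_at_filter)
  then show ?thesis
    unfolding has_vector_derivative_def has_derivative_iff_norm
    by (simp add: tendsto_norm_zero_iff LIM_zero_iff bounded_linear_scaleR_left)
qed

text \<open>The mean value inequality bounds every difference quotient by \<open>K\<close>. The left
  end \<open>c < y\<close> allows a neighbourhood of 0 to be avoided, where derivatives of the flow
  grow like \<open>1 / y\<close>.\<close>

lemma (in prob_space) has_vector_derivative_expectation:
  fixes f f' :: "real \<Rightarrow> 'a \<Rightarrow> complex"
  assumes c: "c < y"
    and deriv: "\<And>x \<omega>. c < x \<Longrightarrow> ((\<lambda>x. f x \<omega>) has_vector_derivative f' x \<omega>) (at x)"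
    and bound: "\<And>x \<omega>. c < x \<Longrightarrow> norm (f' x \<omega>) \<le> K" "0 \<le> K"
    and int: "\<And>x. c < x \<Longrightarrow> integrable M (f x)"
    and meas: "f' y \<in> borel_measurable M"
  shows "((\<lambda>x. \<integral>\<omega>. f x \<omega> \<partial>M) has_vector_derivative (\<integral>\<omega>. f' y \<omega> \<partial>M)) (at y)"
proof -
  have "((\<lambda>x. \<integral>\<omega>. (1 / (x - y)) *\<^sub>R (f x \<omega> - f y \<omega>) \<partial>M) \<longlongrightarrow> (\<integral>\<omega>. f' y \<omega> \<partial>M)) (at y within {c<..})"
  proof (rule integral_dominated_convergence_within[where w = "\<lambda>_. K"])
    show "AE \<omega> in M. ((\<lambda>x. (1 / (x - y)) *\<^sub>R (f x \<omega> - f y \<omega>)) \<longlongrightarrow> f' y \<omega>) (at y within {c<..})"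
      by (rule AE_I2, rule tendsto_within_subset[OF _ subset_UNIV], rule deriv[OF c, unfolded has_vector_derivative_iff_quotient])
    show "(\<lambda>\<omega>. (1 / (x - y)) *\<^sub>R (f x \<omega> - f y \<omega>)) \<in> borel_measurable M" if "x \<in> {c<..} - {y}" for x
      using int[of x] int[of y] that c by (auto dest!: borel_measurable_integrable)
    show "AE \<omega> in M. norm ((1 / (x - y)) *\<^sub>R (f x \<omega> - f y \<omega>)) \<le> K" if x: "x \<in> {c<..} - {y}" for x
    proof (rule AE_I2)
      fix \<omega>
      have "norm (f x \<omega> - f y \<omega>) \<le> K * \<bar>x - y\<bar>"
        by (rule vector_derivative_bound[where S = "{c<..}" and f' = "\<lambda>x. f' x \<omega>"])
           (use x c bound deriv in \<open>auto intro: has_vector_derivative_at_within\<close>)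
      then show "norm ((1 / (x - y)) *\<^sub>R (f x \<omega> - f y \<omega>)) \<le> K"
        using x by (simp add: divide_le_eq)
    qed
  qed (use meas in auto)
  then have "((\<lambda>x. \<integral>\<omega>. (1 / (x - y)) *\<^sub>R (f x \<omega> - f y \<omega>) \<partial>M) \<longlongrightarrow> (\<integral>\<omega>. f' y \<omega> \<partial>M)) (at y)"
    using c by (simp add: at_within_open[of y "{c<..}"])
  moreover have "eventually (\<lambda>x. (\<integral>\<omega>. (1 / (x - y)) *\<^sub>R (f x \<omega> - f y \<omega>) \<partial>M) =
      (1 / (x - y)) *\<^sub>R ((\<integral>\<omega>. f x \<omega> \<partial>M) - (\<integral>\<omega>. f y \<omega> \<partial>M))) (at y)"
  proof -
    have "eventually (\<lambda>x. x \<in> {c<..}) (at y)"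
      using c by (intro eventually_at_in_open') auto
    then show ?thesis
    proof eventually_elim
      case (elim x)
      then show ?case using int[of x] int[OF c] by simp
    qed
  qed
  ultimately show ?thesis
    unfolding has_vector_derivative_iff_quotient by (rule Lim_transform_eventually)
qed

lemma pochhammer_nonneg_real: "0 \<le> (x::real) \<Longrightarrow> 0 \<le> pochhammer x n"
  by (induction n) (auto simp: pochhammer_Suc)

lemma laplace_scale: "0 \<le> c \<Longrightarrow> laplace \<zeta> (\<psi> * complex_of_real c) x = laplace \<zeta> \<psi> (c * x)"
  unfolding laplace_def by (simp add: abs_mult mult_ac)

text \<open>The terms \<open>pochhammer (1 + S) m / fact m\<close> are the coefficients of the
  binomial series of \<open>(1 - q) powr (- (1 + S))\<close>; at \<open>q = 1 - exp (- t)\<close>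
  its sum is \<open>exp ((1 + S) * t)\<close>, and the prefactor \<open>exp (- t)\<close> removes
  the 1.\<close>

lemma sums_yule_moment:
  fixes S t :: real
  assumes "0 \<le> t"
  shows "(\<lambda>m. exp (- t) * (1 - exp (- t)) ^ m * (pochhammer (1 + S) m / fact m)) sums exp (S * t)"
proof -
  let ?z = "- (1 - exp (- t))"
  have "\<bar>?z\<bar> < 1" using assms by simp
  from gen_binomial_real[OF this, of "- (1 + S)"]
  have "(\<lambda>m. exp (- t) * ((- (1 + S) gchoose m) * ?z ^ m)) sums (exp (- t) * (1 + ?z) powr (- (1 + S)))"
    by (rule sums_mult)
  moreover have "exp (- t) * ((- (1 + S) gchoose m) * ?z ^ m) = exp (- t) * (1 - exp (- t)) ^ m * (pochhammer (1 + S) m / fact m)" for m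
  proof -
    have "(- 1) ^ m * ?z ^ m = (1 - exp (- t)) ^ m" by (simp flip: power_mult_distrib)
    have "exp (- t) * ((- 1) ^ m * pochhammer (- (- (1 + S))) m / fact m * ?z ^ m) =
        exp (- t) * ((- 1) ^ m * ?z ^ m) * (pochhammer (1 + S) m / fact m)"
      by (simp only: minus_minus times_divide_eq_left times_divide_eq_right mult_ac)
    then show ?thesis unfolding gbinomial_pochhammer by (simp only: \<open>(- 1) ^ m * ?z ^ m = (1 - exp (- t)) ^ m\<close>)
  qed
  moreover have "exp (- t) * (1 + ?z) powr (- (1 + S)) = exp (S * t)"
  proof -
    have z: "1 + ?z = exp (- t)" by simp
    show ?thesis unfolding z exp_powr_real exp_add[symmetric] by (simp add: algebra_simps)
  qed
  ultimately show ?thesis by simp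
qed

text \<open>The index is shifted: \<open>m\<close> counts completed splittings, so this is the
  probability that the Yule process is at \<open>m + 1\<close>.\<close>

definition yule_pmf :: "real \<Rightarrow> nat \<Rightarrow> real" where
  "yule_pmf t m = exp (- t) * (1 - exp (- t)) ^ m"

lemma yule_pmf_nonneg: "0 \<le> t \<Longrightarrow> 0 \<le> yule_pmf t m"
  by (simp add: yule_pmf_def)

lemma yule_pmf_sums:
  assumes "0 \<le> t"
  shows "yule_pmf t sums 1"
proof -
  have "(\<lambda>m. exp (- t) * (1 - exp (- t)) ^ m) sums (exp (- t) * (1 / (1 - (1 - exp (- t)))))"
    using assms by (intro sums_mult geometric_sums) simp
  moreover have "yule_pmf t = (\<lambda>m. exp (- t) * (1 - exp (- t)) ^ m)" by (simp add: yule_pmf_def fun_eq_iff)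
  ultimately show ?thesis by simp
qed

text \<open>\<open>b m j\<close> with \<open>j \<le> m\<close> plays the weight number
  \<open>j + 1\<close> among \<open>m + 1\<close>. The dynamics enter the analysis through two mean
  identities for one splitting, one for products of a bounded function and one for power sums; the
  lists and the independence behind them are dealt with separately.\<close>

locale kac_chain = smoothing Q a d + prob_space M for Q a d and M :: "'a measure" +
  fixes b :: "nat \<Rightarrow> nat \<Rightarrow> 'a \<Rightarrow> real"
  assumes b_meas: "\<And>m j. j \<le> m \<Longrightarrow> b m j \<in> borel_measurable M"
    and b_nonneg: "\<And>m j. j \<le> m \<Longrightarrow> AE \<omega> in M. 0 \<le> b m j \<omega>"
    and b_0: "\<And>\<omega>. b 0 0 \<omega> = 1"
    and forward: "\<And>g m. g \<in> borel_measurable borel \<Longrightarrow> (\<And>x. norm (g x) \<le> 1) \<Longrightarrow>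
      (CLINT \<omega>|M. \<Prod>j\<le>Suc m. g (b (Suc m) j \<omega>)) =
      (1 / real (Suc m)) *\<^sub>R (CLINT \<omega>|M. \<Sum>i\<le>m. T g (b m i \<omega>) * (\<Prod>j\<in>{..m} - {i}. g (b m j \<omega>)))"
    and forward_moment: "\<And>s S m. (s = 1 \<and> S = a) \<or> (s = d \<and> S = Sd) \<Longrightarrow>
      (\<integral>\<^sup>+\<omega>. (\<Sum>j\<le>Suc m. ennreal (b (Suc m) j \<omega> powr s)) \<partial>M) =
      ennreal (1 + S / real (Suc m)) * (\<integral>\<^sup>+\<omega>. (\<Sum>j\<le>m. ennreal (b m j \<omega> powr s)) \<partial>M)"
begin

definition prod_mean :: "nat \<Rightarrow> (real \<Rightarrow> complex) \<Rightarrow> complex" where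
  "prod_mean m g = (CLINT \<omega>|M. \<Prod>j\<le>m. g (b m j \<omega>))"

text \<open>For g the characteristic function of the initial data this is the Wild sum of V at time t.\<close>

definition Phi :: "real \<Rightarrow> (real \<Rightarrow> complex) \<Rightarrow> complex" where
  "Phi t g = (\<Sum>m. yule_pmf t m *\<^sub>R prod_mean m g)"

lemma norm_prod_le_one: "(\<And>x. norm (g x :: complex) \<le> 1) \<Longrightarrow> norm (\<Prod>j\<in>I. g (f j)) \<le> 1"
  unfolding prod_norm[symmetric] by (intro prod_le_1) auto

lemma measurable_prod_b:
  assumes [measurable]: "g \<in> borel_measurable borel" and "I \<subseteq> {..m}"
  shows "(\<lambda>\<omega>. \<Prod>j\<in>I. g (b m j \<omega>) :: complex) \<in> borel_measurable M"
  using assms(2) by (intro borel_measurable_prod measurable_compose[OF b_meas assms(1)]) auto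

lemma integrable_prod_b:
  assumes "g \<in> borel_measurable borel" "\<And>x. norm (g x) \<le> 1"
  shows "complex_integrable M (\<lambda>\<omega>. \<Prod>j\<le>m. g (b m j \<omega>))"
  by (rule integrable_const_bound[where B = 1], rule AE_I2, rule norm_prod_le_one[OF assms(2)],
      rule measurable_prod_b[OF assms(1)], simp)

lemma norm_prod_mean_le_one:
  assumes "g \<in> borel_measurable borel" "\<And>x. norm (g x) \<le> 1"
  shows "norm (prod_mean m g) \<le> 1"
proof -
  have "norm (prod_mean m g) \<le> (LINT \<omega>|M. norm (\<Prod>j\<le>m. g (b m j \<omega>)))"
    unfolding prod_mean_def by (rule integral_norm_bound)
  also have "\<dots> \<le> (LINT \<omega>|M. 1)"
    by (intro integral_mono integrable_norm integrable_prod_b norm_prod_le_one assms) simp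
  finally show ?thesis using prob_space by simp
qed

lemma summable_Phi:
  assumes "g \<in> borel_measurable borel" "\<And>x. norm (g x) \<le> 1" "0 \<le> t"
  shows "summable (\<lambda>m. yule_pmf t m *\<^sub>R prod_mean m g)"
proof (rule summable_comparison_test'[OF sums_summable[OF yule_pmf_sums[OF assms(3)]], of 0])
  fix m
  show "norm (yule_pmf t m *\<^sub>R prod_mean m g) \<le> yule_pmf t m"
    using mult_left_mono[OF norm_prod_mean_le_one[OF assms(1,2)] yule_pmf_nonneg[OF assms(3)]] yule_pmf_nonneg[OF assms(3)] by simp
qed

text \<open>Starting from the single weight 1, the factors \<open>1 + S / k\<close> for
  \<open>k = 1, ..., m\<close> multiply to \<open>pochhammer (1 + S) m / fact m\<close>.\<close>

lemma moment_nn: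
  assumes "(s = 1 \<and> S = a) \<or> (s = d \<and> S = Sd)"
  shows "(\<integral>\<^sup>+\<omega>. (\<Sum>j\<le>m. ennreal (b m j \<omega> powr s)) \<partial>M) = ennreal (pochhammer (1 + S) m / fact m)"
proof (induction m)
  case 0
  show ?case by (simp add: b_0 emeasure_space_1)
next
  case (Suc m)
  have S: "- 1 \<le> S" using assms Sd a_gt by auto
  then have "0 \<le> 1 + S / real (Suc m)" by (simp add: field_simps)
  moreover have "0 \<le> pochhammer (1 + S) m / fact m" using S by (intro divide_nonneg_nonneg pochhammer_nonneg_real) auto
  moreover have "(1 + S / real (Suc m)) * (pochhammer (1 + S) m / fact m) = pochhammer (1 + S) (Suc m) / fact (Suc m)"
    by (simp add: pochhammer_Suc field_simps)
  ultimately show ?case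
    unfolding forward_moment[OF assms] Suc by (simp only: ennreal_mult[symmetric])
qed

lemma moment_real:
  assumes "(s = 1 \<and> S = a) \<or> (s = d \<and> S = Sd)"
  shows "integrable M (\<lambda>\<omega>. \<Sum>j\<le>m. b m j \<omega> powr s)"
    and "(LINT \<omega>|M. (\<Sum>j\<le>m. b m j \<omega> powr s)) = pochhammer (1 + S) m / fact m"
proof -
  have S: "- 1 \<le> S" using assms Sd a_gt by auto
  then have "0 \<le> pochhammer (1 + S) m / fact m" by (intro divide_nonneg_nonneg pochhammer_nonneg_real) auto
  moreover have "(\<lambda>\<omega>. \<Sum>j\<le>m. b m j \<omega> powr s) \<in> borel_measurable M"
    by (intro borel_measurable_sum measurable_compose[OF b_meas, where g = "\<lambda>x. x powr s"]) auto
  moreover have "(\<integral>\<^sup>+\<omega>. ennreal (\<Sum>j\<le>m. b m j \<omega> powr s) \<partial>M) = ennreal (pochhammer (1 + S) m / fact m)"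
    using moment_nn[OF assms, of m] by (simp add: sum_ennreal)
  ultimately have "has_bochner_integral M (\<lambda>\<omega>. \<Sum>j\<le>m. b m j \<omega> powr s) (pochhammer (1 + S) m / fact m)"
    by (intro has_bochner_integral_nn_integral) (auto intro!: sum_nonneg)
  then show "integrable M (\<lambda>\<omega>. \<Sum>j\<le>m. b m j \<omega> powr s)"
    "(LINT \<omega>|M. (\<Sum>j\<le>m. b m j \<omega> powr s)) = pochhammer (1 + S) m / fact m"
    by (auto simp: has_bochner_integral_iff)
qed

text \<open>Products of factors bounded by 1 differ by at most the sum of the differences of their
  factors, so a bound by \<open>A * x + B * x powr d\<close> integrates to the power sums of orders
  1 and \<open>d\<close>.\<close>

lemma prod_mean_diff:
  assumes g: "g1 \<in> borel_measurable borel" "g2 \<in> borel_measurable borel" "\<And>x. norm (g1 x) \<le> 1" "\<And>x. norm (g2 x) \<le> 1"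
    and diff: "\<And>x. 0 \<le> x \<Longrightarrow> norm (g1 x - g2 x) \<le> A * x + B * x powr d"
  shows "norm (prod_mean m g1 - prod_mean m g2) \<le> A * (pochhammer (1 + a) m / fact m) + B * (pochhammer (1 + Sd) m / fact m)"
proof -
  have "norm (prod_mean m g1 - prod_mean m g2) = norm (CLINT \<omega>|M. (\<Prod>j\<le>m. g1 (b m j \<omega>)) - (\<Prod>j\<le>m. g2 (b m j \<omega>)))"
    unfolding prod_mean_def by (subst Bochner_Integration.integral_diff) (auto intro!: integrable_prod_b g)
  also have "\<dots> \<le> (LINT \<omega>|M. norm ((\<Prod>j\<le>m. g1 (b m j \<omega>)) - (\<Prod>j\<le>m. g2 (b m j \<omega>))))"
    by (rule integral_norm_bound)
  also have "\<dots> \<le> (LINT \<omega>|M. A * (\<Sum>j\<le>m. b m j \<omega> powr 1) + B * (\<Sum>j\<le>m. b m j \<omega> powr d))"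
  proof (rule integral_mono_AE)
    show "integrable M (\<lambda>\<omega>. norm ((\<Prod>j\<le>m. g1 (b m j \<omega>)) - (\<Prod>j\<le>m. g2 (b m j \<omega>))))"
      by (intro integrable_norm Bochner_Integration.integrable_diff integrable_prod_b g)
    show "integrable M (\<lambda>\<omega>. A * (\<Sum>j\<le>m. b m j \<omega> powr 1) + B * (\<Sum>j\<le>m. b m j \<omega> powr d))"
      by (intro Bochner_Integration.integrable_add integrable_mult_right moment_real) auto
    have "AE \<omega> in M. \<forall>j\<in>{..m}. 0 \<le> b m j \<omega>"
      by (intro AE_finite_allI b_nonneg) auto
    then show "AE \<omega> in M. norm ((\<Prod>j\<le>m. g1 (b m j \<omega>)) - (\<Prod>j\<le>m. g2 (b m j \<omega>)))
        \<le> A * (\<Sum>j\<le>m. b m j \<omega> powr 1) + B * (\<Sum>j\<le>m. b m j \<omega> powr d)"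
    proof eventually_elim
      case (elim \<omega>)
      have "norm ((\<Prod>j\<le>m. g1 (b m j \<omega>)) - (\<Prod>j\<le>m. g2 (b m j \<omega>))) \<le> (\<Sum>j\<le>m. norm (g1 (b m j \<omega>) - g2 (b m j \<omega>)))"
        by (intro norm_prod_diff g)
      also have "\<dots> \<le> (\<Sum>j\<le>m. A * b m j \<omega> powr 1 + B * b m j \<omega> powr d)"
        using elim diff by (intro sum_mono) auto
      finally show ?case by (simp add: sum.distrib sum_distrib_left)
    qed
  qed
  also have "\<dots> = A * (LINT \<omega>|M. (\<Sum>j\<le>m. b m j \<omega> powr 1)) + B * (LINT \<omega>|M. (\<Sum>j\<le>m. b m j \<omega> powr d))"
    by (subst Bochner_Integration.integral_add)
       (auto intro!: integrable_mult_right moment_real[of 1 a] moment_real[of d Sd] simp del: powr_one')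
  also have "\<dots> = A * (pochhammer (1 + a) m / fact m) + B * (pochhammer (1 + Sd) m / fact m)"
    using moment_real(2)[of 1 a m] moment_real(2)[of d Sd m] by simp
  finally show ?thesis .
qed

lemma Phi_diff:
  assumes g: "g1 \<in> borel_measurable borel" "g2 \<in> borel_measurable borel" "\<And>x. norm (g1 x) \<le> 1" "\<And>x. norm (g2 x) \<le> 1"
    and diff: "\<And>x. 0 \<le> x \<Longrightarrow> norm (g1 x - g2 x) \<le> A * x + B * x powr d" and t: "0 \<le> t"
  shows "norm (Phi t g1 - Phi t g2) \<le> A * exp (a * t) + B * exp (Sd * t)"
proof -
  have s: "(\<lambda>m. A * (yule_pmf t m * (pochhammer (1 + a) m / fact m)) + B * (yule_pmf t m * (pochhammer (1 + Sd) m / fact m))) sums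
      (A * exp (a * t) + B * exp (Sd * t))"
    unfolding yule_pmf_def by (intro sums_add sums_mult sums_yule_moment t)
  have le: "norm (yule_pmf t m *\<^sub>R prod_mean m g1 - yule_pmf t m *\<^sub>R prod_mean m g2) \<le> A * (yule_pmf t m * (pochhammer (1 + a) m / fact m)) + B * (yule_pmf t m * (pochhammer (1 + Sd) m / fact m))" for m
  proof -
    have "norm (yule_pmf t m *\<^sub>R prod_mean m g1 - yule_pmf t m *\<^sub>R prod_mean m g2) = yule_pmf t m * norm (prod_mean m g1 - prod_mean m g2)"
      using yule_pmf_nonneg[OF t] by (simp flip: scaleR_diff_right)
    also have "\<dots> \<le> yule_pmf t m * (A * (pochhammer (1 + a) m / fact m) + B * (pochhammer (1 + Sd) m / fact m))"
      by (intro mult_left_mono prod_mean_diff g diff yule_pmf_nonneg t)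
    finally show ?thesis by (simp add: algebra_simps)
  qed
  have sm: "summable (\<lambda>m. norm (yule_pmf t m *\<^sub>R prod_mean m g1 - yule_pmf t m *\<^sub>R prod_mean m g2))"
    by (rule summable_comparison_test'[OF sums_summable[OF s], of 0]) (use le in simp)
  have "Phi t g1 - Phi t g2 = (\<Sum>m. yule_pmf t m *\<^sub>R prod_mean m g1 - yule_pmf t m *\<^sub>R prod_mean m g2)"
    unfolding Phi_def by (intro suminf_diff summable_Phi g t)
  also have "norm \<dots> \<le> (\<Sum>m. norm (yule_pmf t m *\<^sub>R prod_mean m g1 - yule_pmf t m *\<^sub>R prod_mean m g2))"
    by (rule summable_norm[OF sm])
  also have "\<dots> \<le> (\<Sum>m. A * (yule_pmf t m * (pochhammer (1 + a) m / fact m)) + B * (yule_pmf t m * (pochhammer (1 + Sd) m / fact m)))"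
    by (rule suminf_le[OF le sm sums_summable[OF s]])
  also have "\<dots> = A * exp (a * t) + B * exp (Sd * t)" using s by (rule sums_unique[symmetric])
  finally show ?thesis .
qed


lemma prod_mean_Suc:
  assumes "g \<in> borel_measurable borel" "\<And>x. norm (g x) \<le> 1"
  shows "(CLINT \<omega>|M. (\<Sum>i\<le>m. T g (b m i \<omega>) * (\<Prod>j\<in>{..m} - {i}. g (b m j \<omega>)))) = of_nat (Suc m) * prod_mean (Suc m) g"
  unfolding prod_mean_def forward[OF assms] by (simp add: scaleR_conv_of_real del: of_nat_Suc)

text \<open>By the product rule each factor contributes its own \<open>(T v - v) / y\<close>. The
  forward identity gathers the terms with \<open>T\<close> into \<open>real (Suc m)\<close> times
  the mean at \<open>m + 1\<close>; the others reproduce the mean at \<open>m\<close> once for each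
  factor.\<close>

lemma prod_mean_flow_derivative:
  assumes Z: "Zlaw \<zeta>" and \<psi>: "Re \<psi> \<le> 0" and y: "0 < y"
  defines "v \<equiv> \<lambda>y x. laplace \<zeta> \<psi> (y powr a * x)"
  shows "((\<lambda>y. prod_mean m (v y)) has_vector_derivative
     (real (Suc m) / y) *\<^sub>R (prod_mean (Suc m) (v y) - prod_mean m (v y))) (at y)"
proof -
  interpret \<zeta>: real_distribution \<zeta> using Z by (simp add: Zlaw_def)
  note [measurable] = \<zeta>.measurable_laplace[OF \<psi>]
  have v_meas [measurable]: "v y \<in> borel_measurable borel" for y unfolding v_def by measurable
  have v1: "norm (v y x) \<le> 1" for y x unfolding v_def by (rule \<zeta>.norm_laplace_le_one[OF \<psi>])
  have Tv: "T (v y) x = T (laplace \<zeta> \<psi>) (y powr a * x)" for y x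
    unfolding T_def v_def by (simp add: mult_ac)
  have Tv1: "norm (T (v y) x) \<le> 1" for y x by (rule norm_T_le[OF v_meas v1])
  have vd: "((\<lambda>y. v y x) has_vector_derivative (1 / y) *\<^sub>R (T (v y) x - v y x)) (at y)" if "0 < y" for y x
    unfolding Tv unfolding v_def by (rule laplace_flow_derivative[OF Z \<psi> that])
  define f' where "f' y \<omega> = (\<Sum>i\<le>m. ((1 / y) *\<^sub>R (T (v y) (b m i \<omega>) - v y (b m i \<omega>))) * (\<Prod>j\<in>{..m} - {i}. v y (b m j \<omega>)))" for y \<omega>
  have "((\<lambda>y. CLINT \<omega>|M. \<Prod>j\<le>m. v y (b m j \<omega>)) has_vector_derivative (CLINT \<omega>|M. f' y \<omega>)) (at y)"
  \<comment> \<open>For \<open>x > y / 2\<close> one has \<open>1 / x < 2 / y\<close>, and the norm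
    of \<open>T v - v\<close> is at most 2; the sum over \<open>Suc m\<close> factors gives
    \<open>K\<close>.\<close>
  proof (rule has_vector_derivative_expectation[where c = "y / 2" and K = "real (Suc m) * (4 / y)"])
    fix x \<omega> assume x: "y / 2 < x"
    then have x0: "0 < x" using y by linarith
    have "((\<lambda>x. \<Prod>j\<le>m. v x (b m j \<omega>)) has_derivative (\<lambda>h. \<Sum>i\<le>m. (h *\<^sub>R ((1 / x) *\<^sub>R (T (v x) (b m i \<omega>) - v x (b m i \<omega>)))) * (\<Prod>j\<in>{..m} - {i}. v x (b m j \<omega>)))) (at x)"
      using vd[OF x0] by (intro has_derivative_prod) (simp only: has_vector_derivative_def)
    then show "((\<lambda>x. \<Prod>j\<le>m. v x (b m j \<omega>)) has_vector_derivative f' x \<omega>) (at x)"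
      unfolding has_vector_derivative_def f'_def by (simp only: scaleR_sum_right mult_scaleR_left)
    have "norm (f' x \<omega>) \<le> (\<Sum>i\<le>m. norm (((1 / x) *\<^sub>R (T (v x) (b m i \<omega>) - v x (b m i \<omega>))) * (\<Prod>j\<in>{..m} - {i}. v x (b m j \<omega>))))"
      unfolding f'_def by (rule norm_sum)
    also have "\<dots> \<le> (\<Sum>i\<le>m. 4 / y)"
    proof (rule sum_mono)
      fix i
      have "norm (T (v x) (b m i \<omega>) - v x (b m i \<omega>)) \<le> 2"
        using norm_triangle_ineq4[of "T (v x) (b m i \<omega>)" "v x (b m i \<omega>)"] Tv1[of x "b m i \<omega>"] v1[of x "b m i \<omega>"] by linarith
      then have "(1 / x) * norm (T (v x) (b m i \<omega>) - v x (b m i \<omega>)) * norm (\<Prod>j\<in>{..m} - {i}. v x (b m j \<omega>)) \<le> (2 / y) * 2 * 1"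
        using x y x0 by (intro mult_mono norm_prod_le_one v1) (auto simp: field_simps)
      then show "norm (((1 / x) *\<^sub>R (T (v x) (b m i \<omega>) - v x (b m i \<omega>))) * (\<Prod>j\<in>{..m} - {i}. v x (b m j \<omega>))) \<le> 4 / y"
        using x0 by (simp only: norm_mult norm_scaleR) simp
    qed
    also have "\<dots> = real (Suc m) * (4 / y)" by simp
    finally show "norm (f' x \<omega>) \<le> real (Suc m) * (4 / y)" .
  next
    show "complex_integrable M (\<lambda>\<omega>. \<Prod>j\<le>m. v x (b m j \<omega>))" for x
      by (rule integrable_prod_b[OF v_meas v1])
    show "f' y \<in> borel_measurable M"
      unfolding f'_def
      by (intro borel_measurable_sum borel_measurable_times borel_measurable_scaleR borel_measurable_diff
           measurable_prod_b measurable_compose[OF b_meas v_meas] measurable_compose[OF b_meas measurable_T[OF v_meas]] v_meas) auto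
  qed (use y in auto)
  moreover have "(CLINT \<omega>|M. f' y \<omega>) = (real (Suc m) / y) *\<^sub>R (prod_mean (Suc m) (v y) - prod_mean m (v y))"
  proof -
    have eq: "f' y \<omega> = (1 / y) *\<^sub>R ((\<Sum>i\<le>m. T (v y) (b m i \<omega>) * (\<Prod>j\<in>{..m} - {i}. v y (b m j \<omega>))) - of_nat (Suc m) * (\<Prod>j\<le>m. v y (b m j \<omega>)))" for \<omega>
    proof -
      have "f' y \<omega> = (1 / y) *\<^sub>R ((\<Sum>i\<le>m. T (v y) (b m i \<omega>) * (\<Prod>j\<in>{..m} - {i}. v y (b m j \<omega>))) - (\<Sum>i\<le>m. v y (b m i \<omega>) * (\<Prod>j\<in>{..m} - {i}. v y (b m j \<omega>))))"
        unfolding f'_def by (simp add: scaleR_sum_right sum_subtractf[symmetric] scaleR_diff_right left_diff_distrib)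
      also have "(\<Sum>i\<le>m. v y (b m i \<omega>) * (\<Prod>j\<in>{..m} - {i}. v y (b m j \<omega>))) = (\<Sum>i\<le>m. \<Prod>j\<le>m. v y (b m j \<omega>))"
        by (intro sum.cong refl prod.remove[symmetric]) auto
      finally show ?thesis by simp
    qed
    have i1: "complex_integrable M (\<lambda>\<omega>. \<Sum>i\<le>m. T (v y) (b m i \<omega>) * (\<Prod>j\<in>{..m} - {i}. v y (b m j \<omega>)))"
    proof (rule Bochner_Integration.integrable_sum)
      fix i assume i: "i \<in> {..m}"
      show "complex_integrable M (\<lambda>\<omega>. T (v y) (b m i \<omega>) * (\<Prod>j\<in>{..m} - {i}. v y (b m j \<omega>)))"
      proof (rule integrable_const_bound[where B = 1])
        show "AE \<omega> in M. norm (T (v y) (b m i \<omega>) * (\<Prod>j\<in>{..m} - {i}. v y (b m j \<omega>))) \<le> 1"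
        proof (rule AE_I2)
          fix \<omega>
          have "norm (T (v y) (b m i \<omega>)) * norm (\<Prod>j\<in>{..m} - {i}. v y (b m j \<omega>)) \<le> 1 * 1"
            by (intro mult_mono Tv1 norm_prod_le_one v1) auto
          then show "norm (T (v y) (b m i \<omega>) * (\<Prod>j\<in>{..m} - {i}. v y (b m j \<omega>))) \<le> 1" by (simp only: norm_mult)
        qed
        show "(\<lambda>\<omega>. T (v y) (b m i \<omega>) * (\<Prod>j\<in>{..m} - {i}. v y (b m j \<omega>))) \<in> borel_measurable M"
          using i by (intro borel_measurable_times measurable_prod_b v_meas measurable_compose[OF b_meas measurable_T[OF v_meas]]) auto
      qed
    qed
    have i2: "complex_integrable M (\<lambda>\<omega>. of_nat (Suc m) * (\<Prod>j\<le>m. v y (b m j \<omega>)))"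
      by (intro integrable_mult_right integrable_prod_b v_meas v1)
    have "(CLINT \<omega>|M. f' y \<omega>) = (1 / y) *\<^sub>R (of_nat (Suc m) * prod_mean (Suc m) (v y) - of_nat (Suc m) * prod_mean m (v y))"
      unfolding eq Bochner_Integration.integral_scaleR_right Bochner_Integration.integral_diff[OF i1 i2] prod_mean_Suc[OF v_meas v1]
      by (simp only: prod_mean_def Bochner_Integration.integral_mult_right_zero)
    then show ?thesis by (simp add: scaleR_conv_of_real algebra_simps del: of_nat_Suc)
  qed
  ultimately show ?thesis by (simp only: prod_mean_def)
qed

text \<open>By the forward equation the derivative of each summand cancels against its neighbours, and only
  the boundary term at N survives.\<close>

lemma partial_flow_derivative:
  assumes Z: "Zlaw \<zeta>" and \<psi>: "Re \<psi> \<le> 0" and y: "0 < y" and Y: "0 < Y"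
  defines "v \<equiv> \<lambda>y x. laplace \<zeta> \<psi> (y powr a * x)"
  shows "((\<lambda>y. \<Sum>m<N. (y / Y * (1 - y / Y) ^ m) *\<^sub>R prod_mean m (v y)) has_vector_derivative
     (real N * (y / Y) * (1 - y / Y) ^ (N - 1) / y) *\<^sub>R prod_mean N (v y)) (at y)"
proof (induction N)
  case 0
  show ?case by simp
next
  case (Suc N)
  have Q: "((\<lambda>y. prod_mean N (v y)) has_vector_derivative (real (Suc N) / y) *\<^sub>R (prod_mean (Suc N) (v y) - prod_mean N (v y))) (at y)"
    unfolding v_def by (rule prod_mean_flow_derivative[OF Z \<psi> y])
  let ?r = "y / Y"
  have c: "((\<lambda>y. y / Y * (1 - y / Y) ^ N) has_real_derivative ((1 - ?r) ^ N / Y - ?r * (real N * (1 - ?r) ^ (N - 1)) / Y)) (at y)"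
  proof -
    have r: "((\<lambda>y. y / Y) has_real_derivative 1 / Y) (at y)"
      using DERIV_cdivide[OF DERIV_ident, of Y y] .
    have "((\<lambda>y. (1 - y / Y) ^ N) has_real_derivative real N * ((0 - 1 / Y) * (1 - ?r) ^ (N - Suc 0))) (at y)"
      by (rule DERIV_power[OF DERIV_diff[OF DERIV_const r]])
    from DERIV_mult[OF r this] show ?thesis
      by (rule DERIV_cong) (simp add: algebra_simps)
  qed
  have "((\<lambda>y. (y / Y * (1 - y / Y) ^ N) *\<^sub>R prod_mean N (v y)) has_vector_derivative
     (?r * (1 - ?r) ^ N) *\<^sub>R ((real (Suc N) / y) *\<^sub>R (prod_mean (Suc N) (v y) - prod_mean N (v y)))
     + ((1 - ?r) ^ N / Y - ?r * (real N * (1 - ?r) ^ (N - 1)) / Y) *\<^sub>R prod_mean N (v y)) (at y)"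
    by (rule has_vector_derivative_scaleR[OF c Q])
  from has_vector_derivative_add[OF Suc this]
  have "((\<lambda>y. \<Sum>m<Suc N. (y / Y * (1 - y / Y) ^ m) *\<^sub>R prod_mean m (v y)) has_vector_derivative
     ((real N * ?r * (1 - ?r) ^ (N - 1) / y) *\<^sub>R prod_mean N (v y) +
     ((?r * (1 - ?r) ^ N) *\<^sub>R ((real (Suc N) / y) *\<^sub>R (prod_mean (Suc N) (v y) - prod_mean N (v y)))
     + ((1 - ?r) ^ N / Y - ?r * (real N * (1 - ?r) ^ (N - 1)) / Y) *\<^sub>R prod_mean N (v y)))) (at y)"
    by simp
  moreover have "(real N * ?r * (1 - ?r) ^ (N - 1) / y) *\<^sub>R prod_mean N (v y) +
     ((?r * (1 - ?r) ^ N) *\<^sub>R ((real (Suc N) / y) *\<^sub>R (prod_mean (Suc N) (v y) - prod_mean N (v y)))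
     + ((1 - ?r) ^ N / Y - ?r * (real N * (1 - ?r) ^ (N - 1)) / Y) *\<^sub>R prod_mean N (v y))
     = (real (Suc N) * ?r * (1 - ?r) ^ N / y) *\<^sub>R prod_mean (Suc N) (v y)"
  proof -
    have "real N * ?r * (1 - ?r) ^ (N - 1) / y - ?r * (1 - ?r) ^ N * (real (Suc N) / y)
       + ((1 - ?r) ^ N / Y - ?r * (real N * (1 - ?r) ^ (N - 1)) / Y) = 0"
    \<comment> \<open>For \<open>N = 0\<close> the truncated exponent \<open>N - 1\<close> is
      harmless, since the factor \<open>real N\<close> vanishes; for \<open>N = Suc k\<close> the
      power \<open>(1 - ?r) ^ k\<close> is common to all terms.\<close>
    proof (cases N)
      case 0
      then show ?thesis using y Y by (simp add: field_simps)
    next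
      case (Suc k)
      define z where "z = (1 - ?r) ^ k"
      have "real N * ?r * z / y - ?r * ((1 - ?r) * z) * (real (Suc N) / y)
       + ((1 - ?r) * z / Y - ?r * (real N * z) / Y) = 0"
        using y Y by (simp add: field_simps)
      then show ?thesis unfolding z_def using Suc by simp
    qed
    note coeff = this
    have gen: "\<alpha> *\<^sub>R q + (\<beta> *\<^sub>R (k *\<^sub>R (p - q)) + \<gamma> *\<^sub>R q) = (\<beta> * k) *\<^sub>R p + (\<alpha> - \<beta> * k + \<gamma>) *\<^sub>R q"
      for \<alpha> \<beta> k \<gamma> :: real and p q :: complex
      by (simp add: algebra_simps)
    show ?thesis unfolding gen coeff by (simp add: mult_ac del: of_nat_Suc)
  qed
  ultimately show ?case by simp
qed

text \<open>The interpolation runs from \<open>y = 1\<close>, where \<open>y / Y = exp (- t)\<close>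
  produces the Yule probabilities, to \<open>y = Y = exp t\<close>, where the flow is evaluated at
  the initial weight. By the telescoped derivative the partial sums at the two ends differ by at
  most a multiple of \<open>real (Suc N) * (1 - 1 / Y) ^ N\<close>, which tends to 0.\<close>

lemma Phi_laplace:
  assumes Z: "Zlaw \<zeta>" and \<psi>: "Re \<psi> \<le> 0" and t: "0 \<le> t"
  shows "Phi t (laplace \<zeta> \<psi>) = laplace \<zeta> \<psi> (exp (a * t))"
proof -
  interpret \<zeta>: real_distribution \<zeta> using Z by (simp add: Zlaw_def)
  define v where "v = (\<lambda>y x. laplace \<zeta> \<psi> (y powr a * x))"
  note [measurable] = \<zeta>.measurable_laplace[OF \<psi>]
  have v_meas: "v y \<in> borel_measurable borel" for y unfolding v_def by measurable
  have v1: "norm (v y x) \<le> 1" for y x unfolding v_def by (rule \<zeta>.norm_laplace_le_one[OF \<psi>])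
  have v_1: "v 1 = laplace \<zeta> \<psi>" by (simp add: v_def)
  define Y where "Y = exp t"
  have Y: "1 \<le> Y" using t by (simp add: Y_def)
  define F where "F N y = (\<Sum>m<N. (y / Y * (1 - y / Y) ^ m) *\<^sub>R prod_mean m (v y))" for N y
  have FY: "F (Suc N) Y = laplace \<zeta> \<psi> (exp (a * t))" for N
  proof -
    \<comment> \<open>At \<open>y = Y\<close> the factor \<open>1 - y / Y\<close> is 0, and
      \<open>0 ^ 0 = 1\<close> keeps exactly the term \<open>m = 0\<close>, which belongs to the
      single initial weight 1.\<close>
    have "F (Suc N) Y = (\<Sum>m<Suc N. (if m = 0 then prod_mean 0 (v Y) else 0))"
      unfolding F_def using Y by (intro sum.cong) auto
    also have "\<dots> = prod_mean 0 (v Y)" by (simp add: sum.lessThan_Suc_shift)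
    also have "\<dots> = v Y 1" using prob_space by (simp add: prod_mean_def b_0)
    finally show ?thesis by (simp add: v_def Y_def exp_powr_real mult.commute)
  qed
  let ?q = "1 - 1 / Y"
  have q: "0 \<le> ?q" "?q < 1" using Y by auto
  have bound: "norm (F (Suc N) Y - F (Suc N) 1) \<le> (real (Suc N) * ?q ^ N) * \<bar>Y - 1\<bar>" for N
  proof (rule vector_derivative_bound[where S = "{1..Y}"])
    fix y assume y: "y \<in> {1..Y}"
    show "(F (Suc N) has_vector_derivative (real (Suc N) * (y / Y) * (1 - y / Y) ^ (Suc N - 1) / y) *\<^sub>R prod_mean (Suc N) (v y)) (at y within {1..Y})"
      unfolding F_def v_def
      by (rule has_vector_derivative_at_within, rule partial_flow_derivative[OF Z \<psi>]) (use y Y in auto)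
    have "norm ((real (Suc N) * (y / Y) * (1 - y / Y) ^ (Suc N - 1) / y) *\<^sub>R prod_mean (Suc N) (v y)) =
        (real (Suc N) * (1 - y / Y) ^ N) * (1 / Y) * norm (prod_mean (Suc N) (v y))"
      using y Y by (simp add: abs_mult del: of_nat_Suc)
    also have "\<dots> \<le> (real (Suc N) * ?q ^ N) * 1 * 1"
      using y Y q by (intro mult_mono power_mono norm_prod_mean_le_one v_meas v1) (auto simp: divide_right_mono)
    finally show "norm ((real (Suc N) * (y / Y) * (1 - y / Y) ^ (Suc N - 1) / y) *\<^sub>R prod_mean (Suc N) (v y)) \<le> real (Suc N) * ?q ^ N"
      by simp
  qed (use q Y in auto)
  have "(\<lambda>N. real (Suc N) * ?q ^ N * \<bar>Y - 1\<bar>) \<longlonglongrightarrow> 0"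
  proof -
    have "(\<lambda>N. real N * ?q ^ N) \<longlonglongrightarrow> 0"
      using powser_times_n_limit_0[of ?q] q by simp
    moreover have "(\<lambda>N. ?q ^ N) \<longlonglongrightarrow> 0" using q by (intro LIMSEQ_realpow_zero) auto
    ultimately have "(\<lambda>N. (real N * ?q ^ N + ?q ^ N) * \<bar>Y - 1\<bar>) \<longlonglongrightarrow> (0 + 0) * \<bar>Y - 1\<bar>"
      by (intro tendsto_mult tendsto_add tendsto_const)
    then show ?thesis by (simp add: algebra_simps)
  qed
  then have "(\<lambda>N. F (Suc N) Y - F (Suc N) 1) \<longlonglongrightarrow> 0"
    by (rule Lim_null_comparison[rotated]) (use bound in simp)
  then have "(\<lambda>N. laplace \<zeta> \<psi> (exp (a * t)) - F (Suc N) 1) \<longlonglongrightarrow> 0" unfolding FY .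
  then have "(\<lambda>N. laplace \<zeta> \<psi> (exp (a * t)) - (laplace \<zeta> \<psi> (exp (a * t)) - F (Suc N) 1)) \<longlonglongrightarrow> laplace \<zeta> \<psi> (exp (a * t)) - 0"
    by (intro tendsto_intros)
  then have "(\<lambda>N. F (Suc N) 1) \<longlonglongrightarrow> laplace \<zeta> \<psi> (exp (a * t))" by simp
  moreover have "(\<lambda>N. F (Suc N) 1) \<longlonglongrightarrow> Phi t (laplace \<zeta> \<psi>)"
  proof -
    have "F N 1 = (\<Sum>m<N. yule_pmf t m *\<^sub>R prod_mean m (laplace \<zeta> \<psi>))" for N
      unfolding F_def v_1 by (simp add: yule_pmf_def Y_def exp_minus inverse_eq_divide)
    moreover have "(\<lambda>N. \<Sum>m<N. yule_pmf t m *\<^sub>R prod_mean m (laplace \<zeta> \<psi>)) \<longlonglongrightarrow> Phi t (laplace \<zeta> \<psi>)"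
      unfolding Phi_def by (intro summable_LIMSEQ summable_Phi t \<zeta>.norm_laplace_le_one \<psi>) measurable
    ultimately show ?thesis by (intro LIMSEQ_Suc) simp
  qed
  ultimately show ?thesis by (rule LIMSEQ_unique[symmetric])
qed

theorem Phi_tendsto:
  assumes Z: "Zlaw \<zeta>" and \<psi>: "Re \<psi> \<le> 0"
    and g: "g \<in> borel_measurable borel" "\<And>x. norm (g x) \<le> 1" "g 0 = 1"
    and lim: "((\<lambda>x. (g x - 1) / x) \<longlongrightarrow> \<psi>) (at_right 0)"
  shows "((\<lambda>t. Phi t (\<lambda>x. g (exp (- a * t) * x))) \<longlongrightarrow> laplace \<zeta> \<psi> 1) at_top"
proof (rule tendstoI)
  fix e :: real assume e: "e > 0"
  interpret \<zeta>: real_distribution \<zeta> using Z by (simp add: Zlaw_def)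
  note [measurable] = \<zeta>.measurable_laplace[OF \<psi>] g(1)
  let ?w = "laplace \<zeta> \<psi>"
  have "((\<lambda>x. (?w x - 1) / x) \<longlongrightarrow> \<psi> * (LINT z|\<zeta>. z)) (at_right 0)"
    by (rule \<zeta>.laplace_expansion[OF \<psi>]) (use Z in \<open>auto simp: Zlaw_def\<close>)
  then have "((\<lambda>x. (?w x - 1) / x) \<longlongrightarrow> \<psi>) (at_right 0)"
    using Z by (simp add: Zlaw_def)
  from tendsto_diff[OF lim this]
  have "((\<lambda>x. (g x - ?w x) / x) \<longlongrightarrow> 0) (at_right 0)"
    by (simp add: diff_divide_distrib)
  then have "eventually (\<lambda>x. norm ((g x - ?w x) / x) < e / 2) (at_right 0)"
    using e by (auto dest!: tendstoD[where e = "e / 2"] simp: dist_norm)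
  then obtain \<eta> where \<eta>: "0 < \<eta>" "\<And>x. 0 < x \<Longrightarrow> x < \<eta> \<Longrightarrow> norm ((g x - ?w x) / x) < e / 2"
    by (auto simp: eventually_at_right_field)
  \<comment> \<open>Beyond \<open>\<eta>\<close> two functions bounded by 1 differ by at most 2, and
    there \<open>2 \<le> C * x powr d\<close>.\<close>
  define C where "C = 2 / \<eta> powr d"
  have C: "0 \<le> C" by (simp add: C_def)
  have diff: "norm (g x - ?w x) \<le> e / 2 * x + C * x powr d" if "0 \<le> x" for x
  proof -
    consider "x = 0" | "0 < x" "x < \<eta>" | "\<eta> \<le> x" using \<open>0 \<le> x\<close> by linarith
    then show ?thesis
    proof cases
      case 1 then show ?thesis using g(3) by simp
    next
      case 2
      have "norm (g x - ?w x) \<le> e / 2 * x"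
        using \<eta>(2)[OF 2] 2 by (simp add: norm_divide divide_less_eq)
      then show ?thesis using C by (simp add: add_increasing2)
    next
      case 3
      have "norm (g x - ?w x) \<le> 2"
        using norm_triangle_ineq4[of "g x" "?w x"] g(2)[of x] \<zeta>.norm_laplace_le_one[OF \<psi>, of x] by linarith
      also have "\<dots> \<le> C * x powr d"
      proof -
        have "\<eta> powr d \<le> x powr d" using 3 \<eta>(1) d_bounds by (intro powr_mono2) auto
        then show ?thesis using \<eta>(1) by (simp add: C_def le_divide_eq)
      qed
      finally show ?thesis using e \<open>0 \<le> x\<close> by (simp add: add_increasing)
    qed
  qed
  have main: "norm (Phi t (\<lambda>x. g (exp (- a * t) * x)) - ?w 1) \<le> e / 2 + C * exp (- ((a * d - Sd) * t))" if t: "0 \<le> t" for t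
  proof -
    let ?c = "exp (- a * t)"
    \<comment> \<open>Rescaling the argument is a change of \<open>\<psi>\<close>, so the exact
      identity \<open>Phi_laplace\<close> still applies, and the factors
      \<open>exp (- a * t)\<close> and \<open>exp (a * t)\<close> cancel.\<close>
    have "(\<lambda>x. ?w (?c * x)) = laplace \<zeta> (\<psi> * complex_of_real ?c)"
      by (rule ext) (simp only: laplace_scale exp_ge_zero)
    then have "Phi t (\<lambda>x. ?w (?c * x)) = Phi t (laplace \<zeta> (\<psi> * complex_of_real ?c))"
      by (rule arg_cong)
    also have "\<dots> = laplace \<zeta> (\<psi> * complex_of_real ?c) (exp (a * t))"
      by (rule Phi_laplace[OF Z _ t]) (use \<psi> in \<open>simp add: mult_nonpos_nonneg\<close>)
    also have "\<dots> = ?w 1" by (subst laplace_scale) (simp_all add: exp_add[symmetric])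
    finally have w: "Phi t (\<lambda>x. ?w (?c * x)) = ?w 1" .
    have "norm (Phi t (\<lambda>x. g (?c * x)) - Phi t (\<lambda>x. ?w (?c * x))) \<le> (e / 2 * ?c) * exp (a * t) + (C * ?c powr d) * exp (Sd * t)"
    proof (rule Phi_diff)
      fix x :: real assume "0 \<le> x"
      then have "norm (g (?c * x) - ?w (?c * x)) \<le> e / 2 * (?c * x) + C * (?c * x) powr d" by (intro diff) simp
      then show "norm (g (?c * x) - ?w (?c * x)) \<le> e / 2 * ?c * x + C * ?c powr d * x powr d"
        by (simp add: powr_mult mult_ac)
    qed (use t in \<open>auto simp: g \<zeta>.norm_laplace_le_one[OF \<psi>]\<close>)
    \<comment> \<open>The first-order error is exactly balanced by the normalisation and stays at
      \<open>e / 2\<close>; the error of order \<open>d\<close> decays because S(d) < a d.\<close>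
    also have "(e / 2 * ?c) * exp (a * t) = e / 2" by (simp add: exp_minus)
    also have "(C * ?c powr d) * exp (Sd * t) = C * exp (- ((a * d - Sd) * t))"
      by (simp add: exp_powr_real exp_add[symmetric] algebra_simps)
    finally show ?thesis unfolding w .
  qed
  have "filterlim (\<lambda>t. (a * d - Sd) * t) at_top at_top"
    using Sd by (intro filterlim_tendsto_pos_mult_at_top[OF tendsto_const] filterlim_ident) auto
  then have "((\<lambda>t. exp (- ((a * d - Sd) * t))) \<longlongrightarrow> 0) at_top"
    by (intro filterlim_compose[OF exp_at_bot]) (simp add: filterlim_uminus_at_top)
  then have "((\<lambda>t. C * exp (- ((a * d - Sd) * t))) \<longlongrightarrow> C * 0) at_top" by (intro tendsto_intros)
  then have "eventually (\<lambda>t. C * exp (- ((a * d - Sd) * t)) < e / 2) at_top"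
    using e by (auto dest: order_tendstoD(2)[where a = "e / 2"])
  then show "eventually (\<lambda>t. dist (Phi t (\<lambda>x. g (exp (- a * t) * x))) (?w 1) < e) at_top"
    using eventually_ge_at_top[of 0]
  proof eventually_elim
    case (elim t)
    then show ?case using main[OF elim(2)] by (simp add: dist_norm)
  qed
qed

text \<open>\<open>Phi_tendsto\<close> constrains \<open>g\<close> near 0 only by its slope. With
  \<open>g\<close> the transform of \<open>\<zeta>\<close>, whose slope is \<open>\<psi>\<close> by
  the unit mean, the same quantity converges to the transform at 1 of any solution, so all solutions
  share it.\<close>

theorem Zlaw_unique:
  assumes "Zlaw \<zeta>" "Zlaw \<zeta>'"
  shows "\<zeta> = \<zeta>'"
proof -
  have eq: "laplace \<zeta> \<psi> 1 = laplace \<zeta>' \<psi> 1" if \<psi>: "Re \<psi> \<le> 0" for \<psi>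
  proof -
    interpret \<zeta>: real_distribution \<zeta> using assms by (simp add: Zlaw_def)
    have "((\<lambda>x. (laplace \<zeta> \<psi> x - 1) / x) \<longlongrightarrow> \<psi> * (LINT z|\<zeta>. z)) (at_right 0)"
      by (rule \<zeta>.laplace_expansion[OF \<psi>]) (use assms in \<open>auto simp: Zlaw_def\<close>)
    then have "((\<lambda>x. (laplace \<zeta> \<psi> x - 1) / x) \<longlongrightarrow> \<psi>) (at_right 0)"
      using assms by (simp add: Zlaw_def)
    then have "((\<lambda>t. Phi t (\<lambda>x. laplace \<zeta> \<psi> (exp (- a * t) * x))) \<longlongrightarrow> laplace \<xi> \<psi> 1) at_top" if "Zlaw \<xi>" for \<xi>
      by (intro Phi_tendsto that \<psi> \<zeta>.measurable_laplace \<zeta>.norm_laplace_le_one \<zeta>.laplace_0)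
    from tendsto_unique[OF _ this[OF assms(1)] this[OF assms(2)]] show ?thesis by simp
  qed
  \<comment> \<open>The argument of the characteristic function is moved entirely into
    \<open>\<psi>\<close>, because the transforms have been compared at the point 1.\<close>
  have char: "char \<xi> u = laplace \<xi> (\<i> * u) 1" if "Zlaw \<xi>" for \<xi> u
  proof -
    have "char \<xi> u = laplace \<xi> (\<i> * complex_of_real (sgn u)) (\<bar>u\<bar> * 1)"
      using real_distribution.laplace_char[of \<xi> u] that by (simp add: Zlaw_def laplace_def)
    also have "\<dots> = laplace \<xi> (\<i> * complex_of_real (sgn u) * complex_of_real \<bar>u\<bar>) 1"
      by (rule laplace_scale[symmetric]) simp
    also have "complex_of_real (sgn u) * complex_of_real \<bar>u\<bar> = complex_of_real u"
      by (simp add: sgn_mult_abs flip: of_real_mult)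
    then have "\<i> * complex_of_real (sgn u) * complex_of_real \<bar>u\<bar> = \<i> * complex_of_real u"
      by (simp only: mult.assoc)
    finally show ?thesis .
  qed
  show ?thesis
  proof (rule Levy_uniqueness)
    show "char \<zeta> = char \<zeta>'" unfolding char[OF assms(1)] char[OF assms(2)] fun_eq_iff by (auto intro: eq)
  qed (use assms in \<open>auto simp: Zlaw_def\<close>)
qed

end

section \<open>The recursive weights\<close>

text \<open>Independence is expressed by integrating twice over \<open>M\<close> itself:
  \<open>\<omega>'\<close> plays an independent copy, so one block of variables can be frozen while
  the other is averaged, without naming the laws of the blocks.\<close>

lemma (in prob_space) indep_var_double_integral:
  fixes f :: "_ \<Rightarrow> complex"
  assumes ind: "indep_var S X T Y"
    and f: "f \<in> borel_measurable (S \<Otimes>\<^sub>M T)" "\<And>z. norm (f z) \<le> K"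
  shows "(\<integral>\<omega>. f (X \<omega>, Y \<omega>) \<partial>M) = (\<integral>\<omega>. \<integral>\<omega>'. f (X \<omega>, Y \<omega>') \<partial>M \<partial>M)"
proof -
  have X [measurable]: "X \<in> measurable M S" and Y [measurable]: "Y \<in> measurable M T"
    and eq: "distr M S X \<Otimes>\<^sub>M distr M T Y = distr M (S \<Otimes>\<^sub>M T) (\<lambda>x. (X x, Y x))"
    using ind unfolding indep_var_distribution_eq by auto
  note f(1)[measurable]
  interpret DX: prob_space "distr M S X" by (rule prob_space_distr) fact
  interpret DY: prob_space "distr M T Y" by (rule prob_space_distr) fact
  interpret P: pair_prob_space "distr M S X" "distr M T Y" ..
  have "(\<integral>\<omega>. f (X \<omega>, Y \<omega>) \<partial>M) = (\<integral>z. f z \<partial>distr M (S \<Otimes>\<^sub>M T) (\<lambda>x. (X x, Y x)))"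
    by (rule integral_distr[symmetric]) measurable
  also have "\<dots> = (\<integral>z. f z \<partial>(distr M S X \<Otimes>\<^sub>M distr M T Y))" by (simp only: eq)
  also have "\<dots> = (\<integral>x. \<integral>y. f (x, y) \<partial>distr M T Y \<partial>distr M S X)"
    by (rule P.integral_fst'[symmetric]) (rule P.P.integrable_const_bound[where B = K], rule AE_I2, rule f(2), measurable)
  also have "\<dots> = (\<integral>\<omega>. \<integral>y. f (X \<omega>, y) \<partial>distr M T Y \<partial>M)"
    by (rule integral_distr) measurable
  also have "\<dots> = (\<integral>\<omega>. \<integral>\<omega>'. f (X \<omega>, Y \<omega>') \<partial>M \<partial>M)"
  proof (rule Bochner_Integration.integral_cong[OF refl])
    fix \<omega> assume "\<omega> \<in> space M"
    then have "X \<omega> \<in> space S" using X by (rule measurable_space[rotated])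
    then show "(\<integral>y. f (X \<omega>, y) \<partial>distr M T Y) = (\<integral>\<omega>'. f (X \<omega>, Y \<omega>') \<partial>M)"
      by (intro integral_distr) measurable
  qed
  finally show ?thesis .
qed

lemma (in prob_space) indep_var_double_nn_integral:
  assumes ind: "indep_var S X T Y"
    and f: "f \<in> borel_measurable (S \<Otimes>\<^sub>M T)"
  shows "(\<integral>\<^sup>+\<omega>. f (X \<omega>, Y \<omega>) \<partial>M) = (\<integral>\<^sup>+\<omega>. \<integral>\<^sup>+\<omega>'. f (X \<omega>, Y \<omega>') \<partial>M \<partial>M)"
proof -
  have X [measurable]: "X \<in> measurable M S" and Y [measurable]: "Y \<in> measurable M T"
    and eq: "distr M S X \<Otimes>\<^sub>M distr M T Y = distr M (S \<Otimes>\<^sub>M T) (\<lambda>x. (X x, Y x))"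
    using ind unfolding indep_var_distribution_eq by auto
  note f(1)[measurable]
  interpret DY: prob_space "distr M T Y" by (rule prob_space_distr) fact
  have "(\<integral>\<^sup>+\<omega>. f (X \<omega>, Y \<omega>) \<partial>M) = (\<integral>\<^sup>+z. f z \<partial>distr M (S \<Otimes>\<^sub>M T) (\<lambda>x. (X x, Y x)))"
    by (rule nn_integral_distr[symmetric]) measurable
  also have "\<dots> = (\<integral>\<^sup>+z. f z \<partial>(distr M S X \<Otimes>\<^sub>M distr M T Y))" by (simp only: eq)
  also have "\<dots> = (\<integral>\<^sup>+x. \<integral>\<^sup>+y. f (x, y) \<partial>distr M T Y \<partial>distr M S X)"
    by (rule DY.nn_integral_fst[symmetric]) measurable
  also have "\<dots> = (\<integral>\<^sup>+\<omega>. \<integral>\<^sup>+y. f (X \<omega>, y) \<partial>distr M T Y \<partial>M)"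
    by (rule nn_integral_distr) measurable
  also have "\<dots> = (\<integral>\<^sup>+\<omega>. \<integral>\<^sup>+\<omega>'. f (X \<omega>, Y \<omega>') \<partial>M \<partial>M)"
  proof (rule nn_integral_cong)
    fix \<omega> assume "\<omega> \<in> space M"
    then have "X \<omega> \<in> space S" using X by (rule measurable_space[rotated])
    then show "(\<integral>\<^sup>+y. f (X \<omega>, y) \<partial>distr M T Y) = (\<integral>\<^sup>+\<omega>'. f (X \<omega>, Y \<omega>') \<partial>M)"
      by (intro nn_integral_distr) measurable
  qed
  finally show ?thesis .
qed

text \<open>No bounds on k and j: on the null set where an index I is out of range the list has the wrong
  length, but its entries still have to be measurable.\<close>

lemma nth_split_step:
  "(take (k - 1) b @ [x, y] @ drop k b) ! j =
   (let p = min (length b) (k - 1) in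
     if j < p then b ! j else if j = p then x else if j = Suc p then y
     else if k \<le> length b then b ! (k + (j - p - 2)) else [] ! (j - p - 2))"
proof -
  let ?p = "min (length b) (k - 1)"
  consider "j < ?p" | "j = ?p" | "j = Suc ?p" | i where "j = Suc (Suc (?p + i))"
  proof -
    have "j < ?p \<or> j = ?p \<or> j = Suc ?p \<or> (\<exists>i. j = Suc (Suc (?p + i)))"
      by (metis Suc_lessI add_Suc less_iff_Suc_add linorder_neqE_nat)
    then show thesis using that by blast
  qed
  then show ?thesis
    by cases (auto simp: nth_append Let_def)
qed

text \<open>Entries and length are treated together, because the position at which an entry is found
  depends on the length. The lists are not made into a measurable space: the random index and the
  length take countably many values, and for each pair of values the entry is a fixed measurable
  expression.\<close>

lemma measurable_beta_list:
  fixes l r :: "nat \<Rightarrow> 'c \<Rightarrow> real" and i :: "nat \<Rightarrow> 'c \<Rightarrow> nat"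
  assumes "\<And>n. 1 \<le> n \<Longrightarrow> n \<le> m \<Longrightarrow> l n \<in> borel_measurable N"
    and "\<And>n. 1 \<le> n \<Longrightarrow> n \<le> m \<Longrightarrow> r n \<in> borel_measurable N"
    and "\<And>n. 1 \<le> n \<Longrightarrow> n \<le> m \<Longrightarrow> i n \<in> measurable N (count_space UNIV)"
  shows "(\<forall>j. (\<lambda>\<omega>. beta_list (\<lambda>n. l n \<omega>) (\<lambda>n. r n \<omega>) (\<lambda>n. i n \<omega>) m ! j) \<in> borel_measurable N) \<and>
    (\<lambda>\<omega>. length (beta_list (\<lambda>n. l n \<omega>) (\<lambda>n. r n \<omega>) (\<lambda>n. i n \<omega>) m)) \<in> measurable N (count_space UNIV)"
  using assms
proof (induction m)
  case 0
  show ?case by simp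
next
  case (Suc m)
  define b where "b \<omega> = beta_list (\<lambda>n. l n \<omega>) (\<lambda>n. r n \<omega>) (\<lambda>n. i n \<omega>) m" for \<omega>
  define k where "k \<omega> = (if Suc m = 1 then 1 else i (Suc m) \<omega>)" for \<omega>
  have b [measurable]: "\<And>j. (\<lambda>\<omega>. b \<omega> ! j) \<in> borel_measurable N"
    and len [measurable]: "(\<lambda>\<omega>. length (b \<omega>)) \<in> measurable N (count_space UNIV)"
    using Suc.IH Suc.prems by (auto simp: b_def)
  have [measurable]: "l (Suc m) \<in> borel_measurable N" "r (Suc m) \<in> borel_measurable N"
     "i (Suc m) \<in> measurable N (count_space UNIV)"
    using Suc.prems[of "Suc m"] by auto
  have k [measurable]: "k \<in> measurable N (count_space UNIV)"
    unfolding k_def by (cases "Suc m = 1") (auto simp: k_def)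
  have step: "beta_list (\<lambda>n. l n \<omega>) (\<lambda>n. r n \<omega>) (\<lambda>n. i n \<omega>) (Suc m) =
     take (k \<omega> - 1) (b \<omega>) @ [l (Suc m) \<omega> * b \<omega> ! (k \<omega> - 1), r (Suc m) \<omega> * b \<omega> ! (k \<omega> - 1)] @ drop (k \<omega>) (b \<omega>)" for \<omega>
    by (simp add: b_def k_def Let_def)
  show ?case
  proof (intro conjI allI)
    fix j
    let ?F = "\<lambda>(kk, n) \<omega>. let p = min n (kk - 1) in
     if j < p then b \<omega> ! j else if j = p then l (Suc m) \<omega> * b \<omega> ! (kk - 1) else if j = Suc p then r (Suc m) \<omega> * b \<omega> ! (kk - 1)
     else if kk \<le> n then b \<omega> ! (kk + (j - p - 2)) else [] ! (j - p - 2)"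
    have "(\<lambda>\<omega>. ?F (k \<omega>, length (b \<omega>)) \<omega>) \<in> borel_measurable N"
    proof (rule measurable_compose_countable)
      show "(\<lambda>\<omega>. ?F z \<omega>) \<in> borel_measurable N" for z
        by (cases z) (auto simp: Let_def)
      show "(\<lambda>\<omega>. (k \<omega>, length (b \<omega>))) \<in> measurable N (count_space UNIV)"
        using measurable_Pair[OF k len] by (simp add: pair_measure_countable)
    qed
    then show "(\<lambda>\<omega>. beta_list (\<lambda>n. l n \<omega>) (\<lambda>n. r n \<omega>) (\<lambda>n. i n \<omega>) (Suc m) ! j) \<in> borel_measurable N"
      unfolding step nth_split_step prod.case .
  next
    show "(\<lambda>\<omega>. length (beta_list (\<lambda>n. l n \<omega>) (\<lambda>n. r n \<omega>) (\<lambda>n. i n \<omega>) (Suc m))) \<in> measurable N (count_space UNIV)"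
      unfolding step length_append length_take length_drop list.size by measurable
  qed
qed

lemma beta_list_cong:
  assumes "\<And>n. 1 \<le> n \<Longrightarrow> n \<le> m \<Longrightarrow> l n = l' n \<and> r n = r' n \<and> i n = i' n"
  shows "beta_list l r i m = beta_list l' r' i' m"
  using assms
proof (induction m)
  case (Suc m)
  then have "beta_list l r i m = beta_list l' r' i' m" by simp
  then show ?case using Suc.prems[of "Suc m"] by (simp add: Let_def)
qed simp

lemma length_beta_list:
  assumes "\<And>n. 1 \<le> n \<Longrightarrow> n \<le> m \<Longrightarrow> 1 \<le> i n \<and> i n \<le> n"
  shows "length (beta_list l r i m) = Suc m"
  using assms
proof (induction m)
  case (Suc m)
  then have "length (beta_list l r i m) = Suc m" by simp
  moreover have "1 \<le> i (Suc m)" "i (Suc m) \<le> Suc m" using Suc.prems[of "Suc m"] by auto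
  ultimately show ?case by (auto simp: Let_def min_def)
qed simp

lemma beta_list_nonneg:
  assumes "\<And>n. 1 \<le> n \<Longrightarrow> n \<le> m \<Longrightarrow> 1 \<le> i n \<and> i n \<le> n \<and> 0 \<le> l n \<and> 0 \<le> r n"
  shows "\<forall>x\<in>set (beta_list l r i m). 0 \<le> x"
  using assms
proof (induction m)
  case (Suc m)
  then have IH: "\<forall>x\<in>set (beta_list l r i m). 0 \<le> x" by simp
  have len: "length (beta_list l r i m) = Suc m"
    by (rule length_beta_list) (use Suc.prems in auto)
  define k where "k = (if Suc m = 1 then 1 else i (Suc m))"
  have "1 \<le> k" "k \<le> Suc m" "0 \<le> l (Suc m)" "0 \<le> r (Suc m)" using Suc.prems[of "Suc m"] by (auto simp: k_def)
  then have "0 \<le> beta_list l r i m ! (k - 1)" using IH len by auto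
  then show ?case using IH \<open>0 \<le> l (Suc m)\<close> \<open>0 \<le> r (Suc m)\<close>
    by (auto simp: Let_def k_def dest: in_set_takeD in_set_dropD split: if_splits)
qed simp

text \<open>Stated in a commutative monoid so that it serves both as the product formula for
  transforms and as the sum formula for moments. Entry \<open>i\<close> is replaced by two, and the
  later ones move up by one.\<close>

lemma (in comm_monoid_set) split_step:
  fixes i m :: nat and h g :: "nat \<Rightarrow> 'a"
  assumes "i \<le> m" "\<And>j. j < i \<Longrightarrow> h j = g j" "\<And>j. i < j \<Longrightarrow> j \<le> m \<Longrightarrow> h (Suc j) = g j"
  shows "F h {..Suc m} = (h i \<^bold>* h (Suc i)) \<^bold>* F g ({..m} - {i})"
proof -
  have "{..Suc m} = {..<i} \<union> ({i, Suc i} \<union> {Suc (Suc i)..Suc m})" using assms(1) by auto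
  then have "F h {..Suc m} = F h ({..<i} \<union> ({i, Suc i} \<union> {Suc (Suc i)..Suc m}))" by simp
  also have "\<dots> = F h {..<i} \<^bold>* (F h {i, Suc i} \<^bold>* F h {Suc (Suc i)..Suc m})"
  proof -
    have "F h ({i, Suc i} \<union> {Suc (Suc i)..Suc m}) = F h {i, Suc i} \<^bold>* F h {Suc (Suc i)..Suc m}"
      by (rule union_disjoint) auto
    moreover have "F h ({..<i} \<union> ({i, Suc i} \<union> {Suc (Suc i)..Suc m})) = F h {..<i} \<^bold>* F h ({i, Suc i} \<union> {Suc (Suc i)..Suc m})"
      by (rule union_disjoint) auto
    ultimately show ?thesis by simp
  qed
  also have "F h {i, Suc i} = h i \<^bold>* h (Suc i)" by simp
  also have "F h {..<i} = F g {..<i}" using assms(2) by (intro cong) auto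
  also have "F h {Suc (Suc i)..Suc m} = F g {Suc i..m}"
    unfolding shift_bounds_cl_Suc_ivl using assms(3) by (intro cong) auto
  also have "F g {..<i} \<^bold>* (h i \<^bold>* h (Suc i) \<^bold>* F g {Suc i..m}) = (h i \<^bold>* h (Suc i)) \<^bold>* (F g {..<i} \<^bold>* F g {Suc i..m})"
    by (simp add: ac_simps)
  also have "F g {..<i} \<^bold>* F g {Suc i..m} = F g ({..<i} \<union> {Suc i..m})"
    by (rule union_disjoint[symmetric]) auto
  also have "{..<i} \<union> {Suc i..m} = {..m} - {i}" using assms(1) by auto
  finally show ?thesis .
qed

locale kac_process = smoothing Q a d + prob_space M for Q a d and M :: "'a measure" +
  fixes X H :: "nat \<Rightarrow> 'a \<Rightarrow> real" and LR :: "nat \<Rightarrow> 'a \<Rightarrow> real \<times> real"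
    and I :: "nat \<Rightarrow> 'a \<Rightarrow> nat" and PX :: "real measure"
  assumes indep: "indep_vars (\<lambda>_. borel) (vfam X H LR I) vidx_set"
    and LR_law: "\<And>n. 1 \<le> n \<Longrightarrow> distr M borel (LR n) = Q"
    and I_unif: "\<And>n k. 1 \<le> n \<Longrightarrow> k \<in> {1..n} \<Longrightarrow> prob {\<omega> \<in> space M. I n \<omega> = k} = 1 / real n"
    and H_law: "\<And>k. 1 \<le> k \<Longrightarrow>
                  distr M borel (H k) = density lborel (\<lambda>x. ennreal (exponential_density (real k) x))"
    and X_law: "\<And>j. 1 \<le> j \<Longrightarrow> distr M borel (X j) = PX"
begin

lemma vidx_set_iff [simp]:
  "XI n \<in> vidx_set \<longleftrightarrow> 1 \<le> n" "HI n \<in> vidx_set \<longleftrightarrow> 1 \<le> n" "LRI n \<in> vidx_set \<longleftrightarrow> 1 \<le> n" "II n \<in> vidx_set \<longleftrightarrow> 1 \<le> n"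
  by (auto simp: vidx_set_def)

lemma fam_meas: "i \<in> vidx_set \<Longrightarrow> vfam X H LR I i \<in> borel_measurable M"
  using indep by (auto simp: indep_vars_def)

lemma LR_meas: "1 \<le> n \<Longrightarrow> LR n \<in> borel_measurable M"
  using fam_meas[of "LRI n"] by simp

lemma X_meas: "1 \<le> n \<Longrightarrow> X n \<in> borel_measurable M"
  using measurable_compose[OF fam_meas[of "XI n"] borel_measurable_continuous_onI[OF continuous_on_fst[OF continuous_on_id]]] by simp

lemma H_meas: "1 \<le> n \<Longrightarrow> H n \<in> borel_measurable M"
  using measurable_compose[OF fam_meas[of "HI n"] borel_measurable_continuous_onI[OF continuous_on_fst[OF continuous_on_id]]] by simp

lemma measurable_nat_floor: "(\<lambda>p::real \<times> real. nat \<lfloor>fst p\<rfloor>) \<in> measurable borel (count_space UNIV)"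
proof -
  have "(\<lambda>p::real \<times> real. fst p) \<in> borel_measurable borel"
    by (intro borel_measurable_continuous_onI continuous_intros)
  then have "(\<lambda>p::real \<times> real. \<lfloor>fst p\<rfloor>) \<in> measurable borel (count_space UNIV)"
    by (rule measurable_compose[OF _ measurable_real_floor])
  then show ?thesis by (rule measurable_compose) simp
qed

lemma I_meas: "1 \<le> n \<Longrightarrow> I n \<in> measurable M (count_space UNIV)"
  using measurable_compose[OF fam_meas[of "II n"] measurable_nat_floor] by simp

text \<open>The variables with index in \<open>A\<close> are bundled into one point of a product
  space, so that disjoint index sets give a pair of independent random elements.\<close>

definition rfam :: "vidx set \<Rightarrow> 'a \<Rightarrow> vidx \<Rightarrow> real \<times> real" where
  "rfam A \<omega> = restrict (\<lambda>i. vfam X H LR I i \<omega>) A"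

abbreviation PiA :: "vidx set \<Rightarrow> (vidx \<Rightarrow> real \<times> real) measure" where
  "PiA A \<equiv> PiM A (\<lambda>_. borel)"

lemma rfam_meas: "A \<subseteq> vidx_set \<Longrightarrow> rfam A \<in> measurable M (PiA A)"
  unfolding rfam_def by (intro measurable_restrict fam_meas) auto

lemma indep_rfam: "A \<inter> B = {} \<Longrightarrow> A \<subseteq> vidx_set \<Longrightarrow> B \<subseteq> vidx_set \<Longrightarrow> indep_var (PiA A) (rfam A) (PiA B) (rfam B)"
  unfolding rfam_def by (rule indep_var_restrict[OF indep])

lemma proj_meas: "i \<in> A \<Longrightarrow> (\<lambda>y. y i) \<in> measurable (PiA A) borel"
  by (rule measurable_component_singleton)

definition past :: "nat \<Rightarrow> vidx set" where
  "past m = LRI ` {1..m} \<union> II ` {1..m}"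

lemma past_subset: "past m \<subseteq> vidx_set"
  by (auto simp: past_def)

text \<open>The weights as a function of the bundled variables. The splitting index is stored there
  as a real number in the first component and recovered by \<open>nat\<close> of the floor.\<close>

definition bl :: "(vidx \<Rightarrow> real \<times> real) \<Rightarrow> nat \<Rightarrow> real list" where
  "bl y m = beta_list (\<lambda>n. fst (y (LRI n))) (\<lambda>n. snd (y (LRI n))) (\<lambda>n. nat \<lfloor>fst (y (II n))\<rfloor>) m"

definition B :: "nat \<Rightarrow> 'a \<Rightarrow> real list" where
  "B m \<omega> = beta_list (\<lambda>n. fst (LR n \<omega>)) (\<lambda>n. snd (LR n \<omega>)) (\<lambda>n. I n \<omega>) m"

lemma bl_meas: "past m \<subseteq> A \<Longrightarrow> (\<lambda>y. bl y m ! j) \<in> borel_measurable (PiA A)"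
proof -
  assume A: "past m \<subseteq> A"
  have cf: "continuous_on UNIV (fst :: real \<times> real \<Rightarrow> real)" "continuous_on UNIV (snd :: real \<times> real \<Rightarrow> real)"
    by (intro continuous_intros)+
  have "(\<lambda>y. beta_list (\<lambda>n. fst (y (LRI n))) (\<lambda>n. snd (y (LRI n))) (\<lambda>n. nat \<lfloor>fst (y (II n))\<rfloor>) m ! j) \<in> borel_measurable (PiA A)"
  proof (rule measurable_beta_list[THEN conjunct1, rule_format])
    fix n assume "1 \<le> n" "n \<le> m"
    then have i: "LRI n \<in> A" "II n \<in> A" using A by (auto simp: past_def)
    show "(\<lambda>y. fst (y (LRI n))) \<in> borel_measurable (PiA A)" "(\<lambda>y. snd (y (LRI n))) \<in> borel_measurable (PiA A)"
      by (intro measurable_compose[OF proj_meas[OF i(1)] borel_measurable_continuous_onI] cf)+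
    show "(\<lambda>y. nat \<lfloor>fst (y (II n))\<rfloor>) \<in> measurable (PiA A) (count_space UNIV)"
      by (rule measurable_compose[OF proj_meas[OF i(2)] measurable_nat_floor])
  qed
  then show ?thesis by (simp only: bl_def)
qed

lemma bl_rfam: "past m \<subseteq> A \<Longrightarrow> bl (rfam A \<omega>) m = B m \<omega>"
  unfolding bl_def B_def
proof (rule beta_list_cong)
  fix n assume "past m \<subseteq> A" "1 \<le> n" "n \<le> m"
  then have "LRI n \<in> A" "II n \<in> A" by (auto simp: past_def)
  then show "fst (rfam A \<omega> (LRI n)) = fst (LR n \<omega>) \<and> snd (rfam A \<omega> (LRI n)) = snd (LR n \<omega>) \<and>
    nat \<lfloor>fst (rfam A \<omega> (II n))\<rfloor> = I n \<omega>"
    by (simp add: rfam_def)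
qed

lemma B_meas: "(\<lambda>\<omega>. B m \<omega> ! j) \<in> borel_measurable M"
  using measurable_compose[OF rfam_meas[OF past_subset[of m]] bl_meas[OF subset_refl, of m j]] by (simp only: bl_rfam[OF subset_refl])

lemma AE_I_range:
  assumes "1 \<le> n"
  shows "AE \<omega> in M. 1 \<le> I n \<omega> \<and> I n \<omega> \<le> n"
proof -
  note [measurable] = I_meas[OF assms]
  have "{\<omega> \<in> space M. 1 \<le> I n \<omega> \<and> I n \<omega> \<le> n} = (\<Union>k\<in>{1..n}. {\<omega> \<in> space M. I n \<omega> = k})" by auto
  then have "prob {\<omega> \<in> space M. 1 \<le> I n \<omega> \<and> I n \<omega> \<le> n} = prob (\<Union>k\<in>{1..n}. {\<omega> \<in> space M. I n \<omega> = k})" by simp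
  also have "\<dots> = (\<Sum>k\<in>{1..n}. prob {\<omega> \<in> space M. I n \<omega> = k})"
    by (rule finite_measure_finite_Union) (auto simp: disjoint_family_on_def)
  also have "\<dots> = (\<Sum>k\<in>{1..n}. 1 / real n)" by (intro sum.cong refl I_unif assms)
  also have "\<dots> = 1" using assms by simp
  finally show ?thesis by (subst (asm) prob_Collect_eq_1) auto
qed

lemma AE_LR_nonneg:
  assumes "1 \<le> n"
  shows "AE \<omega> in M. 0 \<le> fst (LR n \<omega>) \<and> 0 \<le> snd (LR n \<omega>)"
proof -
  have "AE p in distr M borel (LR n). 0 \<le> fst p \<and> 0 \<le> snd p"
    using nonneg_Q unfolding LR_law[OF assms] .
  then show ?thesis by (rule AE_distrD[OF LR_meas[OF assms]])
qed

lemma AE_good: "AE \<omega> in M. \<forall>n\<ge>1. 1 \<le> I n \<omega> \<and> I n \<omega> \<le> n \<and> 0 \<le> fst (LR n \<omega>) \<and> 0 \<le> snd (LR n \<omega>)"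
  unfolding AE_all_countable
proof
  fix n show "AE \<omega> in M. 1 \<le> n \<longrightarrow> 1 \<le> I n \<omega> \<and> I n \<omega> \<le> n \<and> 0 \<le> fst (LR n \<omega>) \<and> 0 \<le> snd (LR n \<omega>)"
  proof (cases "1 \<le> n")
    case True
    show ?thesis using AE_I_range[OF True] AE_LR_nonneg[OF True] by eventually_elim auto
  qed simp
qed

text \<open>A kernel \<open>\<Psi>\<close> of the past and the fresh pair occurs in these four
  shapes when independence is used twice; joint measurability of \<open>\<Psi>\<close> yields all of
  them.\<close>

lemma step_measurable:
  assumes \<Psi>: "(\<lambda>z. \<Psi> (fst z) (snd z)) \<in> measurable (PiA (past m) \<Otimes>\<^sub>M borel) N" and n: "1 \<le> n"
  shows "(\<lambda>\<omega>. \<Psi> (rfam (past m) \<omega>) (LR n \<omega>)) \<in> measurable M N"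
    and "(\<lambda>z. \<Psi> (restrict (snd z) (past m)) (snd z (LRI n))) \<in> measurable (PiA A \<Otimes>\<^sub>M PiA (insert (LRI n) (past m))) N"
    and "(\<lambda>z. \<Psi> (fst z) (snd z (LRI n))) \<in> measurable (PiA (past m) \<Otimes>\<^sub>M PiA {LRI n}) N"
    and "\<omega> \<in> space M \<Longrightarrow> (\<lambda>p. \<Psi> (rfam (past m) \<omega>) p) \<in> measurable borel N"
proof -
  show "(\<lambda>\<omega>. \<Psi> (rfam (past m) \<omega>) (LR n \<omega>)) \<in> measurable M N"
    using measurable_compose[OF measurable_Pair[OF rfam_meas[OF past_subset[of m]] LR_meas[OF n]] \<Psi>] by simp
  have "(\<lambda>z. (restrict (snd z) (past m), snd z (LRI n))) \<in> measurable (PiA A \<Otimes>\<^sub>M PiA (insert (LRI n) (past m))) (PiA (past m) \<Otimes>\<^sub>M borel)"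
    by (intro measurable_Pair measurable_compose[OF measurable_snd measurable_restrict_subset] measurable_compose[OF measurable_snd proj_meas]) auto
  from measurable_compose[OF this \<Psi>]
  show "(\<lambda>z. \<Psi> (restrict (snd z) (past m)) (snd z (LRI n))) \<in> measurable (PiA A \<Otimes>\<^sub>M PiA (insert (LRI n) (past m))) N" by simp
  have "(\<lambda>z. (fst z, snd z (LRI n))) \<in> measurable (PiA (past m) \<Otimes>\<^sub>M PiA {LRI n}) (PiA (past m) \<Otimes>\<^sub>M borel)"
    by (intro measurable_Pair measurable_fst measurable_compose[OF measurable_snd proj_meas]) auto
  from measurable_compose[OF this \<Psi>]
  show "(\<lambda>z. \<Psi> (fst z) (snd z (LRI n))) \<in> measurable (PiA (past m) \<Otimes>\<^sub>M PiA {LRI n}) N" by simp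
  assume "\<omega> \<in> space M"
  then have sp: "rfam (past m) \<omega> \<in> space (PiA (past m))" by (rule measurable_space[OF rfam_meas[OF past_subset]])
  show "(\<lambda>p. \<Psi> (rfam (past m) \<omega>) p) \<in> measurable borel N"
    using measurable_compose[OF measurable_Pair1'[OF sp] \<Psi>] by simp
qed

lemma measurable_index: "(\<lambda>z. nat \<lfloor>fst (fst z (II n))\<rfloor>) \<in> measurable (PiA {II n} \<Otimes>\<^sub>M N) (count_space UNIV)"
  by (rule measurable_compose[OF measurable_compose[OF measurable_fst proj_meas] measurable_nat_floor]) simp

lemma rfam_step:
  "rfam {II n} \<omega> (II n) = (real (I n \<omega>), 0)"
  "restrict (rfam (insert (LRI n) (past m)) \<omega>) (past m) = rfam (past m) \<omega>"
  "rfam (insert (LRI n) (past m)) \<omega> (LRI n) = LR n \<omega>"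
  "rfam {LRI n} \<omega> (LRI n) = LR n \<omega>"
  by (auto simp: rfam_def restrict_def fun_eq_iff)

text \<open>Two uses of independence: the splitting index is independent of the past and the fresh
  pair together, which yields the factor \<open>1 / real (Suc m)\<close>; the pair is independent of
  the past, so it can be integrated against \<open>Q\<close> with the past frozen.\<close>

lemma step_complex:
  fixes \<Psi> :: "nat \<Rightarrow> (vidx \<Rightarrow> real \<times> real) \<Rightarrow> real \<times> real \<Rightarrow> complex"
  assumes \<Psi>: "\<And>i. i \<le> m \<Longrightarrow> (\<lambda>z. \<Psi> i (fst z) (snd z)) \<in> borel_measurable (PiA (past m) \<Otimes>\<^sub>M borel)"
    and \<Psi>1: "\<And>i y p. norm (\<Psi> i y p) \<le> 1"
    and h: "h \<in> borel_measurable M"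
      "AE \<omega> in M. h \<omega> = (\<Sum>i\<le>m. indicator {Suc i} (I (Suc m) \<omega>) * \<Psi> i (rfam (past m) \<omega>) (LR (Suc m) \<omega>))"
  shows "(CLINT \<omega>|M. h \<omega>) = (1 / real (Suc m)) *\<^sub>R (CLINT \<omega>|M. (\<Sum>i\<le>m. (CLINT p|Q. \<Psi> i (rfam (past m) \<omega>) p)))"
proof -
  let ?n = "Suc m"
  have LRm: "LR ?n \<in> borel_measurable M" and Im: "I ?n \<in> measurable M (count_space UNIV)"
    by (rule LR_meas, simp, rule I_meas, simp)
  let ?A = "{II ?n}" let ?B = "insert (LRI ?n) (past m)"
  have sub: "?A \<subseteq> vidx_set" "?B \<subseteq> vidx_set" "{LRI ?n} \<subseteq> vidx_set" using past_subset[of m] by auto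
  have disj: "?A \<inter> ?B = {}" "past m \<inter> {LRI ?n} = {}" by (auto simp: past_def)
  have \<Psi>M: "(\<lambda>\<omega>. \<Psi> i (rfam (past m) \<omega>) (LR ?n \<omega>)) \<in> borel_measurable M" if "i \<le> m" for i
    by (rule step_measurable(1)[OF \<Psi>[OF that]]) simp
  have int: "complex_integrable M (\<lambda>\<omega>. indicator {Suc i} (I ?n \<omega>) * \<Psi> i (rfam (past m) \<omega>) (LR ?n \<omega>))" if "i \<le> m" for i
  proof (rule integrable_const_bound[where B = 1])
    show "AE \<omega> in M. norm (indicator {Suc i} (I ?n \<omega>) * \<Psi> i (rfam (past m) \<omega>) (LR ?n \<omega>)) \<le> 1"
      using \<Psi>1 by (auto simp: indicator_def)
    show "(\<lambda>\<omega>. indicator {Suc i} (I ?n \<omega>) * \<Psi> i (rfam (past m) \<omega>) (LR ?n \<omega>)) \<in> borel_measurable M"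
      by (intro borel_measurable_times \<Psi>M[OF that] measurable_compose[OF Im, where g = "indicator {Suc i}"]) simp
  qed
  have term_eq: "(CLINT \<omega>|M. indicator {Suc i} (I ?n \<omega>) * \<Psi> i (rfam (past m) \<omega>) (LR ?n \<omega>)) =
      (1 / real ?n) *\<^sub>R (CLINT \<omega>|M. (CLINT p|Q. \<Psi> i (rfam (past m) \<omega>) p))" if i: "i \<le> m" for i
  proof -
    let ?f = "\<lambda>z. indicator {Suc i} (nat \<lfloor>fst (fst z (II ?n))\<rfloor>) * \<Psi> i (restrict (snd z) (past m)) (snd z (LRI ?n))"
    have f_meas: "?f \<in> borel_measurable (PiA ?A \<Otimes>\<^sub>M PiA ?B)"
    proof (rule borel_measurable_times)
      show "(\<lambda>z. indicator {Suc i} (nat \<lfloor>fst (fst z (II ?n))\<rfloor>) :: complex) \<in> borel_measurable (PiA ?A \<Otimes>\<^sub>M PiA ?B)"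
        by (rule measurable_compose[OF measurable_index]) simp
      show "(\<lambda>z. \<Psi> i (restrict (snd z) (past m)) (snd z (LRI ?n))) \<in> borel_measurable (PiA ?A \<Otimes>\<^sub>M PiA ?B)"
        by (rule step_measurable(2)[OF \<Psi>[OF i]]) simp
    qed
    have f1: "norm (?f z) \<le> 1" for z using \<Psi>1 by (auto simp: indicator_def)
    note r = rfam_step
    have "(CLINT \<omega>|M. indicator {Suc i} (I ?n \<omega>) * \<Psi> i (rfam (past m) \<omega>) (LR ?n \<omega>)) = (CLINT \<omega>|M. ?f (rfam ?A \<omega>, rfam ?B \<omega>))"
      by (simp only: fst_conv snd_conv r) simp
    also have "\<dots> = (CLINT \<omega>|M. (CLINT \<omega>'|M. ?f (rfam ?A \<omega>, rfam ?B \<omega>')))"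
      by (rule indep_var_double_integral[OF indep_rfam[OF disj(1) sub(1,2)] f_meas f1])
    also have "\<dots> = (CLINT \<omega>|M. indicator {Suc i} (I ?n \<omega>) * (CLINT \<omega>'|M. \<Psi> i (rfam (past m) \<omega>') (LR ?n \<omega>')))"
      by (simp only: fst_conv snd_conv r Bochner_Integration.integral_mult_right_zero) simp
    also have "\<dots> = (CLINT \<omega>|M. indicator {Suc i} (I ?n \<omega>)) * (CLINT \<omega>'|M. \<Psi> i (rfam (past m) \<omega>') (LR ?n \<omega>'))"
      by (rule Bochner_Integration.integral_mult_left_zero)
    also have "(CLINT \<omega>|M. indicator {Suc i} (I ?n \<omega>)) = (CLINT \<omega>|M. complex_of_real (indicator {\<omega> \<in> space M. I ?n \<omega> = Suc i} \<omega>))"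
      by (intro Bochner_Integration.integral_cong) (auto simp: indicator_def)
    also have "\<dots> = complex_of_real (prob {\<omega> \<in> space M. I ?n \<omega> = Suc i})"
    proof -
      have "{\<omega> \<in> space M. I ?n \<omega> = Suc i} \<inter> space M = {\<omega> \<in> space M. I ?n \<omega> = Suc i}" by auto
      then show ?thesis by (subst integral_complex_of_real) simp
    qed
    also have "prob {\<omega> \<in> space M. I ?n \<omega> = Suc i} = 1 / real ?n"
      by (rule I_unif) (use i in auto)
    also have "(CLINT \<omega>'|M. \<Psi> i (rfam (past m) \<omega>') (LR ?n \<omega>')) = (CLINT \<omega>|M. (CLINT \<omega>'|M. \<Psi> i (rfam (past m) \<omega>) (LR ?n \<omega>')))"
    proof -
      let ?g = "\<lambda>z. \<Psi> i (fst z) (snd z (LRI ?n))"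
      have g: "?g \<in> borel_measurable (PiA (past m) \<Otimes>\<^sub>M PiA {LRI ?n})"
        by (rule step_measurable(3)[OF \<Psi>[OF i]]) simp
      from indep_var_double_integral[OF indep_rfam[OF disj(2) past_subset sub(3)] g, of 1]
      show ?thesis using \<Psi>1 by (simp add: rfam_step)
    qed
    also have "\<dots> = (CLINT \<omega>|M. (CLINT p|Q. \<Psi> i (rfam (past m) \<omega>) p))"
    proof (rule Bochner_Integration.integral_cong[OF refl])
      fix \<omega> assume "\<omega> \<in> space M"
      then have "(\<lambda>p. \<Psi> i (rfam (past m) \<omega>) p) \<in> borel_measurable borel"
        by (intro step_measurable(4)[OF \<Psi>[OF i], of ?n]) simp_all
      from integral_distr[OF LRm this]
      show "(CLINT \<omega>'|M. \<Psi> i (rfam (past m) \<omega>) (LR ?n \<omega>')) = (CLINT p|Q. \<Psi> i (rfam (past m) \<omega>) p)"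
        by (simp add: LR_law)
    qed
    finally show ?thesis by (simp add: scaleR_conv_of_real)
  qed
  have intQ: "complex_integrable M (\<lambda>\<omega>. (CLINT p|Q. \<Psi> i (rfam (past m) \<omega>) p))" if i: "i \<le> m" for i
  proof (rule integrable_const_bound[where B = 1])
    show "AE \<omega> in M. norm (CLINT p|Q. \<Psi> i (rfam (past m) \<omega>) p) \<le> 1"
    proof (rule AE_I2)
      fix \<omega> assume "\<omega> \<in> space M"
      then have m: "(\<lambda>p. \<Psi> i (rfam (past m) \<omega>) p) \<in> borel_measurable borel"
        by (intro step_measurable(4)[OF \<Psi>[OF i], of ?n]) simp_all
      have m': "(\<lambda>p. \<Psi> i (rfam (past m) \<omega>) p) \<in> borel_measurable Q"
        using m by (simp cong: measurable_cong_sets add: sets_Q)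
      have "norm (CLINT p|Q. \<Psi> i (rfam (past m) \<omega>) p) \<le> (LINT p|Q. norm (\<Psi> i (rfam (past m) \<omega>) p))"
        by (rule integral_norm_bound)
      also have "\<dots> \<le> (LINT p|Q. 1)"
        by (intro integral_mono \<Psi>1 integrable_norm Q.integrable_const_bound[where B = 1] AE_I2 m') simp_all
      finally show "norm (CLINT p|Q. \<Psi> i (rfam (past m) \<omega>) p) \<le> 1" using Q.prob_space by simp
    qed
    have "(\<lambda>z. \<Psi> i (fst z) (snd z)) \<in> borel_measurable (PiA (past m) \<Otimes>\<^sub>M Q)"
      using \<Psi>[OF i] by (simp cong: measurable_cong_sets sets_pair_measure_cong add: sets_Q)
    then have "(\<lambda>y. (CLINT p|Q. \<Psi> i y p)) \<in> borel_measurable (PiA (past m))"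
      by (intro Q.borel_measurable_lebesgue_integral) (simp add: case_prod_beta')
    from measurable_compose[OF rfam_meas[OF past_subset] this]
    show "(\<lambda>\<omega>. (CLINT p|Q. \<Psi> i (rfam (past m) \<omega>) p)) \<in> borel_measurable M" .
  qed
  have "(CLINT \<omega>|M. h \<omega>) = (CLINT \<omega>|M. (\<Sum>i\<le>m. indicator {Suc i} (I ?n \<omega>) * \<Psi> i (rfam (past m) \<omega>) (LR ?n \<omega>)))"
    by (rule integral_cong_AE[OF h(1) _ h(2)]) (intro borel_measurable_sum borel_measurable_integrable int, simp)
  also have "\<dots> = (\<Sum>i\<le>m. (CLINT \<omega>|M. indicator {Suc i} (I ?n \<omega>) * \<Psi> i (rfam (past m) \<omega>) (LR ?n \<omega>)))"
    by (rule Bochner_Integration.integral_sum) (use int in auto)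
  also have "\<dots> = (\<Sum>i\<le>m. (1 / real ?n) *\<^sub>R (CLINT \<omega>|M. (CLINT p|Q. \<Psi> i (rfam (past m) \<omega>) p)))"
    by (intro sum.cong refl term_eq) simp
  also have "\<dots> = (1 / real ?n) *\<^sub>R (\<Sum>i\<le>m. (CLINT \<omega>|M. (CLINT p|Q. \<Psi> i (rfam (past m) \<omega>) p)))"
    by (rule scaleR_sum_right[symmetric])
  also have "(\<Sum>i\<le>m. (CLINT \<omega>|M. (CLINT p|Q. \<Psi> i (rfam (past m) \<omega>) p))) = (CLINT \<omega>|M. (\<Sum>i\<le>m. (CLINT p|Q. \<Psi> i (rfam (past m) \<omega>) p)))"
    by (rule Bochner_Integration.integral_sum[symmetric]) (use intQ in auto)
  finally show ?thesis .
qed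


text \<open>The version for nonnegative kernels serves the moments, whose finiteness is a result of
  the recursion and not known beforehand.\<close>

lemma step_nn:
  fixes \<Psi> :: "nat \<Rightarrow> (vidx \<Rightarrow> real \<times> real) \<Rightarrow> real \<times> real \<Rightarrow> ennreal"
  assumes \<Psi>: "\<And>i. i \<le> m \<Longrightarrow> (\<lambda>z. \<Psi> i (fst z) (snd z)) \<in> borel_measurable (PiA (past m) \<Otimes>\<^sub>M borel)"
    and h: "AE \<omega> in M. h \<omega> = (\<Sum>i\<le>m. indicator {Suc i} (I (Suc m) \<omega>) * \<Psi> i (rfam (past m) \<omega>) (LR (Suc m) \<omega>))"
  shows "(\<integral>\<^sup>+\<omega>. h \<omega> \<partial>M) = ennreal (1 / real (Suc m)) * (\<integral>\<^sup>+\<omega>. (\<Sum>i\<le>m. (\<integral>\<^sup>+p. \<Psi> i (rfam (past m) \<omega>) p \<partial>Q)) \<partial>M)"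
proof -
  let ?n = "Suc m"
  have LRm: "LR ?n \<in> borel_measurable M" and Im: "I ?n \<in> measurable M (count_space UNIV)"
    by (rule LR_meas, simp, rule I_meas, simp)
  let ?A = "{II ?n}" let ?B = "insert (LRI ?n) (past m)"
  have sub: "?A \<subseteq> vidx_set" "?B \<subseteq> vidx_set" "{LRI ?n} \<subseteq> vidx_set" using past_subset[of m] by auto
  have disj: "?A \<inter> ?B = {}" "past m \<inter> {LRI ?n} = {}" by (auto simp: past_def)
  have \<Psi>M: "(\<lambda>\<omega>. \<Psi> i (rfam (past m) \<omega>) (LR ?n \<omega>)) \<in> borel_measurable M" if "i \<le> m" for i
    by (rule step_measurable(1)[OF \<Psi>[OF that]]) simp
  have meas: "(\<lambda>\<omega>. indicator {Suc i} (I ?n \<omega>) * \<Psi> i (rfam (past m) \<omega>) (LR ?n \<omega>)) \<in> borel_measurable M" if "i \<le> m" for i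
    by (intro borel_measurable_times_ennreal \<Psi>M[OF that] measurable_compose[OF Im, where g = "indicator {Suc i}"]) simp
  have term_eq: "(\<integral>\<^sup>+\<omega>. indicator {Suc i} (I ?n \<omega>) * \<Psi> i (rfam (past m) \<omega>) (LR ?n \<omega>) \<partial>M) =
      ennreal (1 / real ?n) * (\<integral>\<^sup>+\<omega>. (\<integral>\<^sup>+p. \<Psi> i (rfam (past m) \<omega>) p \<partial>Q) \<partial>M)" if i: "i \<le> m" for i
  proof -
    let ?f = "\<lambda>z. indicator {Suc i} (nat \<lfloor>fst (fst z (II ?n))\<rfloor>) * \<Psi> i (restrict (snd z) (past m)) (snd z (LRI ?n))"
    have f_meas: "?f \<in> borel_measurable (PiA ?A \<Otimes>\<^sub>M PiA ?B)"
    proof (rule borel_measurable_times_ennreal)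
      show "(\<lambda>z. indicator {Suc i} (nat \<lfloor>fst (fst z (II ?n))\<rfloor>) :: ennreal) \<in> borel_measurable (PiA ?A \<Otimes>\<^sub>M PiA ?B)"
        by (rule measurable_compose[OF measurable_index]) simp
      show "(\<lambda>z. \<Psi> i (restrict (snd z) (past m)) (snd z (LRI ?n))) \<in> borel_measurable (PiA ?A \<Otimes>\<^sub>M PiA ?B)"
        by (rule step_measurable(2)[OF \<Psi>[OF i]]) simp
    qed
    note r = rfam_step
    have "(\<integral>\<^sup>+\<omega>. indicator {Suc i} (I ?n \<omega>) * \<Psi> i (rfam (past m) \<omega>) (LR ?n \<omega>) \<partial>M) = (\<integral>\<^sup>+\<omega>. ?f (rfam ?A \<omega>, rfam ?B \<omega>) \<partial>M)"
      by (simp only: fst_conv snd_conv r) simp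
    also have "\<dots> = (\<integral>\<^sup>+\<omega>. (\<integral>\<^sup>+\<omega>'. ?f (rfam ?A \<omega>, rfam ?B \<omega>') \<partial>M) \<partial>M)"
      by (rule indep_var_double_nn_integral[OF indep_rfam[OF disj(1) sub(1,2)] f_meas])
    also have "\<dots> = (\<integral>\<^sup>+\<omega>. indicator {Suc i} (I ?n \<omega>) * (\<integral>\<^sup>+\<omega>'. \<Psi> i (rfam (past m) \<omega>') (LR ?n \<omega>') \<partial>M) \<partial>M)"
      by (simp only: fst_conv snd_conv r nn_integral_cmult[OF \<Psi>M[OF i]]) simp
    also have "\<dots> = (\<integral>\<^sup>+\<omega>. indicator {Suc i} (I ?n \<omega>) \<partial>M) * (\<integral>\<^sup>+\<omega>'. \<Psi> i (rfam (past m) \<omega>') (LR ?n \<omega>') \<partial>M)"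
      by (rule nn_integral_multc) (rule measurable_compose[OF Im], simp)
    also have "(\<integral>\<^sup>+\<omega>. indicator {Suc i} (I ?n \<omega>) \<partial>M) = (\<integral>\<^sup>+\<omega>. indicator {\<omega> \<in> space M. I ?n \<omega> = Suc i} \<omega> \<partial>M)"
      by (intro nn_integral_cong) (auto simp: indicator_def)
    also have "\<dots> = emeasure M {\<omega> \<in> space M. I ?n \<omega> = Suc i}"
      by (rule nn_integral_indicator) (use Im in measurable)
    also have "\<dots> = ennreal (1 / real ?n)"
      unfolding emeasure_eq_measure by (subst I_unif) (use i in auto)
    also have "(\<integral>\<^sup>+\<omega>'. \<Psi> i (rfam (past m) \<omega>') (LR ?n \<omega>') \<partial>M) = (\<integral>\<^sup>+\<omega>. (\<integral>\<^sup>+\<omega>'. \<Psi> i (rfam (past m) \<omega>) (LR ?n \<omega>') \<partial>M) \<partial>M)"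
    proof -
      let ?g = "\<lambda>z. \<Psi> i (fst z) (snd z (LRI ?n))"
      have g: "?g \<in> borel_measurable (PiA (past m) \<Otimes>\<^sub>M PiA {LRI ?n})"
        by (rule step_measurable(3)[OF \<Psi>[OF i]]) simp
      from indep_var_double_nn_integral[OF indep_rfam[OF disj(2) past_subset sub(3)] g]
      show ?thesis by (simp add: rfam_step)
    qed
    also have "\<dots> = (\<integral>\<^sup>+\<omega>. (\<integral>\<^sup>+p. \<Psi> i (rfam (past m) \<omega>) p \<partial>Q) \<partial>M)"
    proof (rule nn_integral_cong)
      fix \<omega> assume "\<omega> \<in> space M"
      then have "(\<lambda>p. \<Psi> i (rfam (past m) \<omega>) p) \<in> borel_measurable borel"
        by (intro step_measurable(4)[OF \<Psi>[OF i], of ?n]) simp_all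
      then have "(\<lambda>p. \<Psi> i (rfam (past m) \<omega>) p) \<in> borel_measurable (distr M borel (LR ?n))" by simp
      from nn_integral_distr[OF LRm this]
      show "(\<integral>\<^sup>+\<omega>'. \<Psi> i (rfam (past m) \<omega>) (LR ?n \<omega>') \<partial>M) = (\<integral>\<^sup>+p. \<Psi> i (rfam (past m) \<omega>) p \<partial>Q)"
        by (simp add: LR_law)
    qed
    finally show ?thesis .
  qed
  have measQ: "(\<lambda>\<omega>. (\<integral>\<^sup>+p. \<Psi> i (rfam (past m) \<omega>) p \<partial>Q)) \<in> borel_measurable M" if i: "i \<le> m" for i
  proof -
    have "(\<lambda>z. \<Psi> i (fst z) (snd z)) \<in> borel_measurable (PiA (past m) \<Otimes>\<^sub>M Q)"
      using \<Psi>[OF i] by (simp cong: measurable_cong_sets sets_pair_measure_cong add: sets_Q)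
    then have "(\<lambda>y. (\<integral>\<^sup>+p. \<Psi> i y p \<partial>Q)) \<in> borel_measurable (PiA (past m))"
      by (intro Q.borel_measurable_nn_integral) (simp add: case_prod_beta')
    from measurable_compose[OF rfam_meas[OF past_subset] this]
    show "(\<lambda>\<omega>. (\<integral>\<^sup>+p. \<Psi> i (rfam (past m) \<omega>) p \<partial>Q)) \<in> borel_measurable M" .
  qed
  have "(\<integral>\<^sup>+\<omega>. h \<omega> \<partial>M) = (\<integral>\<^sup>+\<omega>. (\<Sum>i\<le>m. indicator {Suc i} (I ?n \<omega>) * \<Psi> i (rfam (past m) \<omega>) (LR ?n \<omega>)) \<partial>M)"
    by (rule nn_integral_cong_AE[OF h])
  also have "\<dots> = (\<Sum>i\<le>m. (\<integral>\<^sup>+\<omega>. indicator {Suc i} (I ?n \<omega>) * \<Psi> i (rfam (past m) \<omega>) (LR ?n \<omega>) \<partial>M))"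
    by (rule nn_integral_sum) (use meas in auto)
  also have "\<dots> = (\<Sum>i\<le>m. ennreal (1 / real ?n) * (\<integral>\<^sup>+\<omega>. (\<integral>\<^sup>+p. \<Psi> i (rfam (past m) \<omega>) p \<partial>Q) \<partial>M))"
    by (intro sum.cong refl term_eq) simp
  also have "\<dots> = ennreal (1 / real ?n) * (\<Sum>i\<le>m. (\<integral>\<^sup>+\<omega>. (\<integral>\<^sup>+p. \<Psi> i (rfam (past m) \<omega>) p \<partial>Q) \<partial>M))"
    by (rule sum_distrib_left[symmetric])
  also have "(\<Sum>i\<le>m. (\<integral>\<^sup>+\<omega>. (\<integral>\<^sup>+p. \<Psi> i (rfam (past m) \<omega>) p \<partial>Q) \<partial>M)) = (\<integral>\<^sup>+\<omega>. (\<Sum>i\<le>m. (\<integral>\<^sup>+p. \<Psi> i (rfam (past m) \<omega>) p \<partial>Q)) \<partial>M)"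
    by (rule nn_integral_sum[symmetric]) (use measQ in auto)
  finally show ?thesis .
qed

end

lemma beta_list_step_nth:
  assumes "length (beta_list l r i m) = Suc m" "1 \<le> i (Suc m)" "i (Suc m) \<le> Suc m"
  defines "k \<equiv> i (Suc m) - 1"
  shows "beta_list l r i (Suc m) ! j =
    (if j < k then beta_list l r i m ! j else if j = k then l (Suc m) * beta_list l r i m ! k
     else if j = Suc k then r (Suc m) * beta_list l r i m ! k else beta_list l r i m ! (j - 1))"
proof -
  \<comment> \<open>The recursion uses index 1 in the first step; the range condition forces
    \<open>i 1 = 1\<close>, so the two descriptions agree for \<open>m = 0\<close>.\<close>
  have i: "(if Suc m = 1 then 1 else i (Suc m)) = Suc k" "Suc k \<le> Suc m"
    using assms(2,3) by (auto simp: k_def)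
  have step: "beta_list l r i (Suc m) = take (Suc k - 1) (beta_list l r i m) @
     [l (Suc m) * beta_list l r i m ! (Suc k - 1), r (Suc m) * beta_list l r i m ! (Suc k - 1)] @ drop (Suc k) (beta_list l r i m)"
    unfolding beta_list.simps Let_def i(1) ..
  have "min (length (beta_list l r i m)) (Suc k - 1) = k" using i(2) assms(1) by simp
  then show ?thesis
    unfolding step nth_split_step Let_def using i(2) assms(1)
    by (auto intro!: arg_cong[where f = "nth (beta_list l r i m)"])
qed

lemma (in comm_monoid_set) beta_list_step:
  fixes g :: "real \<Rightarrow> 'a"
  assumes "length (beta_list l r i m) = Suc m" "i (Suc m) = Suc k" "k \<le> m"
  shows "F (\<lambda>j. g (beta_list l r i (Suc m) ! j)) {..Suc m} =
    (g (l (Suc m) * beta_list l r i m ! k) \<^bold>* g (r (Suc m) * beta_list l r i m ! k)) \<^bold>*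
    F (\<lambda>j. g (beta_list l r i m ! j)) ({..m} - {k})"
proof -
  have n: "beta_list l r i (Suc m) ! j =
    (if j < k then beta_list l r i m ! j else if j = k then l (Suc m) * beta_list l r i m ! k
     else if j = Suc k then r (Suc m) * beta_list l r i m ! k else beta_list l r i m ! (j - 1))" for j
    using beta_list_step_nth[OF assms(1), of j] assms(2,3) by simp
  show ?thesis
    by (subst split_step[OF assms(3), where g = "\<lambda>j. g (beta_list l r i m ! j)"]) (simp_all only: n, simp_all)
qed

lemma sum_indicator_Suc:
  fixes f :: "nat \<Rightarrow> 'b::semiring_1"
  assumes "k \<le> m"
  shows "(\<Sum>i\<le>m. indicator {Suc i} (Suc k) * f i) = f k"
proof -
  have "(\<Sum>i\<le>m. indicator {Suc i} (Suc k) * f i) = (\<Sum>i\<le>m. if i = k then f k else 0)"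
    by (rule sum.cong) (auto simp: indicator_def)
  then show ?thesis using assms by simp
qed

section \<open>One splitting step in the mean\<close>

context kac_process
begin

lemma AE_B_step:
  "AE \<omega> in M. \<exists>k\<le>m. I (Suc m) \<omega> = Suc k \<and> length (B m \<omega>) = Suc m"
  using AE_good
proof eventually_elim
  case (elim \<omega>)
  then have "1 \<le> I (Suc m) \<omega>" "I (Suc m) \<omega> \<le> Suc m" by auto
  moreover have "length (B m \<omega>) = Suc m"
    unfolding B_def by (rule length_beta_list) (use elim in auto)
  ultimately show ?case by (intro exI[of _ "I (Suc m) \<omega> - 1"]) auto
qed

lemma AE_B_nonneg: "AE \<omega> in M. \<forall>j\<le>m. 0 \<le> B m \<omega> ! j"
  using AE_good
proof eventually_elim
  case (elim \<omega>)
  have "length (B m \<omega>) = Suc m"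
    unfolding B_def by (rule length_beta_list) (use elim in auto)
  moreover have "\<forall>x\<in>set (B m \<omega>). 0 \<le> x"
    unfolding B_def by (rule beta_list_nonneg) (use elim in auto)
  ultimately show ?case by (auto simp: less_Suc_eq_le)
qed

lemma bl_pair_meas: "(\<lambda>z. bl (fst z) m ! j) \<in> borel_measurable (PiA (past m) \<Otimes>\<^sub>M N)"
  by (rule measurable_compose[OF measurable_fst bl_meas[OF subset_refl]])

lemma fst_snd_meas: "(fst :: real \<times> real \<Rightarrow> real) \<in> borel_measurable borel" "(snd :: real \<times> real \<Rightarrow> real) \<in> borel_measurable borel"
  by (intro borel_measurable_continuous_onI continuous_intros)+

text \<open>When weight \<open>i\<close> is split, its factor is replaced by \<open>g\<close> at
  \<open>L\<close> and at \<open>R\<close> times that weight; averaging over the pair gives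
  \<open>T g\<close> there, while the other factors are untouched.\<close>

lemma forward_eq:
  assumes g: "g \<in> borel_measurable borel" "\<And>x. norm (g x) \<le> 1"
  shows "(CLINT \<omega>|M. \<Prod>j\<le>Suc m. g (B (Suc m) \<omega> ! j)) =
      (1 / real (Suc m)) *\<^sub>R (CLINT \<omega>|M. \<Sum>i\<le>m. T g (B m \<omega> ! i) * (\<Prod>j\<in>{..m} - {i}. g (B m \<omega> ! j)))"
proof -
  let ?\<Psi> = "\<lambda>i y p. (g (fst p * bl y m ! i) * g (snd p * bl y m ! i)) * (\<Prod>j\<in>{..m} - {i}. g (bl y m ! j))"
  have pr: "norm (\<Prod>j\<in>A. g (f j)) \<le> 1" for A :: "nat set" and f
    unfolding prod_norm[symmetric] by (intro prod_le_1) (use g in auto)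
  have step: "(CLINT \<omega>|M. \<Prod>j\<le>Suc m. g (B (Suc m) \<omega> ! j)) =
    (1 / real (Suc m)) *\<^sub>R (CLINT \<omega>|M. (\<Sum>i\<le>m. (CLINT p|Q. ?\<Psi> i (rfam (past m) \<omega>) p)))"
  proof (rule step_complex)
    fix i
    show "(\<lambda>z. ?\<Psi> i (fst z) (snd z)) \<in> borel_measurable (PiA (past m) \<Otimes>\<^sub>M borel)"
      by (intro borel_measurable_times borel_measurable_prod measurable_compose[OF _ g(1)] bl_pair_meas
            measurable_compose[OF measurable_snd fst_snd_meas(1)] measurable_compose[OF measurable_snd fst_snd_meas(2)])
    fix y p
    have "norm (g (fst p * bl y m ! i)) * norm (g (snd p * bl y m ! i)) * norm (\<Prod>j\<in>{..m} - {i}. g (bl y m ! j)) \<le> 1 * 1 * 1"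
      by (intro mult_mono g pr) auto
    then show "norm (?\<Psi> i y p) \<le> 1" by (simp only: norm_mult)
  next
    show "(\<lambda>\<omega>. \<Prod>j\<le>Suc m. g (B (Suc m) \<omega> ! j)) \<in> borel_measurable M"
      by (intro borel_measurable_prod measurable_compose[OF B_meas g(1)])
    show "AE \<omega> in M. (\<Prod>j\<le>Suc m. g (B (Suc m) \<omega> ! j)) =
       (\<Sum>i\<le>m. indicator {Suc i} (I (Suc m) \<omega>) * ?\<Psi> i (rfam (past m) \<omega>) (LR (Suc m) \<omega>))"
      using AE_B_step[of m]
    proof eventually_elim
      case (elim \<omega>)
      then obtain k where k: "k \<le> m" "I (Suc m) \<omega> = Suc k" "length (B m \<omega>) = Suc m" by auto
      show ?case
        unfolding k(2) sum_indicator_Suc[OF k(1)] bl_rfam[OF subset_refl]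
        unfolding B_def by (rule prod.beta_list_step[where g = "g" and l = "\<lambda>n. fst (LR n \<omega>)" and r = "\<lambda>n. snd (LR n \<omega>)" and i = "\<lambda>n. I n \<omega>" and m = m and k = k])
          (use k in \<open>auto simp: B_def\<close>)
    qed
  qed
  have inner: "(CLINT p|Q. ?\<Psi> i (rfam (past m) \<omega>) p) = T g (B m \<omega> ! i) * (\<Prod>j\<in>{..m} - {i}. g (B m \<omega> ! j))" for i \<omega>
    unfolding bl_rfam[OF subset_refl] T_def by (rule Bochner_Integration.integral_mult_left_zero)
  show ?thesis unfolding step inner ..
qed

text \<open>The split weight has its power multiplied by \<open>1 + S\<close> in the mean, and the
  \<open>m\<close> others stay. Summing over the \<open>Suc m\<close> equally likely indices gives
  the factor \<open>(real (Suc m) + S) / real (Suc m)\<close>.\<close>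

lemma forward_moment_eq:
  assumes s: "(s = 1 \<and> S = a) \<or> (s = d \<and> S = Sd)"
  shows "(\<integral>\<^sup>+\<omega>. (\<Sum>j\<le>Suc m. ennreal (B (Suc m) \<omega> ! j powr s)) \<partial>M) =
      ennreal (1 + S / real (Suc m)) * (\<integral>\<^sup>+\<omega>. (\<Sum>j\<le>m. ennreal (B m \<omega> ! j powr s)) \<partial>M)"
proof -
  let ?e = "\<lambda>x. ennreal (x powr s)"
  let ?\<Psi> = "\<lambda>i y p. (?e (fst p * bl y m ! i) + ?e (snd p * bl y m ! i)) + (\<Sum>j\<in>{..m} - {i}. ?e (bl y m ! j))"
  have em: "?e \<in> borel_measurable borel" by measurable
  have S: "- 1 \<le> S" using s Sd a_gt by auto
  have mom: "(\<integral>\<^sup>+p. ?e (fst p) + ?e (snd p) \<partial>Q) = ennreal (1 + S)"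
  proof -
    have "(\<integral>\<^sup>+p. ?e (fst p) + ?e (snd p) \<partial>Q) = (\<integral>\<^sup>+p. ennreal (fst p powr s + snd p powr s) \<partial>Q)"
      by (intro nn_integral_cong) (simp add: ennreal_plus)
    also have "\<dots> = ennreal (1 + S)"
    proof (cases "s = 1 \<and> S = a")
      case True
      have "(\<integral>\<^sup>+p. ennreal (fst p powr s + snd p powr s) \<partial>Q) = (\<integral>\<^sup>+p. ennreal (fst p + snd p) \<partial>Q)"
        by (rule nn_integral_cong_AE) (use nonneg_Q in eventually_elim, use True in simp)
      also have "\<dots> = ennreal (\<integral>p. fst p + snd p \<partial>Q)"
        by (rule nn_integral_eq_integral[OF int_1]) (use nonneg_Q in eventually_elim, simp)
      finally show ?thesis using True moment_1 by simp
    next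
      case False
      then have sd: "s = d" "S = Sd" using s by auto
      have "(\<integral>\<^sup>+p. ennreal (fst p powr d + snd p powr d) \<partial>Q) = ennreal (\<integral>p. fst p powr d + snd p powr d \<partial>Q)"
        by (rule nn_integral_eq_integral[OF int_d]) simp
      then show ?thesis using sd by (simp add: Sd_def)
    qed
    finally show ?thesis .
  qed
  have "(\<integral>\<^sup>+\<omega>. (\<Sum>j\<le>Suc m. ?e (B (Suc m) \<omega> ! j)) \<partial>M) =
    ennreal (1 / real (Suc m)) * (\<integral>\<^sup>+\<omega>. (\<Sum>i\<le>m. (\<integral>\<^sup>+p. ?\<Psi> i (rfam (past m) \<omega>) p \<partial>Q)) \<partial>M)"
  proof (rule step_nn)
    fix i
    show "(\<lambda>z. ?\<Psi> i (fst z) (snd z)) \<in> borel_measurable (PiA (past m) \<Otimes>\<^sub>M borel)"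
      by (intro borel_measurable_add borel_measurable_sum measurable_compose[OF _ em] borel_measurable_times bl_pair_meas
            measurable_compose[OF measurable_snd fst_snd_meas(1)] measurable_compose[OF measurable_snd fst_snd_meas(2)])
  next
    show "AE \<omega> in M. (\<Sum>j\<le>Suc m. ?e (B (Suc m) \<omega> ! j)) =
       (\<Sum>i\<le>m. indicator {Suc i} (I (Suc m) \<omega>) * ?\<Psi> i (rfam (past m) \<omega>) (LR (Suc m) \<omega>))"
      using AE_B_step[of m]
    proof eventually_elim
      case (elim \<omega>)
      then obtain k where k: "k \<le> m" "I (Suc m) \<omega> = Suc k" "length (B m \<omega>) = Suc m" by auto
      show ?case
        unfolding k(2) sum_indicator_Suc[OF k(1)] bl_rfam[OF subset_refl]
        unfolding B_def by (rule sum.beta_list_step[where g = "?e" and l = "\<lambda>n. fst (LR n \<omega>)" and r = "\<lambda>n. snd (LR n \<omega>)" and i = "\<lambda>n. I n \<omega>" and m = m and k = k])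
          (use k in \<open>auto simp: B_def\<close>)
    qed
  qed
  also have "(\<integral>\<^sup>+\<omega>. (\<Sum>i\<le>m. (\<integral>\<^sup>+p. ?\<Psi> i (rfam (past m) \<omega>) p \<partial>Q)) \<partial>M) =
     (\<integral>\<^sup>+\<omega>. ennreal (real (Suc m) + S) * (\<Sum>j\<le>m. ?e (B m \<omega> ! j)) \<partial>M)"
  proof (rule nn_integral_cong)
    fix \<omega>
    let ?b = "\<lambda>j. B m \<omega> ! j"
    have "(\<integral>\<^sup>+p. ?\<Psi> i (rfam (past m) \<omega>) p \<partial>Q) = ennreal (1 + S) * ?e (?b i) + (\<Sum>j\<in>{..m} - {i}. ?e (?b j))" for i
    proof -
      have "(\<integral>\<^sup>+p. ?\<Psi> i (rfam (past m) \<omega>) p \<partial>Q) = (\<integral>\<^sup>+p. (?e (fst p) + ?e (snd p)) * ?e (?b i) + (\<Sum>j\<in>{..m} - {i}. ?e (?b j)) \<partial>Q)"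
        unfolding bl_rfam[OF subset_refl] by (simp add: powr_mult ennreal_mult distrib_right)
      also have "\<dots> = (\<integral>\<^sup>+p. ?e (fst p) + ?e (snd p) \<partial>Q) * ?e (?b i) + (\<Sum>j\<in>{..m} - {i}. ?e (?b j))"
        by (subst nn_integral_add) (auto simp: nn_integral_multc Q.emeasure_space_1)
      finally show ?thesis unfolding mom .
    qed
    then have "(\<Sum>i\<le>m. (\<integral>\<^sup>+p. ?\<Psi> i (rfam (past m) \<omega>) p \<partial>Q)) = (\<Sum>i\<le>m. ennreal (1 + S) * ?e (?b i) + (\<Sum>j\<in>{..m} - {i}. ?e (?b j)))"
      by simp
    also have "\<dots> = (\<Sum>i\<le>m. ennreal (1 + S) * ?e (?b i)) + (\<Sum>i\<le>m. \<Sum>j\<in>{..m} - {i}. ?e (?b j))"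
      by (rule sum.distrib)
    \<comment> \<open>Each weight stays untouched for \<open>m\<close> of the \<open>Suc m\<close>
      possible indices.\<close>
    also have "(\<Sum>i\<le>m. \<Sum>j\<in>{..m} - {i}. ?e (?b j)) = of_nat m * (\<Sum>j\<le>m. ?e (?b j))"
    proof -
      have "(\<Sum>i\<le>m. \<Sum>j\<in>{..m} - {i}. ?e (?b j)) = (\<Sum>i\<le>m. \<Sum>j\<le>m. if j = i then 0 else ?e (?b j))"
        by (intro sum.cong refl sum.mono_neutral_cong_left) auto
      also have "\<dots> = (\<Sum>j\<le>m. \<Sum>i\<le>m. if j = i then 0 else ?e (?b j))" by (rule sum.swap)
      also have "\<dots> = (\<Sum>j\<le>m. \<Sum>i\<in>{..m} - {j}. ?e (?b j))"
        by (intro sum.cong refl sum.mono_neutral_cong_right) auto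
      also have "\<dots> = (\<Sum>j\<le>m. of_nat m * ?e (?b j))" by (intro sum.cong refl) simp
      finally show ?thesis by (simp only: sum_distrib_left)
    qed
    also have "(\<Sum>i\<le>m. ennreal (1 + S) * ?e (?b i)) + of_nat m * (\<Sum>j\<le>m. ?e (?b j)) =
      (ennreal (1 + S) + ennreal (real m)) * (\<Sum>j\<le>m. ?e (?b j))"
      by (simp only: sum_distrib_left distrib_right sum.distrib ennreal_of_nat_eq_real_of_nat)
    also have "ennreal (1 + S) + ennreal (real m) = ennreal (real (Suc m) + S)"
      using S by (simp add: ennreal_plus[symmetric] add_ac del: ennreal_plus)
    finally show "(\<Sum>i\<le>m. (\<integral>\<^sup>+p. ?\<Psi> i (rfam (past m) \<omega>) p \<partial>Q)) = ennreal (real (Suc m) + S) * (\<Sum>j\<le>m. ?e (?b j))" .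
  qed
  also have "\<dots> = ennreal (real (Suc m) + S) * (\<integral>\<^sup>+\<omega>. (\<Sum>j\<le>m. ?e (B m \<omega> ! j)) \<partial>M)"
    by (rule nn_integral_cmult) (intro borel_measurable_sum measurable_compose[OF B_meas em])
  also have "ennreal (1 / real (Suc m)) * (ennreal (real (Suc m) + S) * (\<integral>\<^sup>+\<omega>. (\<Sum>j\<le>m. ?e (B m \<omega> ! j)) \<partial>M)) =
      ennreal (1 / real (Suc m) * (real (Suc m) + S)) * (\<integral>\<^sup>+\<omega>. (\<Sum>j\<le>m. ?e (B m \<omega> ! j)) \<partial>M)"
    using S by (subst ennreal_mult) (simp_all add: mult.assoc)
  also have "1 / real (Suc m) * (real (Suc m) + S) = 1 + S / real (Suc m)"
    by (simp add: field_simps)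
  finally show ?thesis .
qed

sublocale kac_chain Q a d M "\<lambda>m j \<omega>. B m \<omega> ! j"
proof
  show "AE \<omega> in M. 0 \<le> B m \<omega> ! j" if "j \<le> m" for m j
    using AE_B_nonneg[of m] by eventually_elim (use that in auto)
  show "B 0 \<omega> ! 0 = 1" for \<omega> by (simp add: B_def)
  show "(\<lambda>\<omega>. B m \<omega> ! j) \<in> borel_measurable M" for m j by (rule B_meas)
next
  fix g :: "real \<Rightarrow> complex" and m :: nat
  assume "g \<in> borel_measurable borel" "\<And>x. norm (g x) \<le> 1"
  then show "(CLINT \<omega>|M. \<Prod>j\<le>Suc m. g (B (Suc m) \<omega> ! j)) =
      (1 / real (Suc m)) *\<^sub>R (CLINT \<omega>|M. \<Sum>i\<le>m. T g (B m \<omega> ! i) * (\<Prod>j\<in>{..m} - {i}. g (B m \<omega> ! j)))"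
    by (rule forward_eq)
next
  fix s S :: real and m :: nat
  assume "(s = 1 \<and> S = a) \<or> (s = d \<and> S = Sd)"
  then show "(\<integral>\<^sup>+\<omega>. (\<Sum>j\<le>Suc m. ennreal (B (Suc m) \<omega> ! j powr s)) \<partial>M) =
      ennreal (1 + S / real (Suc m)) * (\<integral>\<^sup>+\<omega>. (\<Sum>j\<le>m. ennreal (B m \<omega> ! j powr s)) \<partial>M)"
    by (rule forward_moment_eq)
qed

end

section \<open>The Yule clock\<close>

context kac_process
begin

definition S :: "nat \<Rightarrow> 'a \<Rightarrow> real" where
  "S n \<omega> = (\<Sum>j=1..n. H j \<omega>)"

lemma S_meas: "S n \<in> borel_measurable M"
  unfolding S_def[abs_def] by (intro borel_measurable_sum H_meas) auto

lemma AE_H_nonneg: "AE \<omega> in M. \<forall>k\<ge>1. 0 \<le> H k \<omega>"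
  unfolding AE_all_countable
proof
  fix k show "AE \<omega> in M. 1 \<le> k \<longrightarrow> 0 \<le> H k \<omega>"
  proof (cases "1 \<le> k")
    case True
    have "AE x in density lborel (\<lambda>x. ennreal (exponential_density (real k) x)). 0 \<le> x"
      by (subst AE_density) (auto simp: exponential_density_def)
    then have "AE x in distr M borel (H k). 0 \<le> x" by (simp only: H_law[OF True])
    from AE_distrD[OF H_meas[OF True] this] show ?thesis by eventually_elim simp
  qed simp
qed

text \<open>On \<open>{0..s}\<close> the product
  \<open>exp (- x * real (Suc n)) * (1 - exp (- (s - x))) ^ n\<close> equals
  \<open>exp (- x) * (exp (- x) - exp (- s)) ^ n\<close>, which times \<open>real (Suc n)\<close> is
  an exact derivative.\<close>

lemma exp_convolution:
  assumes "0 \<le> s"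
  shows "(\<integral>\<^sup>+x. ennreal (exponential_density (real (Suc n)) x) * ennreal (if s - x < 0 then 0 else (1 - exp (- (s - x))) ^ n) \<partial>lborel)
    = ennreal ((1 - exp (- s)) ^ Suc n)"
proof -
  let ?f = "\<lambda>x. real (Suc n) * exp (- x) * (exp (- x) - exp (- s)) ^ n"
  let ?F = "\<lambda>x. - ((exp (- x) - exp (- s)) ^ Suc n)"
  have "(\<integral>\<^sup>+x. ennreal (exponential_density (real (Suc n)) x) * ennreal (if s - x < 0 then 0 else (1 - exp (- (s - x))) ^ n) \<partial>lborel)
     = (\<integral>\<^sup>+x. ennreal (?f x) * indicator {0..s} x \<partial>lborel)"
  proof (rule nn_integral_cong)
    fix x :: real
    show "ennreal (exponential_density (real (Suc n)) x) * ennreal (if s - x < 0 then 0 else (1 - exp (- (s - x))) ^ n)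
        = ennreal (?f x) * indicator {0..s} x"
    proof (cases "x \<in> {0..s}")
      case True
      have "exp (- x * real (Suc n)) = exp (- x) * exp (- x) ^ n"
        by (simp add: exp_of_nat_mult[symmetric] exp_add[symmetric] algebra_simps)
      moreover have "exp (- x) * (1 - exp (- (s - x))) = exp (- x) - exp (- s)"
        by (simp add: right_diff_distrib exp_add[symmetric])
      then have "exp (- x) ^ n * (1 - exp (- (s - x))) ^ n = (exp (- x) - exp (- s)) ^ n"
        by (simp only: power_mult_distrib[symmetric])
      ultimately have "real (Suc n) * exp (- x * real (Suc n)) * (1 - exp (- (s - x))) ^ n = ?f x"
        by (simp only: mult.assoc)
      then have "exponential_density (real (Suc n)) x * (1 - exp (- (s - x))) ^ n = ?f x"
        using True by (simp only: exponential_density_def) simp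
      moreover have "0 \<le> exponential_density (real (Suc n)) x" by simp
      ultimately show ?thesis using True
        by (simp only: ennreal_mult'[symmetric]) simp
    next
      case False
      then show ?thesis by (auto simp: exponential_density_def)
    qed
  qed
  also have "\<dots> = ennreal (?F s - ?F 0)"
  proof (rule nn_integral_FTC_Icc)
    fix x assume x: "x \<in> {0..s}"
    have e: "((\<lambda>x. exp (- x) - exp (- s)) has_real_derivative - exp (- x)) (at x)"
      by (auto intro!: derivative_eq_intros)
    show "(?F has_real_derivative ?f x) (at x)"
      by (rule DERIV_cong[OF DERIV_minus[OF DERIV_power[OF e, of "Suc n"]]]) simp
    show "0 \<le> ?f x" using x by simp
  qed (use assms in auto)
  also have "?F s - ?F 0 = (1 - exp (- s)) ^ Suc n" by simp
  finally show ?thesis .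
qed

lemma AE_S_nonneg: "AE \<omega> in M. 0 \<le> S n \<omega>"
  using AE_H_nonneg
proof eventually_elim
  case (elim \<omega>)
  then show ?case unfolding S_def by (intro sum_nonneg) auto
qed

text \<open>A sum of independent exponential times with rates 1, ..., n is distributed like the
  maximum of n standard exponential times. The induction adds one holding time by convolution, which
  is why negative \<open>s\<close> is included: the remaining time can be negative.\<close>

lemma S_cdf: "emeasure M {\<omega> \<in> space M. S n \<omega> \<le> s} = ennreal (if s < 0 then 0 else (1 - exp (- s)) ^ n)"
proof (induction n arbitrary: s)
  case 0
  then show ?case by (simp add: S_def emeasure_space_1)
next
  case (Suc n)
  show ?case
  proof (cases "s < 0")
    case True
    have "AE \<omega> in M. \<not> S (Suc n) \<omega> \<le> s"
      using AE_S_nonneg[of "Suc n"] by eventually_elim (use True in simp)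
    then have "emeasure M {\<omega> \<in> space M. S (Suc n) \<omega> \<le> s} = 0"
      by (subst (asm) AE_iff_measurable[OF _ refl]) (use S_meas in auto)
    then show ?thesis using True by simp
  next
    case False
    then have s: "0 \<le> s" by simp
    let ?A = "{HI (Suc n)}" let ?B = "HI ` {1..n}"
    let ?f = "\<lambda>z. indicator {..s} (fst (fst z (HI (Suc n))) + (\<Sum>j=1..n. fst (snd z (HI j)))) :: ennreal"
    have ind: "indep_var (PiA ?A) (rfam ?A) (PiA ?B) (rfam ?B)" by (rule indep_rfam) auto
    have f_meas: "?f \<in> borel_measurable (PiA ?A \<Otimes>\<^sub>M PiA ?B)"
    proof -
      have "(\<lambda>z. fst (fst z (HI (Suc n))) + (\<Sum>j=1..n. fst (snd z (HI j)))) \<in> borel_measurable (PiA ?A \<Otimes>\<^sub>M PiA ?B)"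
        by (intro borel_measurable_add borel_measurable_sum measurable_compose[OF measurable_compose[OF measurable_fst proj_meas] fst_snd_meas(1)]
            measurable_compose[OF measurable_compose[OF measurable_snd proj_meas] fst_snd_meas(1)]) auto
      then show ?thesis by (rule measurable_compose) simp
    qed
    have r: "fst (rfam ?A \<omega> (HI (Suc n))) = H (Suc n) \<omega>" "(\<Sum>j=1..n. fst (rfam ?B \<omega> (HI j))) = S n \<omega>" for \<omega>
      by (simp_all add: rfam_def S_def)
    have S_Suc: "S (Suc n) \<omega> = H (Suc n) \<omega> + S n \<omega>" for \<omega> by (simp add: S_def)
    have "emeasure M {\<omega> \<in> space M. S (Suc n) \<omega> \<le> s} = (\<integral>\<^sup>+\<omega>. indicator {\<omega> \<in> space M. S (Suc n) \<omega> \<le> s} \<omega> \<partial>M)"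
      by (rule nn_integral_indicator[symmetric]) (use S_meas in measurable)
    also have "\<dots> = (\<integral>\<^sup>+\<omega>. ?f (rfam ?A \<omega>, rfam ?B \<omega>) \<partial>M)"
      by (intro nn_integral_cong) (simp only: fst_conv snd_conv r S_Suc, simp add: indicator_def)
    also have "\<dots> = (\<integral>\<^sup>+\<omega>. (\<integral>\<^sup>+\<omega>'. ?f (rfam ?A \<omega>, rfam ?B \<omega>') \<partial>M) \<partial>M)"
      by (rule indep_var_double_nn_integral[OF ind f_meas])
    also have "\<dots> = (\<integral>\<^sup>+\<omega>. ennreal (if s - H (Suc n) \<omega> < 0 then 0 else (1 - exp (- (s - H (Suc n) \<omega>))) ^ n) \<partial>M)"
    proof (rule nn_integral_cong)
      fix \<omega>
      have "(\<integral>\<^sup>+\<omega>'. ?f (rfam ?A \<omega>, rfam ?B \<omega>') \<partial>M) = (\<integral>\<^sup>+\<omega>'. indicator {\<omega>' \<in> space M. S n \<omega>' \<le> s - H (Suc n) \<omega>} \<omega>' \<partial>M)"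
        by (intro nn_integral_cong) (simp only: fst_conv snd_conv r, auto simp: indicator_def)
      also have "\<dots> = emeasure M {\<omega>' \<in> space M. S n \<omega>' \<le> s - H (Suc n) \<omega>}"
        by (rule nn_integral_indicator) (use S_meas in measurable)
      finally show "(\<integral>\<^sup>+\<omega>'. ?f (rfam ?A \<omega>, rfam ?B \<omega>') \<partial>M) = ennreal (if s - H (Suc n) \<omega> < 0 then 0 else (1 - exp (- (s - H (Suc n) \<omega>))) ^ n)"
        unfolding Suc.IH .
    qed
    also have "\<dots> = (\<integral>\<^sup>+x. ennreal (if s - x < 0 then 0 else (1 - exp (- (s - x))) ^ n) \<partial>distr M borel (H (Suc n)))"
      by (rule nn_integral_distr[symmetric]) (auto intro: H_meas)
    also have "\<dots> = (\<integral>\<^sup>+x. ennreal (exponential_density (real (Suc n)) x) * ennreal (if s - x < 0 then 0 else (1 - exp (- (s - x))) ^ n) \<partial>lborel)"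
      by (subst H_law, simp, rule nn_integral_density) auto
    also have "\<dots> = ennreal ((1 - exp (- s)) ^ Suc n)"
      by (rule exp_convolution[OF s])
    finally show ?thesis using False by simp
  qed
qed

lemma S_prob: "0 \<le> t \<Longrightarrow> prob {\<omega> \<in> space M. S n \<omega> \<le> t} = (1 - exp (- t)) ^ n"
  using S_cdf[of n t] by (simp add: emeasure_eq_measure)

text \<open>The Yule process does not explode, because \<open>(1 - exp (- t)) ^ n\<close> tends to
  0. This matters for \<open>yule\<close>: \<open>card\<close> of an infinite set is 0, which would
  put the process back to 1.\<close>

lemma AE_S_unbounded:
  assumes "0 \<le> t"
  shows "AE \<omega> in M. \<exists>n. t < S n \<omega>"
proof -
  let ?E = "{\<omega> \<in> space M. \<forall>n. S n \<omega> \<le> t}"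
  note [measurable] = S_meas
  have "prob ?E \<le> (1 - exp (- t)) ^ n" for n
    unfolding S_prob[OF assms, of n, symmetric] by (intro finite_measure_mono) auto
  moreover have "(\<lambda>n. (1 - exp (- t)) ^ n) \<longlonglongrightarrow> 0" by (rule LIMSEQ_realpow_zero) (use assms in auto)
  ultimately have "prob ?E \<le> 0" by (intro LIMSEQ_le_const) auto
  then have "emeasure M ?E = 0" by (simp add: emeasure_eq_measure measure_le_0_iff)
  then have "AE \<omega> in M. \<not> (\<forall>n. S n \<omega> \<le> t)"
    by (intro AE_I[where N = ?E]) auto
  then show ?thesis by (simp add: not_le)
qed

definition nu :: "real \<Rightarrow> 'a \<Rightarrow> nat" where
  "nu t \<omega> = yule (\<lambda>k. H k \<omega>) t"

lemma nu_meas: "nu t \<in> measurable M (count_space UNIV)"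
proof -
  have "(\<lambda>\<omega>. card {k. 1 \<le> k \<and> S k \<omega> \<le> t}) \<in> measurable M (count_space UNIV)"
  proof (rule measurable_card)
    fix i
    have "{\<omega> \<in> space M. S i \<omega> \<le> t} \<in> events" using S_meas[of i] by measurable
    then show "{\<omega> \<in> space M. i \<in> {k. 1 \<le> k \<and> S k \<omega> \<le> t}} \<in> events" by (cases "1 \<le> i") auto
  qed
  from measurable_compose[OF this, of "\<lambda>n. 1 + n"]
  show ?thesis by (simp add: nu_def[abs_def] yule_def S_def)
qed

text \<open>Nonnegative holding times make \<open>S\<close> nondecreasing, so the indices counted by
  \<open>yule\<close> form an initial segment. Uniqueness of \<open>m\<close> is included so that
  the event \<open>nu t \<omega> = Suc m\<close> can be read off from \<open>S m\<close> and
  \<open>S (Suc m)\<close>.\<close>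

lemma AE_nu:
  assumes t: "0 \<le> t"
  shows "AE \<omega> in M. \<exists>m. nu t \<omega> = Suc m \<and> S m \<omega> \<le> t \<and> t < S (Suc m) \<omega> \<and> (\<forall>m'. S m' \<omega> \<le> t \<and> t < S (Suc m') \<omega> \<longrightarrow> m' = m)"
  using AE_S_unbounded[OF t] AE_H_nonneg
proof eventually_elim
  case (elim \<omega>)
  have mono: "S i \<omega> \<le> S j \<omega>" if "i \<le> j" for i j
    unfolding S_def using that elim(2) by (intro sum_mono2) auto
  define n where "n = (LEAST n. t < S n \<omega>)"
  have n: "t < S n \<omega>" unfolding n_def using elim(1) by (rule LeastI_ex)
  have "n \<noteq> 0" using n t by (auto simp: S_def intro: ccontr)
  then obtain m where m: "n = Suc m" by (cases n) auto
  have Sm: "S m \<omega> \<le> t"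
    using not_less_Least[of m "\<lambda>n. t < S n \<omega>"] m unfolding n_def by simp
  have iff: "S k \<omega> \<le> t \<longleftrightarrow> k \<le> m" for k
  proof
    assume "S k \<omega> \<le> t"
    show "k \<le> m"
    proof (rule ccontr)
      assume "\<not> k \<le> m"
      then have "S n \<omega> \<le> S k \<omega>" by (intro mono) (simp add: m)
      then show False using n \<open>S k \<omega> \<le> t\<close> by simp
    qed
  next
    assume "k \<le> m" then show "S k \<omega> \<le> t" using mono[of k m] Sm by simp
  qed
  have "{k. 1 \<le> k \<and> S k \<omega> \<le> t} = {1..m}" unfolding iff by auto
  then have "nu t \<omega> = Suc m" by (simp add: nu_def yule_def S_def)
  moreover have "m' = m" if "S m' \<omega> \<le> t \<and> t < S (Suc m') \<omega>" for m'
    using that iff[of m'] iff[of "Suc m'"] by (auto simp: not_less[symmetric])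
  ultimately show ?case using Sm n[unfolded m] by (intro exI[of _ m] conjI allI impI)
qed

lemma nu_prob:
  assumes t: "0 \<le> t"
  shows "prob {\<omega> \<in> space M. nu t \<omega> = Suc m} = yule_pmf t m"
proof -
  note [measurable] = S_meas nu_meas[of t]
  have "prob {\<omega> \<in> space M. nu t \<omega> = Suc m} = prob ({\<omega> \<in> space M. S m \<omega> \<le> t} - {\<omega> \<in> space M. S m \<omega> \<le> t \<and> S (Suc m) \<omega> \<le> t})"
  proof (rule finite_measure_eq_AE)
    show "AE \<omega> in M. (\<omega> \<in> {\<omega> \<in> space M. nu t \<omega> = Suc m}) = (\<omega> \<in> {\<omega> \<in> space M. S m \<omega> \<le> t} - {\<omega> \<in> space M. S m \<omega> \<le> t \<and> S (Suc m) \<omega> \<le> t})"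
      using AE_nu[OF t]
    proof eventually_elim
      case (elim \<omega>)
      then obtain k where k: "nu t \<omega> = Suc k" "S k \<omega> \<le> t" "t < S (Suc k) \<omega>"
          "\<And>m'. S m' \<omega> \<le> t \<Longrightarrow> t < S (Suc m') \<omega> \<Longrightarrow> m' = k" by blast
      have "nu t \<omega> = Suc m \<longleftrightarrow> S m \<omega> \<le> t \<and> t < S (Suc m) \<omega>"
        using k by (metis Suc_inject)
      then show ?case by (auto simp: not_le)
    qed
  qed measurable
  also have "\<dots> = prob {\<omega> \<in> space M. S m \<omega> \<le> t} - prob {\<omega> \<in> space M. S m \<omega> \<le> t \<and> S (Suc m) \<omega> \<le> t}"
    by (rule finite_measure_Diff) auto
  also have "prob {\<omega> \<in> space M. S m \<omega> \<le> t \<and> S (Suc m) \<omega> \<le> t} = prob {\<omega> \<in> space M. S (Suc m) \<omega> \<le> t}"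
  proof (rule finite_measure_eq_AE)
    show "AE \<omega> in M. (\<omega> \<in> {\<omega> \<in> space M. S m \<omega> \<le> t \<and> S (Suc m) \<omega> \<le> t}) = (\<omega> \<in> {\<omega> \<in> space M. S (Suc m) \<omega> \<le> t})"
      using AE_H_nonneg
    proof eventually_elim
      case (elim \<omega>)
      have "S m \<omega> \<le> S (Suc m) \<omega>" using elim by (simp add: S_def)
      then show ?case by auto
    qed
  qed measurable
  \<comment> \<open>With \<open>q = 1 - exp (- t)\<close> this is
    \<open>q ^ m - q ^ Suc m = (1 - q) * q ^ m\<close>.\<close>
  also have "prob {\<omega> \<in> space M. S m \<omega> \<le> t} - prob {\<omega> \<in> space M. S (Suc m) \<omega> \<le> t} = yule_pmf t m"
    unfolding S_prob[OF t] yule_pmf_def by (simp add: algebra_simps)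
  finally show ?thesis .
qed

section \<open>Characteristic function of the sum at the Yule time\<close>

definition W :: "nat \<Rightarrow> 'a \<Rightarrow> real" where
  "W m \<omega> = (\<Sum>j\<le>m. B m \<omega> ! j * X (Suc j) \<omega>)"

lemma W_meas: "W m \<in> borel_measurable M"
  unfolding W_def[abs_def] by (intro borel_measurable_sum borel_measurable_times B_meas X_meas) auto

definition V :: "real \<Rightarrow> 'a \<Rightarrow> real" where
  "V t \<omega> = Vfun (\<lambda>n. fst (LR n \<omega>)) (\<lambda>n. snd (LR n \<omega>)) (\<lambda>n. I n \<omega>) (\<lambda>k. H k \<omega>) (\<lambda>j. X j \<omega>) t"

lemma V_W: "V t \<omega> = W (nu t \<omega> - 1) \<omega>"
proof -
  obtain m where m: "nu t \<omega> = Suc m" by (simp add: nu_def yule_def)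
  have "V t \<omega> = (\<Sum>j=1..Suc m. B m \<omega> ! (j - 1) * X j \<omega>)"
    using m unfolding V_def Vfun_def beta_def B_def nu_def by simp
  also have "\<dots> = (\<Sum>j=0..m. B m \<omega> ! j * X (Suc j) \<omega>)"
    unfolding One_nat_def sum.shift_bounds_cl_Suc_ivl by simp
  finally show ?thesis by (simp add: W_def m atLeast0AtMost)
qed

lemma V_meas: "V t \<in> borel_measurable M"
proof -
  have "(\<lambda>\<omega>. W (nu t \<omega> - 1) \<omega>) \<in> borel_measurable M"
    by (rule measurable_compose_countable[OF W_meas measurable_compose[OF nu_meas]]) simp
  then show ?thesis by (simp only: V_W[symmetric, abs_def])
qed

text \<open>The coefficients are constants here; \<open>char_W\<close> freezes the random weights by
  independence before this factorisation over the initial variables is used.\<close>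

lemma char_weighted_sum:
  "(CLINT \<omega>|M. iexp (\<Sum>j\<le>m. c j * X (Suc j) \<omega>)) = (\<Prod>j\<le>m. char PX (c j))"
proof -
  let ?K = "XI ` Suc ` {..m}"
  let ?Y = "\<lambda>i p. case i of XI k \<Rightarrow> c (k - 1) * fst (p :: real \<times> real) | _ \<Rightarrow> (0::real)"
  have sub: "?K \<subseteq> vidx_set" by auto
  have "indep_vars (\<lambda>_. borel) (\<lambda>i \<omega>. ?Y i (vfam X H LR I i \<omega>)) ?K"
    by (rule indep_vars_compose2[OF indep_vars_subset[OF indep sub]])
       (auto split: vidx.split intro!: borel_measurable_times fst_snd_meas)
  from char_distr_sum[OF this, of 1]
  have "char (distr M borel (\<lambda>\<omega>. \<Sum>i\<in>?K. ?Y i (vfam X H LR I i \<omega>))) 1 = (\<Prod>i\<in>?K. char (distr M borel (\<lambda>\<omega>. ?Y i (vfam X H LR I i \<omega>))) 1)" .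
  moreover have "(\<Sum>i\<in>?K. ?Y i (vfam X H LR I i \<omega>)) = (\<Sum>j\<le>m. c j * X (Suc j) \<omega>)" for \<omega>
    by (subst sum.reindex, simp add: inj_on_def, subst sum.reindex) (auto simp: comp_def)
  moreover have "(\<Prod>i\<in>?K. char (distr M borel (\<lambda>\<omega>. ?Y i (vfam X H LR I i \<omega>))) 1) = (\<Prod>j\<le>m. char (distr M borel (\<lambda>\<omega>. c j * X (Suc j) \<omega>)) 1)"
    by (subst prod.reindex, simp add: inj_on_def, subst prod.reindex) (auto simp: comp_def)
  moreover have "char (distr M borel (\<lambda>\<omega>. c j * X (Suc j) \<omega>)) 1 = char PX (c j)" for j
  proof -
    have Xm: "X (Suc j) \<in> borel_measurable M" by (rule X_meas) simp
    have "char (distr M borel (\<lambda>\<omega>. c j * X (Suc j) \<omega>)) 1 = (CLINT \<omega>|M. iexp (1 * (c j * X (Suc j) \<omega>)))"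
      unfolding char_def by (rule integral_distr) (use Xm in auto)
    also have "\<dots> = char (distr M borel (X (Suc j))) (c j)"
      unfolding char_def by (subst integral_distr[OF Xm]) auto
    finally show ?thesis by (simp add: X_law)
  qed
  moreover have "char (distr M borel (\<lambda>\<omega>. \<Sum>j\<le>m. c j * X (Suc j) \<omega>)) 1 = (CLINT \<omega>|M. iexp (1 * (\<Sum>j\<le>m. c j * X (Suc j) \<omega>)))"
    unfolding char_def by (rule integral_distr) (auto intro!: borel_measurable_sum borel_measurable_times X_meas)
  ultimately show ?thesis by simp
qed

lemma char_W: "(CLINT \<omega>|M. iexp (v * W m \<omega>)) = prod_mean m (\<lambda>x. char PX (v * x))"
proof -
  let ?A = "past m" let ?C = "XI ` Suc ` {..m}"
  let ?f = "\<lambda>z. iexp (v * (\<Sum>j\<le>m. bl (fst z) m ! j * fst (snd z (XI (Suc j)))))"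
  have ind: "indep_var (PiA ?A) (rfam ?A) (PiA ?C) (rfam ?C)"
    by (rule indep_rfam) (auto simp: past_def)
  have f_meas: "?f \<in> borel_measurable (PiA ?A \<Otimes>\<^sub>M PiA ?C)"
  proof -
    have "(\<lambda>z. (\<Sum>j\<le>m. bl (fst z) m ! j * fst (snd z (XI (Suc j))))) \<in> borel_measurable (PiA ?A \<Otimes>\<^sub>M PiA ?C)"
      by (intro borel_measurable_sum borel_measurable_times bl_pair_meas
          measurable_compose[OF measurable_compose[OF measurable_snd proj_meas] fst_snd_meas(1)]) auto
    then show ?thesis by (rule measurable_compose) simp
  qed
  have r: "(\<Sum>j\<le>m. bl (rfam ?A \<omega>) m ! j * fst (rfam ?C \<omega>' (XI (Suc j)))) = (\<Sum>j\<le>m. B m \<omega> ! j * X (Suc j) \<omega>')" for \<omega> \<omega>'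
    unfolding bl_rfam[OF subset_refl] by (intro sum.cong refl) (auto simp: rfam_def)
  have "(CLINT \<omega>|M. iexp (v * W m \<omega>)) = (CLINT \<omega>|M. ?f (rfam ?A \<omega>, rfam ?C \<omega>))"
    by (simp only: fst_conv snd_conv r W_def)
  also have "\<dots> = (CLINT \<omega>|M. (CLINT \<omega>'|M. ?f (rfam ?A \<omega>, rfam ?C \<omega>')))"
    by (rule indep_var_double_integral[OF ind f_meas, of 1]) simp
  also have "\<dots> = (CLINT \<omega>|M. (CLINT \<omega>'|M. iexp (\<Sum>j\<le>m. (v * B m \<omega> ! j) * X (Suc j) \<omega>')))"
    by (simp only: fst_conv snd_conv r sum_distrib_left mult.assoc)
  also have "\<dots> = prod_mean m (\<lambda>x. char PX (v * x))"
    unfolding char_weighted_sum prod_mean_def ..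
  finally show ?thesis .
qed

lemma PX_real_distribution: "real_distribution PX"
proof -
  have "real_distribution (distr M borel (X 1))" by (rule real_distribution_distr[OF X_meas]) simp
  then show ?thesis by (simp add: X_law)
qed

text \<open>The clock depends only on the holding times, hence is independent of the weights and the
  initial variables. Decomposing over the values of \<open>nu t\<close> gives the sum
  \<open>Phi\<close>; the norms of the terms have means \<open>yule_pmf t m\<close>, which justifies
  the exchange of sum and integral.\<close>

lemma char_V:
  assumes t: "0 \<le> t"
  shows "(CLINT \<omega>|M. iexp (v * V t \<omega>)) = Phi t (\<lambda>x. char PX (v * x))"
proof -
  \<comment> \<open>All holding times are taken at once, since \<open>yule\<close> counts over an
    unbounded set of indices; these start at 1, hence the \<open>Suc\<close>.\<close>
  let ?HI = "range (\<lambda>k. HI (Suc k))"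
  note [measurable] = nu_meas[of t] W_meas
  have term_eq: "(CLINT \<omega>|M. indicator {Suc m} (nu t \<omega>) * iexp (v * W m \<omega>)) = yule_pmf t m *\<^sub>R prod_mean m (\<lambda>x. char PX (v * x))" for m
  proof -
    let ?C = "past m \<union> XI ` Suc ` {..m}"
    let ?nu = "\<lambda>y. yule (\<lambda>k. fst (y (HI k))) t"
    let ?f = "\<lambda>z. indicator {Suc m} (?nu (fst z)) * iexp (v * (\<Sum>j\<le>m. bl (snd z) m ! j * fst (snd z (XI (Suc j)))))"
    have ind: "indep_var (PiA ?HI) (rfam ?HI) (PiA ?C) (rfam ?C)"
      by (rule indep_rfam) (auto simp: past_def)
    have nu_m: "?nu \<in> measurable (PiA ?HI) (count_space UNIV)"
    proof -
      have "(\<lambda>y. card {k. 1 \<le> k \<and> (\<Sum>j=1..k. fst (y (HI j))) \<le> t}) \<in> measurable (PiA ?HI) (count_space UNIV)"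
      proof (rule measurable_card)
        fix i
        have "(\<lambda>y. \<Sum>j=1..i. fst (y (HI j))) \<in> borel_measurable (PiA ?HI)"
        proof (intro borel_measurable_sum measurable_compose[OF proj_meas fst_snd_meas(1)])
          fix j assume "j \<in> {1..i}"
          then show "HI j \<in> ?HI" by (cases j) auto
        qed
        then have "{y \<in> space (PiA ?HI). (\<Sum>j=1..i. fst (y (HI j))) \<le> t} \<in> sets (PiA ?HI)" by measurable
        then show "{y \<in> space (PiA ?HI). i \<in> {k. 1 \<le> k \<and> (\<Sum>j=1..k. fst (y (HI j))) \<le> t}} \<in> sets (PiA ?HI)" by (cases "1 \<le> i") auto
      qed
      from measurable_compose[OF this, of "\<lambda>n. 1 + n"]
      show ?thesis by (simp add: yule_def)
    qed
    have f_meas: "?f \<in> borel_measurable (PiA ?HI \<Otimes>\<^sub>M PiA ?C)"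
    proof (rule borel_measurable_times)
      show "(\<lambda>z. indicator {Suc m} (?nu (fst z)) :: complex) \<in> borel_measurable (PiA ?HI \<Otimes>\<^sub>M PiA ?C)"
        by (rule measurable_compose[OF measurable_compose[OF measurable_fst nu_m]]) simp
      have "(\<lambda>z. (\<Sum>j\<le>m. bl (snd z) m ! j * fst (snd z (XI (Suc j))))) \<in> borel_measurable (PiA ?HI \<Otimes>\<^sub>M PiA ?C)"
        by (intro borel_measurable_sum borel_measurable_times measurable_compose[OF measurable_snd bl_meas]
            measurable_compose[OF measurable_compose[OF measurable_snd proj_meas] fst_snd_meas(1)]) auto
      then show "(\<lambda>z. iexp (v * (\<Sum>j\<le>m. bl (snd z) m ! j * fst (snd z (XI (Suc j)))))) \<in> borel_measurable (PiA ?HI \<Otimes>\<^sub>M PiA ?C)"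
        by (rule measurable_compose) simp
    qed
    have f1: "norm (?f z) \<le> 1" for z by (simp add: norm_mult indicator_def)
    have r1: "?nu (rfam ?HI \<omega>) = nu t \<omega>" for \<omega>
    proof -
      have "fst (rfam ?HI \<omega> (HI j)) = H j \<omega>" if "1 \<le> j" for j
        using that by (cases j) (auto simp: rfam_def)
      then have "(\<Sum>j=1..k. fst (rfam ?HI \<omega> (HI j))) = (\<Sum>j=1..k. H j \<omega>)" for k by (intro sum.cong) auto
      then show ?thesis by (simp add: nu_def yule_def)
    qed
    have r2: "(\<Sum>j\<le>m. bl (rfam ?C \<omega>) m ! j * fst (rfam ?C \<omega> (XI (Suc j)))) = W m \<omega>" for \<omega>
      unfolding W_def by (subst bl_rfam, simp, intro sum.cong refl) (auto simp: rfam_def)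
    have "(CLINT \<omega>|M. indicator {Suc m} (nu t \<omega>) * iexp (v * W m \<omega>)) = (CLINT \<omega>|M. ?f (rfam ?HI \<omega>, rfam ?C \<omega>))"
      by (simp only: fst_conv snd_conv r1 r2)
    also have "\<dots> = (CLINT \<omega>|M. (CLINT \<omega>'|M. ?f (rfam ?HI \<omega>, rfam ?C \<omega>')))"
      by (rule indep_var_double_integral[OF ind f_meas f1])
    also have "\<dots> = (CLINT \<omega>|M. indicator {Suc m} (nu t \<omega>) * (CLINT \<omega>'|M. iexp (v * W m \<omega>')))"
      by (simp only: fst_conv snd_conv r1 r2 Bochner_Integration.integral_mult_right_zero)
    also have "\<dots> = (CLINT \<omega>|M. indicator {Suc m} (nu t \<omega>)) * (CLINT \<omega>'|M. iexp (v * W m \<omega>'))"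
      by (rule Bochner_Integration.integral_mult_left_zero)
    also have "(CLINT \<omega>|M. indicator {Suc m} (nu t \<omega>)) = (CLINT \<omega>|M. complex_of_real (indicator {\<omega> \<in> space M. nu t \<omega> = Suc m} \<omega>))"
      by (intro Bochner_Integration.integral_cong) (auto simp: indicator_def)
    also have "\<dots> = complex_of_real (prob {\<omega> \<in> space M. nu t \<omega> = Suc m})"
    proof -
      have "{\<omega> \<in> space M. nu t \<omega> = Suc m} \<inter> space M = {\<omega> \<in> space M. nu t \<omega> = Suc m}" by auto
      then show ?thesis by (subst integral_complex_of_real) simp
    qed
    finally show ?thesis unfolding nu_prob[OF t] char_W by (simp add: scaleR_conv_of_real)
  qed
  let ?g = "\<lambda>m \<omega>. indicator {Suc m} (nu t \<omega>) * iexp (v * W m \<omega>)"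
  have ptw: "(\<lambda>m. ?g m \<omega>) sums iexp (v * V t \<omega>)" for \<omega>
  proof -
    obtain k where k: "nu t \<omega> = Suc k" by (simp add: nu_def yule_def)
    have "?g m \<omega> = (if m = k then iexp (v * V t \<omega>) else 0)" for m
      using k by (auto simp: V_W indicator_def)
    then show ?thesis using sums_single[of k "\<lambda>_. iexp (v * V t \<omega>)"] by simp
  qed
  have g_int: "complex_integrable M (?g m)" for m
  proof (rule integrable_const_bound[where B = 1])
    show "AE \<omega> in M. norm (?g m \<omega>) \<le> 1" by (simp add: norm_mult indicator_def)
    show "?g m \<in> borel_measurable M"
      by (intro borel_measurable_times measurable_compose[OF nu_meas, where g = "indicator {Suc m}"]) (simp, measurable)
  qed
  have "(CLINT \<omega>|M. (\<Sum>m. ?g m \<omega>)) = (\<Sum>m. (CLINT \<omega>|M. ?g m \<omega>))"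
  proof (rule integral_suminf[OF g_int])
    show "AE \<omega> in M. summable (\<lambda>m. norm (?g m \<omega>))"
    proof (rule AE_I2)
      fix \<omega>
      obtain k where k: "nu t \<omega> = Suc k" by (simp add: nu_def yule_def)
      have "norm (?g m \<omega>) = (if m = k then 1 else 0)" for m
        using k by (auto simp: norm_mult indicator_def)
      then show "summable (\<lambda>m. norm (?g m \<omega>))" using sums_summable[OF sums_single[of k "\<lambda>_. 1::real"]] by simp
    qed
    have "(LINT \<omega>|M. norm (?g m \<omega>)) = yule_pmf t m" for m
    proof -
      have "(LINT \<omega>|M. norm (?g m \<omega>)) = (LINT \<omega>|M. indicator {\<omega> \<in> space M. nu t \<omega> = Suc m} \<omega>)"
        by (intro Bochner_Integration.integral_cong) (auto simp: norm_mult indicator_def)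
      also have "\<dots> = prob {\<omega> \<in> space M. nu t \<omega> = Suc m}"
      proof -
        have "{\<omega> \<in> space M. nu t \<omega> = Suc m} \<inter> space M = {\<omega> \<in> space M. nu t \<omega> = Suc m}" by auto
        then show ?thesis by simp
      qed
      finally show ?thesis by (simp only: nu_prob[OF t])
    qed
    then show "summable (\<lambda>m. (LINT \<omega>|M. norm (?g m \<omega>)))"
      using sums_summable[OF yule_pmf_sums[OF t]] by simp
  qed
  then show ?thesis
    unfolding term_eq Phi_def sums_unique[OF ptw, symmetric] .
qed

end

section \<open>Conclusion\<close>

lemma (in real_distribution) char_minus: "char M (- t) = cnj (char M t)"
proof -
  have "cnj (iexp (t * x)) = iexp (- t * x)" for x
    by (simp add: complex_eq_iff Re_exp Im_exp)
  then have "char M (- t) = (CLINT x|M. cnj (iexp (t * x)))" unfolding char_def by simp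
  also have "\<dots> = cnj (char M t)" unfolding char_def by (rule Bochner_Integration.integral_cnj)
  finally show ?thesis .
qed

section \<open>Reduction to an exponent of at most 2\<close>

lemma interpolation_weights:
  fixes \<delta> :: real
  assumes "2 < \<delta>"
  shows "(\<delta> - 2) / (\<delta> - 1) + (1 - (\<delta> - 2) / (\<delta> - 1)) * \<delta> = 2"
proof -
  define k where "k = (\<delta> - 2) / (\<delta> - 1)"
  have "k * (\<delta> - 1) = \<delta> - 2" using assms by (simp add: k_def)
  then have "k + (1 - k) * \<delta> = 2" by (simp add: algebra_simps)
  then show ?thesis by (simp only: k_def)
qed

text \<open>Weighted arithmetic-geometric inequality: 2 is the convex combination of 1 and
  \<open>\<delta>\<close> with weight \<open>(\<delta> - 2) / (\<delta> - 1)\<close> on 1.\<close>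

lemma powr_interpolate:
  fixes l :: real
  assumes "0 \<le> l" "2 < \<delta>"
  shows "l powr 2 \<le> (\<delta> - 2) / (\<delta> - 1) * l + (1 - (\<delta> - 2) / (\<delta> - 1)) * l powr \<delta>"
proof (cases "l = 0")
  case False
  let ?k = "(\<delta> - 2) / (\<delta> - 1)"
  have k: "0 \<le> ?k" "0 \<le> 1 - ?k" using assms by (auto simp: field_simps)
  have "l powr ?k * (l powr \<delta>) powr (1 - ?k) \<le> ?k * l + (1 - ?k) * l powr \<delta>"
    by (rule Youngs_inequality_0) (use k assms False in auto)
  moreover have "?k + \<delta> * (1 - ?k) = 2"
    using interpolation_weights[OF assms(2)] by (simp only: mult.commute)
  then have "l powr ?k * (l powr \<delta>) powr (1 - ?k) = l powr 2"
    by (simp add: powr_powr powr_add[symmetric])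
  ultimately show ?thesis by simp
qed (use assms in auto)

lemma Sfun_finite:
  assumes "sets Q = sets borel" "Sfun Q s < \<infinity>"
  shows "integrable Q (\<lambda>p. fst p powr s + snd p powr s)"
    and "Sfun Q s = ereal ((\<integral>p. fst p powr s + snd p powr s \<partial>Q) - 1)"
proof -
  have sp: "sets Q = sets (borel \<Otimes>\<^sub>M borel)" by (simp only: assms(1) borel_prod)
  note [measurable_cong] = sp
  let ?N = "\<integral>\<^sup>+p. ennreal (fst p powr s + snd p powr s) \<partial>Q"
  have fin: "?N < \<infinity>"
  proof (rule ccontr)
    assume "\<not> ?N < \<infinity>"
    then have "?N = top" by (simp add: less_top[symmetric])
    then have "Sfun Q s = \<infinity>" by (simp add: Sfun_def)
    then show False using assms(2) by simp
  qed
  show int: "integrable Q (\<lambda>p. fst p powr s + snd p powr s)"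
    by (rule integrableI_nonneg) (use fin in \<open>auto simp: less_top[symmetric]\<close>)
  have "?N = ennreal (\<integral>p. fst p powr s + snd p powr s \<partial>Q)"
    by (rule nn_integral_eq_integral[OF int]) simp
  moreover have "0 \<le> (\<integral>p. fst p powr s + snd p powr s \<partial>Q)" by (intro integral_nonneg_AE) simp
  ultimately show "Sfun Q s = ereal ((\<integral>p. fst p powr s + snd p powr s \<partial>Q) - 1)"
    by (simp add: Sfun_def one_ereal_def)
qed

text \<open>If \<open>\<delta> > 2\<close>, the moment of order 2 is at most a convex combination of
  those of orders 1 and \<open>\<delta>\<close>. The comparison line \<open>1 + a * s\<close> is
  affine in \<open>s\<close>, attained at 1 and strictly above the moment at
  \<open>\<delta>\<close>, hence strictly above it at 2.\<close>

lemma smoothing_exists: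
  assumes Q: "prob_space Q" "sets Q = sets borel" "AE p in Q. 0 \<le> fst p \<and> 0 \<le> snd p"
    and \<delta>: "\<delta> > 1" "mufun Q \<delta> < mufun Q 1" "mufun Q 1 < \<infinity>"
  shows "mufun Q 1 = Sfun Q 1" "smoothing Q (real_of_ereal (Sfun Q 1)) (min \<delta> 2)"
proof -
  interpret Q: prob_space Q by fact
  have sp: "sets Q = sets (borel \<Otimes>\<^sub>M borel)" by (simp only: Q(2) borel_prod)
  note [measurable_cong] = sp
  show mu1: "mufun Q 1 = Sfun Q 1"
    by (simp add: mufun_def one_ereal_def[symmetric])
  have f1: "Sfun Q 1 < \<infinity>" using \<delta>(3) mu1 by simp
  have "Sfun Q \<delta> < \<infinity>"
  proof (rule ccontr)
    assume "\<not> Sfun Q \<delta> < \<infinity>"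
    then have "mufun Q \<delta> = \<infinity>" using \<delta>(1) by (simp add: mufun_def)
    then show False using \<delta>(2) by simp
  qed
  note F1 = Sfun_finite[OF Q(2) f1] and Fd = Sfun_finite[OF Q(2) this]
  define a where "a = real_of_ereal (Sfun Q 1)"
  define md where "md = (\<integral>p. fst p powr \<delta> + snd p powr \<delta> \<partial>Q)"
  have a: "a = (\<integral>p. fst p powr 1 + snd p powr 1 \<partial>Q) - 1" by (simp add: a_def F1(2))
  have lt: "md - 1 < a * \<delta>"
  proof -
    have "ereal ((md - 1) / \<delta>) < ereal a"
      using \<delta>(1,2) unfolding mu1 unfolding mufun_def F1(2) Fd(2) a md_def by simp
    then show ?thesis using \<delta>(1) by (simp add: divide_less_eq)
  qed
  have ae1: "AE p in Q. fst p powr 1 + snd p powr 1 = fst p + snd p"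
    using Q(3) by eventually_elim simp
  have int1: "integrable Q (\<lambda>p. fst p + snd p)"
    by (rule Bochner_Integration.integrable_cong_AE_imp[OF F1(1)]) (use ae1 in auto)
  have m1: "(\<integral>p. fst p + snd p \<partial>Q) = 1 + a"
  proof -
    have "(\<integral>p. fst p + snd p \<partial>Q) = (\<integral>p. fst p powr 1 + snd p powr 1 \<partial>Q)"
      by (rule integral_cong_AE) (use ae1 in auto)
    then show ?thesis using a by simp
  qed
  have "integrable Q (\<lambda>p. fst p powr min \<delta> 2 + snd p powr min \<delta> 2) \<and>
      (\<integral>p. fst p powr min \<delta> 2 + snd p powr min \<delta> 2 \<partial>Q) < 1 + a * min \<delta> 2"
  proof (cases "\<delta> \<le> 2")
    case True
    then show ?thesis using Fd(1) lt by (simp add: md_def min_def)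
  next
    case False
    let ?k = "(\<delta> - 2) / (\<delta> - 1)"
    let ?b = "\<lambda>p. ?k * (fst p + snd p) + (1 - ?k) * (fst p powr \<delta> + snd p powr \<delta>)"
    have k1: "0 < 1 - ?k" "?k + (1 - ?k) * \<delta> = 2"
      using False by (simp add: field_simps, intro interpolation_weights, simp)
    have ib: "integrable Q ?b" by (intro Bochner_Integration.integrable_add integrable_mult_right int1 Fd(1))
    have le: "AE p in Q. fst p powr 2 + snd p powr 2 \<le> ?b p"
      using Q(3)
    proof eventually_elim
      case (elim p)
      have d2: "2 < \<delta>" using False by simp
      have "0 \<le> fst p" "0 \<le> snd p" using elim by auto
      from add_mono[OF powr_interpolate[OF this(1) d2] powr_interpolate[OF this(2) d2]]
      show ?case by (simp only: distrib_left add_ac)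
    qed
    have i2: "integrable Q (\<lambda>p. fst p powr 2 + snd p powr 2)"
      by (rule Bochner_Integration.integrable_bound[OF ib]) (measurable, use le in \<open>eventually_elim, simp\<close>)
    have "(\<integral>p. fst p powr 2 + snd p powr 2 \<partial>Q) \<le> (\<integral>p. ?b p \<partial>Q)"
      by (rule integral_mono_AE[OF i2 ib le])
    also have "\<dots> = ?k * (1 + a) + (1 - ?k) * md"
      by (subst Bochner_Integration.integral_add) (use int1 Fd(1) in \<open>simp_all only: integrable_mult_right Bochner_Integration.integral_mult_right_zero m1 md_def\<close>)
    also have "\<dots> < ?k * (1 + a) + (1 - ?k) * (1 + a * \<delta>)"
      using lt k1(1) by (intro add_strict_left_mono mult_strict_left_mono) auto
    also have "\<dots> = 1 + a * (?k + (1 - ?k) * \<delta>)"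
    proof -
      have "k * (1 + a) + (1 - k) * (1 + a * \<delta>) = 1 + a * (k + (1 - k) * \<delta>)" for k
        by (simp add: algebra_simps)
      then show ?thesis .
    qed
    also have "\<dots> = 1 + a * 2" unfolding k1(2) ..
    finally show ?thesis using i2 False by (simp add: min_def)
  qed
  then show "smoothing Q (real_of_ereal (Sfun Q 1)) (min \<delta> 2)"
    unfolding smoothing_def a_def[symmetric] using Q int1 m1 \<delta>(1) by auto
qed

context kac_process
begin

lemma real_distribution_scaled_V: "real_distribution (distr M borel (\<lambda>\<omega>. exp (- a * t) * V t \<omega>))"
  by (rule real_distribution_distr) (intro borel_measurable_times borel_measurable_const V_meas)

text \<open>\<open>Phi_tendsto\<close> is used with \<open>g x = char PX (\<xi> * x)\<close>: the
  frequency is part of \<open>g\<close>, so a slope at 0 from the right carries the whole dependence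
  on \<open>\<xi>\<close>, including its sign.\<close>

lemma char_scaled_V_tendsto:
  assumes Z: "Zlaw \<zeta>" and \<psi>: "Re \<psi> \<le> 0"
    and lim: "((\<lambda>x. (char PX (\<xi> * x) - 1) / x) \<longlongrightarrow> \<psi>) (at_right 0)"
    and s: "filterlim s at_top sequentially"
  shows "(\<lambda>n. char (distr M borel (\<lambda>\<omega>. exp (- a * s n) * V (s n) \<omega>)) \<xi>) \<longlonglongrightarrow> laplace \<zeta> \<psi> 1"
proof (rule Lim_transform_eventually)
  interpret PX: real_distribution PX by (rule PX_real_distribution)
  have "((\<lambda>t. Phi t (\<lambda>x. char PX (\<xi> * (exp (- a * t) * x)))) \<longlongrightarrow> laplace \<zeta> \<psi> 1) at_top"
    by (rule Phi_tendsto[OF Z \<psi>, where g = "\<lambda>x. char PX (\<xi> * x)"]) (auto intro: PX.cmod_char_le_1 lim simp: PX.char_zero)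
  from filterlim_compose[OF this s]
  show "(\<lambda>n. Phi (s n) (\<lambda>x. char PX (\<xi> * (exp (- a * s n) * x)))) \<longlonglongrightarrow> laplace \<zeta> \<psi> 1" .
  have "eventually (\<lambda>n. 0 \<le> s n) sequentially"
    using s by (simp add: filterlim_at_top)
  then show "eventually (\<lambda>n. Phi (s n) (\<lambda>x. char PX (\<xi> * (exp (- a * s n) * x))) =
      char (distr M borel (\<lambda>\<omega>. exp (- a * s n) * V (s n) \<omega>)) \<xi>) sequentially"
  proof eventually_elim
    case (elim n)
    have "char (distr M borel (\<lambda>\<omega>. exp (- a * s n) * V (s n) \<omega>)) \<xi> = (CLINT \<omega>|M. iexp (\<xi> * (exp (- a * s n) * V (s n) \<omega>)))"
      unfolding char_def by (rule integral_distr) (intro borel_measurable_times borel_measurable_const V_meas, simp)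
    also have "\<dots> = (CLINT \<omega>|M. iexp ((\<xi> * exp (- a * s n)) * V (s n) \<omega>))" by (simp only: mult.assoc)
    also have "\<dots> = Phi (s n) (\<lambda>x. char PX ((\<xi> * exp (- a * s n)) * x))" by (rule char_V[OF elim])
    finally show ?case by (simp only: mult.assoc)
  qed
qed

end

text \<open>For \<open>\<xi> > 0\<close> this is a change of variable. For \<open>\<xi> < 0\<close>
  conjugation is applied to the case \<open>- \<xi>\<close>: it changes the sign of the drift and
  keeps the real part, whence \<open>\<bar>\<xi>\<bar>\<close>.\<close>

lemma char_scaled_expansion:
  assumes M: "real_distribution M"
    and lim: "((\<lambda>\<xi>. (char M \<xi> - 1) / \<xi>) \<longlongrightarrow> \<i> * \<gamma> - c * pi) (at_right 0)"
  shows "((\<lambda>x. (char M (\<xi> * x) - 1) / x) \<longlongrightarrow> \<i> * complex_of_real (\<gamma> * \<xi>) - complex_of_real (c * pi * \<bar>\<xi>\<bar>)) (at_right 0)"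
proof -
  interpret M: real_distribution M by fact
  have pos: "((\<lambda>x. (char M (u * x) - 1) / x) \<longlongrightarrow> \<i> * complex_of_real (\<gamma> * u) - complex_of_real (c * pi * u)) (at_right 0)"
    if "u > 0" for u
  proof -
    have "filterlim (\<lambda>x. u * x) (at_right 0) (at_right 0)"
      using that by real_asymp
    from filterlim_compose[OF lim this]
    have "((\<lambda>x. u * ((char M (u * x) - 1) / complex_of_real (u * x))) \<longlongrightarrow> u * (\<i> * \<gamma> - c * pi)) (at_right 0)"
      by (intro tendsto_mult tendsto_const)
    moreover have "(\<lambda>x. u * ((char M (u * x) - 1) / complex_of_real (u * x))) = (\<lambda>x. (char M (u * x) - 1) / x)"
      using that by (simp add: fun_eq_iff)
    moreover have "u * (\<i> * \<gamma> - c * pi) = \<i> * complex_of_real (\<gamma> * u) - complex_of_real (c * pi * u)"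
      by (simp add: algebra_simps)
    ultimately show ?thesis by simp
  qed
  consider "\<xi> = 0" | "\<xi> > 0" | "\<xi> < 0" by linarith
  then show ?thesis
  proof cases
    case 1 then show ?thesis by (simp add: M.char_zero)
  next
    case 2 then show ?thesis using pos[OF 2] by simp
  next
    case 3
    have "((\<lambda>x. cnj ((char M (- \<xi> * x) - 1) / x)) \<longlongrightarrow> cnj (\<i> * complex_of_real (\<gamma> * - \<xi>) - complex_of_real (c * pi * - \<xi>))) (at_right 0)"
      by (rule tendsto_cnj[OF pos]) (use 3 in simp)
    moreover have "cnj ((char M (- \<xi> * x) - 1) / x) = (char M (\<xi> * x) - 1) / x" for x
      using M.char_minus[of "\<xi> * x"] by simp
    moreover have "cnj (\<i> * complex_of_real (\<gamma> * - \<xi>) - complex_of_real (c * pi * - \<xi>)) =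
        \<i> * complex_of_real (\<gamma> * \<xi>) - complex_of_real (c * pi * \<bar>\<xi>\<bar>)"
      using 3 by simp
    ultimately show ?thesis by (simp only:)
  qed
qed

theorem theorem2p2:
  fixes M :: "'a measure"
    and X H :: "nat \<Rightarrow> 'a \<Rightarrow> real"
    and LR :: "nat \<Rightarrow> 'a \<Rightarrow> real \<times> real"
    and I :: "nat \<Rightarrow> 'a \<Rightarrow> nat"
    and Q :: "(real \<times> real) measure"
    and PX :: "real measure"
    and c0 \<gamma>0 \<delta> :: real
  assumes M: "prob_space M"
    and indep: "prob_space.indep_vars M (\<lambda>_. borel) (vfam X H LR I) vidx_set"
    and LR_law: "\<And>n. 1 \<le> n \<Longrightarrow> distr M borel (LR n) = Q"
    and LR_nonneg: "AE p in Q. 0 \<le> fst p \<and> 0 \<le> snd p"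
    and LR_pos: "measure Q {p. 0 < fst p} + measure Q {p. 0 < snd p} > 1"
    and I_unif: "\<And>n k. 1 \<le> n \<Longrightarrow> k \<in> {1..n} \<Longrightarrow> measure M {\<omega> \<in> space M. I n \<omega> = k} = 1 / real n"
    and H_law: "\<And>k. 1 \<le> k \<Longrightarrow>
                  distr M borel (H k) = density lborel (\<lambda>x. ennreal (exponential_density (real k) x))"
    and X_law: "\<And>j. 1 \<le> j \<Longrightarrow> distr M borel (X j) = PX"
    and c0_pos: "c0 > 0"
    and tail_plus: "((\<lambda>x. x * (1 - cdf PX x)) \<longlongrightarrow> c0) at_top"
    and tail_minus: "((\<lambda>x. \<bar>x\<bar> * cdf PX x) \<longlongrightarrow> c0) at_bot"
    and gamma0: "((\<lambda>R. \<integral>x. indicator {-R<..<R} x * x \<partial>PX) \<longlongrightarrow> \<gamma>0) at_top"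
    and delta: "\<delta> > 1" "mufun Q \<delta> < mufun Q 1" "mufun Q 1 < \<infinity>"
  shows "\<exists>Vinf \<zeta>. real_distribution Vinf \<and>
           conv_distr_at_top
             (\<lambda>t. distr M borel (\<lambda>\<omega>. exp (- real_of_ereal (mufun Q 1) * t) *
                   Vfun (\<lambda>n. fst (LR n \<omega>)) (\<lambda>n. snd (LR n \<omega>)) (\<lambda>n. I n \<omega>)
                        (\<lambda>k. H k \<omega>) (\<lambda>j. X j \<omega>) t)) Vinf \<and>
           is_Zlaw Q \<zeta> \<and> (\<forall>\<zeta>'. is_Zlaw Q \<zeta>' \<longrightarrow> \<zeta>' = \<zeta>) \<and>
           (\<forall>\<xi>. char Vinf \<xi> =
              (CLINT z|\<zeta>. exp (complex_of_real z *
                  (\<i> * complex_of_real (\<gamma>0 * \<xi>) - complex_of_real (c0 * pi * \<bar>\<xi>\<bar>)))))"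
proof -
  interpret M: prob_space M by (rule M)
  have "vfam X H LR I (LRI 1) \<in> borel_measurable M"
  proof -
    have "LRI 1 \<in> vidx_set" by (auto simp: vidx_set_def)
    then show ?thesis using indep unfolding M.indep_vars_def by blast
  qed
  then have "prob_space Q"
    using M.prob_space_distr[of "LR 1" borel] LR_law[of 1] by simp
  moreover have "sets Q = sets borel" using LR_law[of 1] by auto
  ultimately have mu1: "mufun Q 1 = Sfun Q 1" and smooth: "smoothing Q (real_of_ereal (Sfun Q 1)) (min \<delta> 2)"
    using smoothing_exists[OF _ _ LR_nonneg delta] by auto
  define a where "a = real_of_ereal (Sfun Q 1)"
  interpret kac_process Q a "min \<delta> 2" M X H LR I PX
  proof (intro kac_process.intro)
    show "smoothing Q a (min \<delta> 2)" unfolding a_def by (rule smooth)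
  qed (rule M, rule kac_process_axioms.intro[OF indep LR_law I_unif H_law X_law])
  have Zlaw_iff: "is_Zlaw Q \<zeta> \<longleftrightarrow> Zlaw \<zeta>" for \<zeta>
    unfolding is_Zlaw_def Zlaw_def unfolding a_def ..
  obtain \<zeta> where \<zeta>: "Zlaw \<zeta>" using Zlaw_exists by blast
  interpret \<zeta>: real_distribution \<zeta> using \<zeta> by (simp add: Zlaw_def)
  \<comment> \<open>The exponent of a Cauchy law with location \<open>\<gamma>0\<close> and scale
    \<open>c0 * pi\<close>; multiplied by \<open>z\<close> and averaged over \<open>\<zeta>\<close>
    it describes a mixture of rescaled Cauchy laws.\<close>
  define \<psi> where "\<psi> \<xi> = \<i> * complex_of_real (\<gamma>0 * \<xi>) - complex_of_real (c0 * pi * \<bar>\<xi>\<bar>)" for \<xi>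
  have \<psi>: "Re (\<psi> \<xi>) \<le> 0" for \<xi> using c0_pos by (simp add: \<psi>_def)
  define F where "F \<xi> = laplace \<zeta> (\<psi> \<xi>) 1" for \<xi>
  have F_eq: "F \<xi> = (CLINT z|\<zeta>. exp (complex_of_real z * \<psi> \<xi>))" for \<xi>
    unfolding F_def laplace_def
  proof (rule integral_cong_AE)
    have "AE z in \<zeta>. 0 \<le> z" using \<zeta> by (simp add: Zlaw_def)
    then show "AE z in \<zeta>. exp (\<psi> \<xi> * complex_of_real (\<bar>1\<bar> * \<bar>z\<bar>)) = exp (complex_of_real z * \<psi> \<xi>)"
      by eventually_elim (simp add: mult.commute)
  qed auto
  let ?P = "\<lambda>t. distr M borel (\<lambda>\<omega>. exp (- a * t) * V t \<omega>)"
  have conv: "(\<lambda>n. char (?P (s n)) \<xi>) \<longlonglongrightarrow> F \<xi>" if "filterlim s at_top sequentially" for s :: "nat \<Rightarrow> real" and \<xi>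
    unfolding F_def \<psi>_def
    by (rule char_scaled_V_tendsto[OF \<zeta> \<psi>[unfolded \<psi>_def] _ that],
        rule char_scaled_expansion[OF PX_real_distribution char_expansion[OF PX_real_distribution tail_plus tail_minus gamma0]])
  \<comment> \<open>Continuity at 0 is what turns the pointwise limit \<open>F\<close> into the
    characteristic function of a law.\<close>
  have "isCont F 0"
    unfolding isCont_def F_def laplace_def
  proof (rule integral_dominated_convergence_within[where w = "\<lambda>_. 1"])
    show "AE z in \<zeta>. ((\<lambda>\<xi>. exp (\<psi> \<xi> * complex_of_real (\<bar>1\<bar> * \<bar>z\<bar>))) \<longlongrightarrow> exp (\<psi> 0 * complex_of_real (\<bar>1\<bar> * \<bar>z\<bar>))) (at 0)"
      unfolding \<psi>_def by (intro AE_I2 tendsto_intros)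
    show "AE z in \<zeta>. norm (exp (\<psi> \<xi> * complex_of_real (\<bar>1\<bar> * \<bar>z\<bar>))) \<le> 1" for \<xi>
      by (intro AE_I2 norm_exp_le_one[OF \<psi>]) simp
  qed auto
  \<comment> \<open>The integer times already produce \<open>Vinf\<close>; along every other
    sequence of times the limit is the same \<open>F\<close>, and Levy continuity gives convergence
    to this law.\<close>
  then obtain Vinf where Vinf: "real_distribution Vinf" "char Vinf = F"
    using levy_continuity_exists[of "\<lambda>n. ?P (real n)" F] real_distribution_scaled_V conv[OF filterlim_real_sequentially] by blast
  have "conv_distr_at_top ?P Vinf"
    unfolding conv_distr_at_top_def
    by (intro allI impI levy_continuity real_distribution_scaled_V Vinf(1)) (simp only: Vinf(2) conv)
  then show ?thesis
    using Vinf \<zeta> Zlaw_unique F_eq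
    by (intro exI[of _ Vinf] exI[of _ \<zeta>]) (auto simp: Zlaw_iff mu1 a_def V_def \<psi>_def)
qed

end
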